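(* Let $n\ge 2$ be an integer, $\lambda=\frac{n-1}{2}$, let $a>0$, $c>0$, and let $q_\nu(l)=a_\nu l^\nu+a_{\nu-1}l^{\nu-1}+\dots+a_1l+a_0$ be a real polynomial of degree $\nu\ge 1$ that is positive and monotonically increasing for $l\ge 1$. For $\rho>0$ let $\Psi_\rho$ be the zonal function on the unit sphere $\mathcal S^n\subset\mathbb R^{n+1}$ $$\Psi_\rho(x)=\sum_{l=0}^\infty\widehat\Psi_\rho(l)\,C_l^\lambda(\cos\vartheta),\qquad \widehat\Psi_\rho(l)=\left[\rho^a q_\nu(l)\right]^c e^{-\rho^a q_\nu(l)}\cdot\frac{l+\lambda}{\lambda},$$ where $\cos\vartheta=x_1$ is the first coordinate of $x\in\mathcal S^n$. Then the uncertainty product $U(\Psi_\rho)$ satisfies $$U(\Psi_\rho)\le\mathcal O\left(\rho^{-\frac{a}{2\nu}}\right)\qquad\text{for }\rho\to0,$$ i.e. there exist constants $C>0$ and $\rho_0>0$ such that $U(\Psi_\rho)\le C\rho^{-\frac{a}{2\nu}}$ for all $\rho\in(0,\rho_0)$.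
   Context: $\mathcal S^n$ is the unit sphere in $\mathbb R^{n+1}$ and $\sigma$ its (Lebesgue) surface measure. The Gegenbauer polynomials $C_l^\lambda$ of order $\lambda$ and degree $l\in\mathbb N_0$ are defined by the generating function $\sum_{l=0}^\infty C_l^\lambda(t)\,r^l=(1-2tr+r^2)^{-\lambda}$, $t\in[-1,1]$. A function on $\mathcal S^n$ is called zonal if it depends only on $\vartheta$, where $x_1=\cos\vartheta$. For a $\mathcal C^2$ function $f$ on $\mathcal S^n$ with $\int_{\mathcal S^n}x\,|f(x)|^2\,d\sigma(x)\neq0$ (a vector in $\mathbb R^{n+1}$), the variances in space and momentum domain are $$\text{var}_S(f)=\left(\frac{\int_{\mathcal S^n}|f(x)|^2\,d\sigma(x)}{\int_{\mathcal S^n}x\,|f(x)|^2\,d\sigma(x)}\right)^2-1,\qquad \text{var}_M(f)=-\frac{\int_{\mathcal S^n}\Delta^\ast f(x)\cdot\overline{f(x)}\,d\sigma(x)}{\int_{\mathcal S^n}|f(x)|^2\,d\sigma(x)},$$ where the square of the vector in the denominator of $\text{var}_S$ is its squared Euclidean norm and $\Delta^\ast$ is the Laplace--Beltrami operator on $\mathcal S^n$. The uncertainty product of $f$ is $U(f)=\sqrt{\text{var}_S(f)}\cdot\sqrt{\text{var}_M(f)}$. For a zonal function $f(\cos\vartheta)=\sum_{l=0}^\infty\widehat f(l)\,C_l^\lambda(\cos\vartheta)$ these variances are equal to $$\text{var}_S(f)=\left(\frac{\sum_{l=0}^\infty\frac{\lambda}{l+\lambda}\binom{l+2\lambda-1}{l}|\widehat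 f(l)|^2}{\sum_{l=0}^\infty\binom{l+2\lambda}{l}\frac{\lambda^2\left[\overline{\widehat f(l)}\,\widehat f(l+1)+\widehat f(l)\,\overline{\widehat f(l+1)}\right]}{(l+\lambda)(l+\lambda+1)}}\right)^2-1,$$ $$\text{var}_M(f)=\frac{\sum_{l=1}^\infty\frac{l\lambda(l+2\lambda)}{l+\lambda}\binom{l+2\lambda-1}{l}|\widehat f(l)|^2}{\sum_{l=0}^\infty\frac{\lambda}{l+\lambda}\binom{l+2\lambda-1}{l}|\widehat f(l)|^2}$$ whenever the series converge. It is presupposed that the coefficient formula is meaningful at $l=0$, i.e. that the power $[\rho^a q_\nu(0)]^c$ is defined. *)

theory Defs
  imports "HOL-Analysis.Analysis" "HOL-Computational_Algebra.Polynomial"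
begin

text \<open>The coefficients of the power series in \<open>r\<close> of \<open>(1 - 2 t r + r^2) powr (-lam)\<close> around
  \<open>r = 0\<close>. The generating identity is required near \<open>r = 0\<close> only, which determines the coefficients
  uniquely and makes the definition meaningful for every real \<open>t\<close>.\<close>

definition gegenbauer :: "real \<Rightarrow> nat \<Rightarrow> real \<Rightarrow> real" where
  "gegenbauer lam l t =
     (THE C :: nat \<Rightarrow> real.
        \<forall>\<^sub>F r in nhds 0. (\<lambda>j. C j * r ^ j) sums ((1 - 2 * t * r + r\<^sup>2) powr (- lam))) l"

text \<open>The surface measure of the unit sphere as cone measure: the surface area of \<open>A\<close> is the
  dimension of the ambient space times the volume of the cone of all \<open>r x\<close>, \<open>0 < r \<le> 1\<close>, \<open>x \<in> A\<close>.
  Recall that \<open>sgn y = y /\<^sub>R norm y\<close> is the radial projection.\<close>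

definition surface_measure :: "'a::euclidean_space measure" where
  "surface_measure =
     scale_measure (of_nat DIM('a))
       (distr (restrict_space lborel (cball 0 1 - {0})) (restrict_space borel (sphere 0 1)) sgn)"

definition dir_deriv :: "'a::real_normed_vector \<Rightarrow> ('a \<Rightarrow> 'b::real_normed_vector) \<Rightarrow> 'a \<Rightarrow> 'b" where
  "dir_deriv v F y = vector_derivative (\<lambda>t. F (y + t *\<^sub>R v)) (at 0)"

definition C1_on :: "'a::euclidean_space set \<Rightarrow> ('a \<Rightarrow> 'b::real_normed_vector) \<Rightarrow> bool" where
  "C1_on S F \<longleftrightarrow> (\<forall>i\<in>Basis.
     (\<forall>y\<in>S. (\<lambda>t. F (y + t *\<^sub>R i)) differentiable (at 0)) \<and> continuous_on S (dir_deriv i F))"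

definition C2_on :: "'a::euclidean_space set \<Rightarrow> ('a \<Rightarrow> 'b::real_normed_vector) \<Rightarrow> bool" where
  "C2_on S F \<longleftrightarrow> C1_on S F \<and> (\<forall>i\<in>Basis. C1_on S (dir_deriv i F))"

text \<open>Functions on the sphere are represented by functions on the ambient space of which only the
  values on \<open>sphere 0 1\<close> matter. Differentiation on the sphere is differentiation of the
  extension that is constant along rays, which is smooth off the origin iff the function on the
  sphere is; the Laplacian of this extension restricts to the Laplace--Beltrami operator.\<close>

definition radial_ext :: "('a::euclidean_space \<Rightarrow> 'b) \<Rightarrow> 'a \<Rightarrow> 'b" where
  "radial_ext f y = f (sgn y)"

definition C2_on_sphere :: "('a::euclidean_space \<Rightarrow> 'b::real_normed_vector) \<Rightarrow> bool" where
  "C2_on_sphere f \<longleftrightarrow> C2_on (- {0}) (radial_ext f)"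

definition laplace_beltrami :: "('a::euclidean_space \<Rightarrow> 'b::real_normed_vector) \<Rightarrow> 'a \<Rightarrow> 'b" where
  "laplace_beltrami f x = (\<Sum>i\<in>Basis. dir_deriv i (dir_deriv i (radial_ext f)) x)"

definition mass :: "('a::euclidean_space \<Rightarrow> complex) \<Rightarrow> real" where
  "mass f = (LINT x|surface_measure. (cmod (f x))\<^sup>2)"

definition moment :: "('a::euclidean_space \<Rightarrow> complex) \<Rightarrow> 'a" where
  "moment f = (LINT x|surface_measure. (cmod (f x))\<^sup>2 *\<^sub>R x)"

definition var_S :: "('a::euclidean_space \<Rightarrow> complex) \<Rightarrow> real" where
  "var_S f = (mass f / norm (moment f))\<^sup>2 - 1"

text \<open>The integral below is real for \<open>f\<close> of class C2, as the Laplace--Beltrami operator is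
  symmetric; \<open>Re\<close> merely adjusts the type.\<close>

definition var_M :: "('a::euclidean_space \<Rightarrow> complex) \<Rightarrow> real" where
  "var_M f = - Re (LINT x|surface_measure. laplace_beltrami f x * cnj (f x)) / mass f"

definition uncertainty_product :: "('a::euclidean_space \<Rightarrow> complex) \<Rightarrow> real" where
  "uncertainty_product f = sqrt (var_S f) * sqrt (var_M f)"

text \<open>The conditions under which the variances, hence the uncertainty product, are defined.\<close>

definition uncertainty_defined :: "('a::euclidean_space \<Rightarrow> complex) \<Rightarrow> bool" where
  "uncertainty_defined f \<longleftrightarrow> C2_on_sphere f \<and> moment f \<noteq> 0"

text \<open>Real powers \<open>x^c\<close> with \<open>c > 0\<close>: a negative base is admitted exactly for integer exponents
  (\<open>powr\<close> alone would not give the correct value there).\<close>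

definition rpow_defined :: "real \<Rightarrow> real \<Rightarrow> bool" where
  "rpow_defined x c \<longleftrightarrow> 0 \<le> x \<or> c \<in> \<int>"

definition rpow :: "real \<Rightarrow> real \<Rightarrow> real" where
  "rpow x c = (if c \<in> \<int> then x powi \<lfloor>c\<rfloor> else x powr c)"

definition Psi_coeff :: "real \<Rightarrow> real \<Rightarrow> real \<Rightarrow> real poly \<Rightarrow> real \<Rightarrow> nat \<Rightarrow> real" where
  "Psi_coeff lam a c q \<rho> l =
     rpow (\<rho> powr a * poly q (real l)) c * exp (- (\<rho> powr a * poly q (real l)))
       * ((real l + lam) / lam)"

text \<open>The index \<open>k\<close> designates the coordinate that plays the role of the first one,
  \<open>x $ k = cos \<theta>\<close>.\<close>

definition Psi_term ::
    "real \<Rightarrow> real \<Rightarrow> real \<Rightarrow> real poly \<Rightarrow> 'd::finite \<Rightarrow> real \<Rightarrow> real ^ 'd \<Rightarrow> nat \<Rightarrow> real" where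
  "Psi_term lam a c q k \<rho> x l = Psi_coeff lam a c q \<rho> l * gegenbauer lam l (x $ k)"

definition Psi ::
    "real \<Rightarrow> real \<Rightarrow> real \<Rightarrow> real poly \<Rightarrow> 'd::finite \<Rightarrow> real \<Rightarrow> real ^ 'd \<Rightarrow> complex" where
  "Psi lam a c q k \<rho> x = complex_of_real (\<Sum>l. Psi_term lam a c q k \<rho> x l)"

end

theory Submission
  imports Defs
begin

text \<open>
  Write \<open>n = m + 2\<close>, so that \<open>lam = (m + 1) / 2\<close>, and \<open>g l = h (\<rho>\<^sup>a q(l))\<close> with \<open>h u = u\<^sup>c exp (- u)\<close>. Then
  \<open>\<Psi>\<close> is the series of the terms \<open>g l * (l + lam) / lam * C l\<close> in the Gegenbauer polynomials \<open>C l\<close>.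
  Let \<open>B l = (l + m + 1) choose (m + 1)\<close> (\<open>coupling_weight\<close>) and let \<open>N l\<close> be the dimension of the space of
  spherical harmonics of degree \<open>l\<close> (\<open>harmonic_weight\<close>). Up to the total measure of the sphere,
  orthogonality and the three-term recurrence give

    \<open>mass = \<Sum> N l * (g l)\<^sup>2\<close>,
    coordinate \<open>k\<close> of the moment \<open>= \<Sum> 2 * B l * g l * g (l + 1)\<close>,
    \<open>- \<integral> \<Delta>\<Psi> * \<Psi> = \<Sum> l * (l + 2 * lam) * N l * (g l)\<^sup>2\<close>.

  The argument rests on \<open>N l = B l + B (l - 1)\<close>, which turns the difference of the first two sums into a
  sum of squares: \<open>mass - moment = \<Sum> B l * (g (l + 1) - g l)\<^sup>2\<close> (\<open>harmonic_minus_coupling\<close>).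

  Put \<open>L = \<rho> powr (- a / \<nu>)\<close>. As \<open>q(l)\<close> is comparable to \<open>l\<^sup>\<nu>\<close>, the function \<open>g\<close> is bounded below by a positive
  constant for \<open>l\<close> between \<open>L\<close> and \<open>2 L\<close> and above by a multiple of \<open>exp (- \<beta> l / L)\<close>; hence the mass is at least of order \<open>L ^ n\<close> and
  the energy at most of order \<open>L ^ (n + 2)\<close> (\<open>harmonic_mass_ge\<close>, \<open>laplacian_energy_le\<close>). For the defect
  \<open>mass - moment\<close> smoothness of \<open>h\<close> at \<open>0\<close> is not available (\<open>c\<close> may be small), but \<open>h\<close> is unimodal and \<open>q\<close>
  is monotone, so that \<open>g\<close> has bounded variation. Since \<open>g\<close> is bounded, \<open>(g (l + 1) - g l)\<^sup>2\<close> is at most a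
  constant times \<open>\<bar>g (l + 1) - g l\<bar>\<close>, and Abel summation against the variation of \<open>g\<close> gives a bound of order
  \<open>L ^ (n - 1)\<close> (\<open>localisation_defect_le\<close>). Therefore \<open>var_S\<close> is at most of order \<open>1 / L\<close> and \<open>var_M\<close>
  at most of order \<open>L\<^sup>2\<close>, and the uncertainty product is at most of order \<open>sqrt L = \<rho> powr (- a / (2 * \<nu>))\<close>.

  The integral formulas come from the rotation invariance of the surface measure. Differentiating it
  along the rotations in the coordinate planes through the axis \<open>k\<close> yields
  \<open>\<integral> (1 - t\<^sup>2) p'(t) - n t p(t) = 0\<close> for \<open>t = x $ k\<close> and all polynomials \<open>p\<close> (\<open>zonal_int_divergence\<close>), which makes
  the operator \<open>(1 - t\<^sup>2) p'' - (2 * lam + 1) t p'\<close> symmetric; the Gegenbauer polynomials are its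
  eigenfunctions. Passing from finite sums to the series only needs that \<open>C l\<close> and its first two
  derivatives grow polynomially in \<open>l\<close> on \<open>[-1, 1]\<close>, uniformly in the argument.
\<close>

section \<open>Gegenbauer polynomials\<close>

text \<open>The Gegenbauer polynomials by their three-term recurrence; \<open>gegenbauer_eq_poly\<close> below
  identifies them with the coefficients of the generating function.\<close>
fun gegenbauer_poly :: "real \<Rightarrow> nat \<Rightarrow> real poly" where
  "gegenbauer_poly lam 0 = 1"
| "gegenbauer_poly lam (Suc 0) = [:0, 2 * lam:]"
| "gegenbauer_poly lam (Suc (Suc l)) = smult (1 / (real l + 2))
     (smult (2 * (real l + 1 + lam)) ([:0, 1:] * gegenbauer_poly lam (Suc l)) - smult (real l + 2 * lam) (gegenbauer_poly lam l))"

lemma gegenbauer_poly_recurrence: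
  "(real l + 2) * poly (gegenbauer_poly lam (Suc (Suc l))) t =
     2 * (real l + 1 + lam) * t * poly (gegenbauer_poly lam (Suc l)) t - (real l + 2 * lam) * poly (gegenbauer_poly lam l) t"
  by (simp add: field_simps)

lemma gegenbauer_poly_recurrence_deriv:
  "(real l + 2) * poly (pderiv (gegenbauer_poly lam (Suc (Suc l)))) t =
     2 * (real l + 1 + lam) * (poly (gegenbauer_poly lam (Suc l)) t + t * poly (pderiv (gegenbauer_poly lam (Suc l))) t)
       - (real l + 2 * lam) * poly (pderiv (gegenbauer_poly lam l)) t"
  by (simp add: pderiv_smult pderiv_diff pderiv_mult pderiv_pCons distrib_left)

declare gegenbauer_poly.simps(3) [simp del]

text \<open>Simultaneous induction along the recurrence: each of the two relations at \<open>l + 1\<close> is a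
  combination of the differentiated recurrence and of both relations at \<open>l\<close>.\<close>
lemma gegenbauer_poly_deriv_ladder:
  shows gegenbauer_poly_deriv_down: "t * poly (pderiv (gegenbauer_poly lam (Suc l))) t - poly (pderiv (gegenbauer_poly lam l)) t
           = (real l + 1) * poly (gegenbauer_poly lam (Suc l)) t"
    and gegenbauer_poly_deriv_up: "poly (pderiv (gegenbauer_poly lam (Suc l))) t - t * poly (pderiv (gegenbauer_poly lam l)) t
           = (real l + 2 * lam) * poly (gegenbauer_poly lam l) t"
proof (induction l)
  case 0
  { case 1 show ?case by (simp add: pderiv_pCons) }
  { case 2 show ?case by (simp add: pderiv_pCons) }
next
  case (Suc l)
  define G0 G1 G2 D0 D1 D2 where
    "G0 = poly (gegenbauer_poly lam l) t" and "G1 = poly (gegenbauer_poly lam (Suc l)) t" and "G2 = poly (gegenbauer_poly lam (Suc (Suc l))) t"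
    and "D0 = poly (pderiv (gegenbauer_poly lam l)) t" and "D1 = poly (pderiv (gegenbauer_poly lam (Suc l))) t"
    and "D2 = poly (pderiv (gegenbauer_poly lam (Suc (Suc l)))) t"
  note defs = G0_def[symmetric] G1_def[symmetric] G2_def[symmetric]
    D0_def[symmetric] D1_def[symmetric] D2_def[symmetric]
  have down: "t * D1 - D0 = (real l + 1) * G1" and up: "D1 - t * D0 = (real l + 2 * lam) * G0"
    using Suc.IH unfolding defs by auto
  have rec: "(real l + 2) * G2 = 2 * (real l + 1 + lam) * t * G1 - (real l + 2 * lam) * G0"
    using gegenbauer_poly_recurrence[of l lam t] unfolding defs .
  have recd: "(real l + 2) * D2 = 2 * (real l + 1 + lam) * (G1 + t * D1) - (real l + 2 * lam) * D0"
    using gegenbauer_poly_recurrence_deriv[of l lam t] unfolding defs .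
  have D0: "D0 = t * D1 - (real l + 1) * G1" using down by simp
  have "(real l + 2) * (D2 - t * D1 - (real l + 1 + 2 * lam) * G1) = 0"
    using recd unfolding D0 by (simp add: algebra_simps)
  moreover have pos: "real l + 2 \<noteq> 0" by linarith
  ultimately have up': "D2 - t * D1 = (real l + 1 + 2 * lam) * G1" by simp
  \<comment> \<open>\<open>up\<close> with \<open>D0\<close> eliminated determines \<open>D1 - t\<^sup>2 D1\<close>; subtract it from \<open>t\<close> times \<open>up'\<close>\<close>
  have "D1 - t * (t * D1 - (real l + 1) * G1) = (real l + 2 * lam) * G0" using up unfolding D0 .
  moreover have "t * D2 - t * (t * D1) = t * ((real l + 1 + 2 * lam) * G1)"
    using up' by (metis right_diff_distrib)
  ultimately have "t * D2 - D1 = (real l + 2) * G2" using rec by (simp add: algebra_simps)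
  { case 1 show ?case using \<open>t * D2 - D1 = _\<close> unfolding defs by (simp add: algebra_simps) }
  { case 2 show ?case using up' unfolding defs by (simp add: algebra_simps) }
qed

text \<open>The combination of the two ladder relations in which the derivative of the lower polynomial
  cancels. Its derivative is the differential equation, and its value at \<open>t = 1\<close> is the recursion
  for the values at the endpoint.\<close>
lemma gegenbauer_poly_deriv_weighted:
  "(1 - t\<^sup>2) * poly (pderiv (gegenbauer_poly lam (Suc l))) t =
     (real l + 2 * lam) * poly (gegenbauer_poly lam l) t - (real l + 1) * t * poly (gegenbauer_poly lam (Suc l)) t"
proof -
  have "t * (t * poly (pderiv (gegenbauer_poly lam (Suc l))) t - poly (pderiv (gegenbauer_poly lam l)) t)
           = t * ((real l + 1) * poly (gegenbauer_poly lam (Suc l)) t)"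
    by (simp only: gegenbauer_poly_deriv_down)
  with gegenbauer_poly_deriv_up[of lam l t] show ?thesis by (simp add: algebra_simps power2_eq_square)
qed

lemma gegenbauer_poly_ode:
  "(1 - t\<^sup>2) * poly (pderiv (pderiv (gegenbauer_poly lam l))) t - (2 * lam + 1) * t * poly (pderiv (gegenbauer_poly lam l)) t
     = - (real l * (real l + 2 * lam)) * poly (gegenbauer_poly lam l) t"
proof (cases l)
  case 0
  then show ?thesis by simp
next
  case (Suc j)
  have eq: "[:1, 0, -1:] * pderiv (gegenbauer_poly lam (Suc j)) =
      smult (real j + 2 * lam) (gegenbauer_poly lam j) - smult (real j + 1) ([:0, 1:] * gegenbauer_poly lam (Suc j))"
    using gegenbauer_poly_deriv_weighted[of _ lam j]
    by (subst poly_eq_poly_eq_iff[symmetric]) (auto simp: fun_eq_iff power2_eq_square algebra_simps)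
  have prod: "poly (pderiv (p * r)) t = poly p t * poly (pderiv r) t + poly r t * poly (pderiv p) t"
    for p r :: "real poly"
    by (simp only: pderiv_mult poly_add poly_mult)
  have "(1 - t\<^sup>2) * poly (pderiv (pderiv (gegenbauer_poly lam (Suc j)))) t - 2 * t * poly (pderiv (gegenbauer_poly lam (Suc j))) t =
      poly (pderiv ([:1, 0, -1:] * pderiv (gegenbauer_poly lam (Suc j)))) t"
    unfolding prod by (simp add: pderiv_pCons power2_eq_square algebra_simps)
  also have "\<dots> = poly (pderiv (smult (real j + 2 * lam) (gegenbauer_poly lam j) - smult (real j + 1) ([:0, 1:] * gegenbauer_poly lam (Suc j)))) t"
    unfolding eq ..
  also have "\<dots> = (real j + 2 * lam) * poly (pderiv (gegenbauer_poly lam j)) t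
        - (real j + 1) * (poly (gegenbauer_poly lam (Suc j)) t + t * poly (pderiv (gegenbauer_poly lam (Suc j))) t)"
    unfolding pderiv_diff pderiv_smult poly_diff poly_smult prod by (simp add: pderiv_pCons)
  finally have "(1 - t\<^sup>2) * poly (pderiv (pderiv (gegenbauer_poly lam (Suc j)))) t - 2 * t * poly (pderiv (gegenbauer_poly lam (Suc j))) t =
      (real j + 2 * lam) * poly (pderiv (gegenbauer_poly lam j)) t
        - (real j + 1) * (poly (gegenbauer_poly lam (Suc j)) t + t * poly (pderiv (gegenbauer_poly lam (Suc j))) t)" .
  moreover have "poly (pderiv (gegenbauer_poly lam j)) t =
      t * poly (pderiv (gegenbauer_poly lam (Suc j))) t - (real j + 1) * poly (gegenbauer_poly lam (Suc j)) t"
    using gegenbauer_poly_deriv_down[of t lam j] by linarith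
  ultimately show ?thesis unfolding Suc by (simp add: algebra_simps)
qed

lemma gegenbauer_poly_at_1: "(real l + 1) * poly (gegenbauer_poly lam (Suc l)) 1 = (real l + 2 * lam) * poly (gegenbauer_poly lam l) 1"
  using gegenbauer_poly_deriv_weighted[of 1 lam l] by simp

lemma gegenbauer_poly_minus: "poly (gegenbauer_poly lam l) (- t) = (- 1) ^ l * poly (gegenbauer_poly lam l) t"
proof (induction lam l rule: gegenbauer_poly.induct)
  case (3 lam l)
  have "(real l + 2) * poly (gegenbauer_poly lam (Suc (Suc l))) (- t)
      = (real l + 2) * ((- 1) ^ Suc (Suc l) * poly (gegenbauer_poly lam (Suc (Suc l))) t)"
    unfolding mult.left_commute[of "real l + 2" "(- 1) ^ Suc (Suc l)"] gegenbauer_poly_recurrence[of l lam t]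
      gegenbauer_poly_recurrence[of l lam "-t"] 3
    by (simp add: algebra_simps)
  moreover have "real l + 2 \<noteq> 0" by linarith
  ultimately show ?case by (metis mult_cancel_left)
qed auto

text \<open>Sonin's argument: with \<open>\<Lambda> = l * (l + 2 * lam)\<close> and \<open>G\<close> the polynomial, the differential
  equation shows that \<open>G\<^sup>2 + (1 - t\<^sup>2) * G'\<^sup>2 / \<Lambda>\<close> has derivative \<open>4 * lam * t * G'\<^sup>2 / \<Lambda>\<close>. It
  therefore increases on \<open>[0, 1]\<close>; it dominates \<open>G\<^sup>2\<close> and coincides with it at \<open>1\<close>. Negative
  arguments follow by parity.\<close>
lemma abs_gegenbauer_poly_le_at_1:
  assumes lam: "lam > 0" and t: "\<bar>t\<bar> \<le> 1"
  shows "\<bar>poly (gegenbauer_poly lam l) t\<bar> \<le> \<bar>poly (gegenbauer_poly lam l) 1\<bar>"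
proof -
  define G D D2 where "G = poly (gegenbauer_poly lam l)" and "D = poly (pderiv (gegenbauer_poly lam l))"
    and "D2 = poly (pderiv (pderiv (gegenbauer_poly lam l)))"
  define \<Lambda> where "\<Lambda> = real l * (real l + 2 * lam)"
  define E where "E = (\<lambda>s. (G s)\<^sup>2 + (1 - s\<^sup>2) * (D s)\<^sup>2 / \<Lambda>)"
  have pos: "(G s)\<^sup>2 \<le> (G 1)\<^sup>2" if s: "0 \<le> s" "s \<le> 1" for s
  proof (cases "l = 0")
    case True
    then show ?thesis by (simp add: G_def)
  next
    case False
    then have \<Lambda>: "\<Lambda> > 0" using lam by (simp add: \<Lambda>_def)
    have dE: "(E has_real_derivative 4 * lam * x * (D x)\<^sup>2 / \<Lambda>) (at x)" for x
    proof -
      have "(E has_real_derivative 2 * G x * D x + (- 2 * x * (D x)\<^sup>2 + (1 - x\<^sup>2) * (2 * D x * D2 x)) / \<Lambda>) (at x)"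
        unfolding E_def G_def D_def D2_def
        using \<Lambda> by (auto intro!: derivative_eq_intros simp: power2_eq_square field_simps)
      moreover have "(1 - x\<^sup>2) * (2 * D x * D2 x) = 2 * D x * ((2 * lam + 1) * x * D x - \<Lambda> * G x)"
      proof -
        have "(1 - x\<^sup>2) * D2 x = (2 * lam + 1) * x * D x - \<Lambda> * G x"
          using gegenbauer_poly_ode[of x lam l] by (simp add: G_def D_def D2_def \<Lambda>_def)
        then show ?thesis by (metis (no_types) mult.assoc mult.left_commute)
      qed
      then have "2 * G x * D x + (- 2 * x * (D x)\<^sup>2 + (1 - x\<^sup>2) * (2 * D x * D2 x)) / \<Lambda> = 4 * lam * x * (D x)\<^sup>2 / \<Lambda>"
        using \<Lambda> by (simp add: field_simps power2_eq_square)
      ultimately show ?thesis by simp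
    qed
    have "E s \<le> E 1"
    proof (rule DERIV_nonneg_imp_nondecreasing[OF s(2)])
      fix x assume "s \<le> x" "x \<le> 1"
      with s \<Lambda> lam dE show "\<exists>y. (E has_real_derivative y) (at x) \<and> 0 \<le> y"
        by (intro exI[of _ "4 * lam * x * (D x)\<^sup>2 / \<Lambda>"]) auto
    qed
    moreover have "(1 - s\<^sup>2) * (D s)\<^sup>2 / \<Lambda> \<ge> 0"
      using s \<Lambda> by (intro divide_nonneg_pos mult_nonneg_nonneg) (auto simp: power_le_one)
    ultimately show ?thesis by (simp add: E_def)
  qed
  have "(G t)\<^sup>2 \<le> (G 1)\<^sup>2"
  proof (cases "t \<ge> 0")
    case True
    with t pos show ?thesis by auto
  next
    case False
    then have "(G (- t))\<^sup>2 \<le> (G 1)\<^sup>2" using t by (intro pos) auto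
    moreover have "(G (- t))\<^sup>2 = (G t)\<^sup>2" unfolding G_def gegenbauer_poly_minus by (simp add: power_mult_distrib flip: power_mult)
    ultimately show ?thesis by simp
  qed
  then show ?thesis by (simp add: G_def abs_le_square_iff)
qed

lemma gegenbauer_poly_half_integer_at_1:
  "poly (gegenbauer_poly ((real m + 1) / 2) l) 1 = real ((l + m) choose m)"
proof (induction l)
  case (Suc l)
  have "Suc l * ((Suc l + m) choose m) = (Suc l + m) * ((l + m) choose m)"
    using Suc_times_binomial_eq[of "l + m" l]
      binomial_symmetric[of m "l + m"] binomial_symmetric[of "Suc l" "Suc (l + m)"]
    by (simp add: ac_simps del: binomial_Suc_Suc)
  from arg_cong[OF this, of real] have "(real l + 1) * real ((Suc l + m) choose m) = (real l + 1 + real m) * real ((l + m) choose m)"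
    by (simp add: algebra_simps del: binomial_Suc_Suc)
  also have "\<dots> = (real l + 1) * poly (gegenbauer_poly ((real m + 1) / 2) (Suc l)) 1"
    using gegenbauer_poly_at_1[of l "(real m + 1) / 2"] Suc by (simp add: algebra_simps)
  finally show ?case by (simp del: of_nat_Suc add: add_pos_pos)
qed simp

lemma binomial_add_le_power: "real ((l + m) choose m) \<le> (real l + 1) ^ m"
proof (induction m)
  case (Suc m)
  have "Suc m * ((l + Suc m) choose Suc m) = (l + Suc m) * ((l + m) choose m)"
    using Suc_times_binomial_eq[of "l + m" m] by (simp add: ac_simps del: binomial_Suc_Suc)
  from arg_cong[OF this, of real] have "(real m + 1) * real ((l + Suc m) choose Suc m) = (real l + (real m + 1)) * real ((l + m) choose m)"
    by (simp add: algebra_simps del: binomial_Suc_Suc)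
  also have "\<dots> \<le> ((real m + 1) * (real l + 1)) * (real l + 1) ^ m"
    using Suc by (intro mult_mono) (auto simp: algebra_simps)
  finally have "(real m + 1) * real ((l + Suc m) choose Suc m) \<le> (real m + 1) * (real l + 1) ^ Suc m"
    by (simp add: mult.assoc)
  then show ?case by (rule mult_left_le_imp_le) simp
qed simp

lemma abs_gegenbauer_poly_half_integer_le:
  assumes "\<bar>t\<bar> \<le> 1"
  shows "\<bar>poly (gegenbauer_poly ((real m + 1) / 2) l) t\<bar> \<le> (real l + 1) ^ m"
  using abs_gegenbauer_poly_le_at_1[of "(real m + 1) / 2" t l] assms binomial_add_le_power[of l m]
  by (simp add: gegenbauer_poly_half_integer_at_1)

text \<open>The sum of the two ladder relations expresses the derivative by values of the polynomials
  alone, so that polynomial bounds pass from the values to the derivatives.\<close>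
lemma gegenbauer_poly_deriv_two_step:
  "poly (pderiv (gegenbauer_poly lam (Suc (Suc l)))) t =
     poly (pderiv (gegenbauer_poly lam l)) t + 2 * (real l + 1 + lam) * poly (gegenbauer_poly lam (Suc l)) t"
  using gegenbauer_poly_deriv_up[of lam "Suc l" t] gegenbauer_poly_deriv_down[of t lam l] by (simp add: algebra_simps)

lemma gegenbauer_poly_deriv2_two_step:
  "poly (pderiv (pderiv (gegenbauer_poly lam (Suc (Suc l))))) t =
     poly (pderiv (pderiv (gegenbauer_poly lam l))) t + 2 * (real l + 1 + lam) * poly (pderiv (gegenbauer_poly lam (Suc l))) t"
proof -
  have "pderiv (gegenbauer_poly lam (Suc (Suc l))) = pderiv (gegenbauer_poly lam l) + smult (2 * (real l + 1 + lam)) (gegenbauer_poly lam (Suc l))"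
    by (subst poly_eq_poly_eq_iff[symmetric]) (auto simp: fun_eq_iff gegenbauer_poly_deriv_two_step)
  then show ?thesis by (simp add: pderiv_add pderiv_smult)
qed

text \<open>The inductive step uses \<open>(l + 2) ^ (p + 2) + (l + 2) ^ (p + 1) = (l + 2) ^ (p + 1) * (l + 3)\<close>:
  summing terms of size \<open>l ^ (p + 1)\<close> costs one more power of \<open>l\<close>.\<close>
lemma two_step_growth:
  fixes x y :: "nat \<Rightarrow> real"
  assumes step: "\<And>l. x (Suc (Suc l)) = x l + 2 * (real l + 1 + lam) * y (Suc l)"
    and y: "\<And>l. \<bar>y l\<bar> \<le> M * (real l + 1) ^ p" and lam: "lam \<ge> 0"
    and base: "\<bar>x 0\<bar> \<le> 2 * (1 + lam) * M" "\<bar>x (Suc 0)\<bar> \<le> 2 * (1 + lam) * M"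
  shows "\<bar>x l\<bar> \<le> 2 * (1 + lam) * M * (real l + 1) ^ (p + 2)"
proof -
  define c where "c = 2 * (1 + lam) * M"
  have M: "M \<ge> 0" using y[of 0] by simp
  then have c: "c \<ge> 0" using lam by (simp add: c_def)
  have "\<bar>x l\<bar> \<le> c * (real l + 1) ^ (p + 2)"
  proof (induction l rule: induct_nat_012)
    case 0
    then show ?case using base by (simp add: c_def)
  next
    case 1
    have "c * 1 \<le> c * 2 ^ (p + 2)" using c by (intro mult_left_mono one_le_power) auto
    then show ?case using base by (simp add: c_def)
  next
    case (ge2 l)
    have "\<bar>x (Suc (Suc l))\<bar> \<le> \<bar>x l\<bar> + 2 * (real l + 1 + lam) * \<bar>y (Suc l)\<bar>"
      using abs_triangle_ineq[of "x l" "2 * (real l + 1 + lam) * y (Suc l)"] lam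
      by (simp add: step abs_mult)
    also have "\<dots> \<le> c * (real l + 2) ^ (p + 2) + 2 * ((1 + lam) * (real l + 2)) * (M * (real l + 2) ^ p)"
    proof (intro add_mono mult_mono)
      show "\<bar>x l\<bar> \<le> c * (real l + 2) ^ (p + 2)"
        by (rule order_trans[OF ge2(1)]) (use c in \<open>intro mult_left_mono power_mono, auto\<close>)
      show "\<bar>y (Suc l)\<bar> \<le> M * (real l + 2) ^ p" using y[of "Suc l"] by (simp add: algebra_simps)
      show "real l + 1 + lam \<le> (1 + lam) * (real l + 2)" using lam by (simp add: algebra_simps)
    qed (use lam M in auto)
    also have "\<dots> = c * ((real l + 2) ^ (p + 2) + (real l + 2) ^ (p + 1))"
      by (simp add: c_def algebra_simps)
    also have "\<dots> = c * ((real l + 2) ^ (p + 1) * (real l + 3))"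
      by (simp add: algebra_simps)
    also have "\<dots> \<le> c * ((real l + 3) ^ (p + 1) * (real l + 3))"
      using c by (intro mult_left_mono mult_right_mono power_mono) auto
    finally show ?case by (simp add: algebra_simps)
  qed
  then show ?thesis by (simp add: c_def)
qed

lemma abs_gegenbauer_poly_deriv_le:
  assumes "\<bar>t\<bar> \<le> 1"
  shows "\<bar>poly (pderiv (gegenbauer_poly ((real m + 1) / 2) l)) t\<bar> \<le> (real m + 3) * (real l + 1) ^ (m + 2)"
proof -
  have "\<bar>poly (pderiv (gegenbauer_poly ((real m + 1) / 2) l)) t\<bar>
      \<le> 2 * (1 + (real m + 1) / 2) * 1 * (real l + 1) ^ (m + 2)"
    by (rule two_step_growth[OF gegenbauer_poly_deriv_two_step])
       (use abs_gegenbauer_poly_half_integer_le[OF assms] in \<open>auto simp: pderiv_pCons\<close>)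
  moreover have "2 * (1 + (real m + 1) / 2) * 1 = real m + 3" by (simp add: field_simps)
  ultimately show ?thesis by metis
qed

lemma abs_gegenbauer_poly_deriv2_le:
  assumes "\<bar>t\<bar> \<le> 1"
  shows "\<bar>poly (pderiv (pderiv (gegenbauer_poly ((real m + 1) / 2) l))) t\<bar>
           \<le> (real m + 3)\<^sup>2 * (real l + 1) ^ (m + 4)"
proof -
  have "\<bar>poly (pderiv (pderiv (gegenbauer_poly ((real m + 1) / 2) l))) t\<bar>
      \<le> 2 * (1 + (real m + 1) / 2) * (real m + 3) * (real l + 1) ^ (m + 2 + 2)"
    by (rule two_step_growth[OF gegenbauer_poly_deriv2_two_step])
       (use abs_gegenbauer_poly_deriv_le[OF assms] in \<open>auto simp: pderiv_pCons\<close>)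
  moreover have "2 * (1 + (real m + 1) / 2) * (real m + 3) = (real m + 3)\<^sup>2" "m + 2 + 2 = m + 4"
    by (simp_all add: field_simps power2_eq_square)
  ultimately show ?thesis by metis
qed

text \<open>Dividing by the power of \<open>r\<close> in front of the first coefficient not yet known to vanish and
  letting \<open>r\<close> tend to \<open>0\<close>.\<close>
lemma powser_zero_imp_coeff_zero:
  fixes d :: "nat \<Rightarrow> real"
  assumes "\<forall>\<^sub>F r in nhds 0. (\<lambda>j. d j * r ^ j) sums 0"
  shows "d n = 0"
proof (induction n rule: less_induct)
  case (less n)
  obtain e where e: "e > 0" "\<And>r. \<bar>r\<bar> < e \<Longrightarrow> (\<lambda>j. d j * r ^ j) sums 0"
    using assms by (auto simp: eventually_nhds_metric dist_real_def)
  have "(\<lambda>j. d (j + n) * r ^ j) sums 0" if r: "r \<noteq> 0" "norm r < e" for r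
  proof -
    have "(\<lambda>j. d (j + n) * r ^ (j + n)) sums (0 - (\<Sum>i<n. d i * r ^ i))"
      by (rule sums_split_initial_segment[OF e(2)]) (use r in auto)
    then have "(\<lambda>j. d (j + n) * r ^ (j + n) / r ^ n) sums (0 / r ^ n)"
      by (intro sums_divide) (simp add: less)
    then show ?thesis using r by (simp add: power_add)
  qed
  then have "((\<lambda>_. 0) \<longlongrightarrow> d (0 + n)) (at (0::real))"
    by (rule powser_limit_0_strong[OF e(1), where a = "\<lambda>j. d (j + n)"])
  then show ?case by (simp add: LIM_unique tendsto_const_iff)
qed

text \<open>A crude bound, valid for every real \<open>t\<close>, that gives the generating series a positive radius of
  convergence.\<close>
lemma gegenbauer_poly_geometric_bound:
  assumes lam: "lam > 0" and R: "R = 2 * (1 + lam) * (1 + \<bar>t\<bar>)"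
  shows "\<bar>poly (gegenbauer_poly lam l) t\<bar> \<le> R ^ l"
proof (induction l rule: induct_nat_012)
  case 1
  have "2 * lam * \<bar>t\<bar> \<le> 2 * (1 + lam) * (1 + \<bar>t\<bar>)" using lam by (intro mult_mono) auto
  then show ?case using lam by (simp add: R abs_mult mult_ac)
next
  case (ge2 l)
  have R1: "R \<ge> 1" unfolding R using lam mult_mono[of 1 "2 * (1 + lam)" 1 "1 + \<bar>t\<bar>"] by simp
  have "(real l + 2) * \<bar>poly (gegenbauer_poly lam (Suc (Suc l))) t\<bar> = \<bar>(real l + 2) * poly (gegenbauer_poly lam (Suc (Suc l))) t\<bar>"
    by (simp add: abs_mult)
  also have "\<dots> \<le> 2 * (real l + 1 + lam) * \<bar>t\<bar> * \<bar>poly (gegenbauer_poly lam (Suc l)) t\<bar> + (real l + 2 * lam) * \<bar>poly (gegenbauer_poly lam l) t\<bar>"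
    unfolding gegenbauer_poly_recurrence
    using abs_triangle_ineq4[of "2 * (real l + 1 + lam) * t * poly (gegenbauer_poly lam (Suc l)) t" "(real l + 2 * lam) * poly (gegenbauer_poly lam l) t"] lam
    by (simp add: abs_mult)
  also have "\<dots> \<le> 2 * ((real l + 2) * (1 + lam)) * \<bar>t\<bar> * R ^ Suc l + ((real l + 2) * (1 + lam)) * R ^ Suc l"
  proof (intro add_mono mult_mono)
    show "real l + 2 * lam \<le> (real l + 2) * (1 + lam)" "real l + 1 + lam \<le> (real l + 2) * (1 + lam)"
      using lam by (simp_all add: algebra_simps)
    show "\<bar>poly (gegenbauer_poly lam l) t\<bar> \<le> R ^ Suc l"
      using ge2(1) R1 power_increasing[of l "Suc l" R] by linarith
  qed (use lam ge2 R1 in auto)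
  also have "\<dots> \<le> (real l + 2) * R ^ Suc (Suc l)"
  proof -
    have "2 * (1 + lam) * \<bar>t\<bar> + (1 + lam) \<le> R" unfolding R using lam by (simp add: algebra_simps)
    then have "(2 * (1 + lam) * \<bar>t\<bar> + (1 + lam)) * ((real l + 2) * R ^ Suc l) \<le> R * ((real l + 2) * R ^ Suc l)"
      using R1 by (intro mult_right_mono) auto
    then show ?thesis by (simp add: algebra_simps)
  qed
  finally show ?case by (rule mult_left_le_imp_le) simp
qed simp

text \<open>By the recurrence the series \<open>F\<close> of the polynomials satisfies
  \<open>(1 - 2 t r + r\<^sup>2) F'(r) = 2 lam (t - r) F(r)\<close>, as does \<open>(1 - 2 t r + r\<^sup>2) powr (- lam)\<close>. Hence
  the quotient of the two has derivative zero near \<open>r = 0\<close> and equals its value \<open>1\<close> at \<open>0\<close>.\<close>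
lemma gegenbauer_eq_poly:
  assumes lam: "lam > 0"
  shows "gegenbauer lam l t = poly (gegenbauer_poly lam l) t"
proof -
  define R where "R = 2 * (1 + lam) * (1 + \<bar>t\<bar>)"
  have R: "R \<ge> 1" "2 * \<bar>t\<bar> \<le> R"
    unfolding R_def using lam mult_mono[of 1 "2 * (1 + lam)" 1 "1 + \<bar>t\<bar>"] mult_mono[of 2 "2 * (1 + lam)" "\<bar>t\<bar>" "1 + \<bar>t\<bar>"]
    by simp_all
  define \<delta> where "\<delta> = 1 / (2 * R)"
  have \<delta>: "\<delta> > 0" "\<delta> \<le> 1 / 2" "2 * \<bar>t\<bar> * \<delta> \<le> 1 / 2" using R by (auto simp: \<delta>_def field_simps)
  define F :: "real fps" where "F = Abs_fps (\<lambda>l. poly (gegenbauer_poly lam l) t)"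
  define u where "u = (\<lambda>r. 1 - 2 * t * r + r\<^sup>2)"
  have "summable (\<lambda>l. poly (gegenbauer_poly lam l) t * \<delta> ^ l)"
  proof (rule summable_comparison_test')
    show "summable (\<lambda>l. (1 / 2 :: real) ^ l)" by (intro summable_geometric) auto
    fix l show "norm (poly (gegenbauer_poly lam l) t * \<delta> ^ l) \<le> (1 / 2) ^ l"
      using mult_right_mono[OF gegenbauer_poly_geometric_bound[OF lam R_def, of l], of "\<delta> ^ l"] \<delta>(1) R(1)
      by (simp add: abs_mult \<delta>_def power_divide power_mult_distrib)
  qed
  from conv_radius_geI[OF this] have rad: "ereal \<delta> \<le> fps_conv_radius F"
    using \<delta> by (simp add: fps_conv_radius_def F_def)
  have ode: "fps_deriv F * fps_of_poly [:1, - 2 * t, 1:] = fps_of_poly [:2 * lam * t, - 2 * lam:] * F"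
  proof (rule fps_ext)
    fix n
    show "fps_nth (fps_deriv F * fps_of_poly [:1, - 2 * t, 1:]) n =
          fps_nth (fps_of_poly [:2 * lam * t, - 2 * lam:] * F) n"
    proof (cases n)
      case 0
      then show ?thesis by (simp add: fps_of_poly_pCons F_def)
    next
      case (Suc n')
      then show ?thesis
        using gegenbauer_poly_recurrence[of n' lam t]
        by (cases n') (simp_all add: fps_of_poly_pCons F_def algebra_simps)
    qed
  qed
  have u: "u r > 0" if "\<bar>r\<bar> < \<delta>" for r
  proof -
    have "\<bar>2 * t * r\<bar> \<le> 2 * \<bar>t\<bar> * \<delta>" using that by (simp add: abs_mult mult_left_mono)
    then have "2 * t * r \<le> 1 / 2" using \<delta>(3) by linarith
    then show ?thesis unfolding u_def using zero_le_power2[of r] by linarith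
  qed
  have deriv0: "((\<lambda>r. eval_fps F r * u r powr lam) has_real_derivative 0) (at r within ball 0 \<delta>)"
    if r: "r \<in> ball 0 \<delta>" for r
  proof -
    have r': "\<bar>r\<bar> < \<delta>" using r by simp
    then have nr: "ereal (norm r) < fps_conv_radius F" using rad
      by (metis ereal_less(3) less_ereal.simps(1) order_less_le_trans real_norm_def)
    then have nr': "ereal (norm r) < fps_conv_radius (fps_deriv F)"
      using fps_conv_radius_deriv[of F] by (rule order_less_le_trans)
    have "eval_fps (fps_deriv F) r * u r = 2 * lam * (t - r) * eval_fps F r"
      using arg_cong[OF ode, of "\<lambda>f. eval_fps f r"] nr nr'
      by (simp add: eval_fps_mult u_def algebra_simps power2_eq_square)
    then have eq: "eval_fps (fps_deriv F) r = 2 * lam * (t - r) * eval_fps F r / u r"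
      using u[OF r'] by (simp add: field_simps)
    have "(u has_real_derivative (2 * r - 2 * t)) (at r within ball 0 \<delta>)"
      unfolding u_def by (auto intro!: derivative_eq_intros)
    then have "((\<lambda>r. u r powr lam) has_real_derivative (lam * u r powr (lam - 1) * (2 * r - 2 * t))) (at r within ball 0 \<delta>)"
      using u[OF r'] by (auto intro!: derivative_eq_intros)
    then have "((\<lambda>r. eval_fps F r * u r powr lam) has_real_derivative
        (eval_fps (fps_deriv F) r * u r powr lam + (lam * u r powr (lam - 1) * (2 * r - 2 * t)) * eval_fps F r)) (at r within ball 0 \<delta>)"
      by (intro DERIV_mult has_field_derivative_eval_fps nr)
    moreover have "eval_fps (fps_deriv F) r * u r powr lam + (lam * u r powr (lam - 1) * (2 * r - 2 * t)) * eval_fps F r = 0"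
      unfolding eq using u[OF r'] by (simp add: powr_diff field_simps)
    ultimately show ?thesis by simp
  qed
  obtain c0 where c0: "\<And>r. r \<in> ball 0 \<delta> \<Longrightarrow> eval_fps F r * u r powr lam = c0"
    using has_field_derivative_zero_constant[OF convex_ball deriv0] by auto
  have "c0 = 1" using c0[of 0] \<delta> by (simp add: u_def F_def eval_fps_at_0)
  have gen: "(\<lambda>j. poly (gegenbauer_poly lam j) t * r ^ j) sums (u r powr (- lam))" if r: "\<bar>r\<bar> < \<delta>" for r
  proof -
    have "ereal (norm r) < fps_conv_radius F" using rad r
      by (metis ereal_less(3) less_ereal.simps(1) order_less_le_trans real_norm_def)
    from summable_fps[OF this] have "(\<lambda>j. poly (gegenbauer_poly lam j) t * r ^ j) sums eval_fps F r"
      by (simp add: F_def eval_fps_def summable_sums)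
    moreover have "eval_fps F r = u r powr (- lam)"
      using c0[of r] \<open>c0 = 1\<close> r u[OF r] by (simp add: powr_minus field_simps)
    ultimately show ?thesis by simp
  qed
  have ev: "\<forall>\<^sub>F r in nhds 0. (\<lambda>j. poly (gegenbauer_poly lam j) t * r ^ j) sums ((1 - 2 * t * r + r\<^sup>2) powr (- lam))"
    using gen \<delta>(1) unfolding u_def eventually_nhds_metric dist_real_def by auto
  have "(THE C :: nat \<Rightarrow> real. \<forall>\<^sub>F r in nhds 0. (\<lambda>j. C j * r ^ j) sums ((1 - 2 * t * r + r\<^sup>2) powr (- lam)))
      = (\<lambda>j. poly (gegenbauer_poly lam j) t)"
  proof (rule the_equality)
    show "\<forall>\<^sub>F r in nhds 0. (\<lambda>j. poly (gegenbauer_poly lam j) t * r ^ j) sums ((1 - 2 * t * r + r\<^sup>2) powr (- lam))"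
      by (rule ev)
    fix C :: "nat \<Rightarrow> real"
    assume "\<forall>\<^sub>F r in nhds 0. (\<lambda>j. C j * r ^ j) sums ((1 - 2 * t * r + r\<^sup>2) powr (- lam))"
    with ev have *: "\<forall>\<^sub>F r in nhds 0. (\<lambda>j. (C j - poly (gegenbauer_poly lam j) t) * r ^ j) sums 0"
    proof eventually_elim
      case (elim r)
      from sums_diff[OF elim(2,1)] show ?case by (simp add: algebra_simps)
    qed
    show "C = (\<lambda>j. poly (gegenbauer_poly lam j) t)"
      using powser_zero_imp_coeff_zero[OF *] by (auto simp: fun_eq_iff)
  qed
  then show ?thesis unfolding gegenbauer_def by simp
qed

section \<open>Rotation invariance of the surface measure\<close>

lemma space_surface_measure [simp]: "space (surface_measure :: 'a::euclidean_space measure) = sphere 0 1"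
  by (simp add: surface_measure_def space_scale_measure space_restrict_space)

lemma sets_surface_measure [measurable_cong]:
  "sets (surface_measure :: 'a::euclidean_space measure) = sets (restrict_space borel (sphere 0 1))"
  by (simp add: surface_measure_def)

lemma sgn_measurable_punctured_ball:
  "sgn \<in> restrict_space lborel (cball 0 1 - {0 :: 'a::euclidean_space}) \<rightarrow>\<^sub>M restrict_space borel (sphere 0 1)"
proof (rule measurable_restrict_space2)
  show "sgn \<in> space (restrict_space lborel (cball 0 1 - {0 :: 'a})) \<rightarrow> sphere 0 1"
    by (auto simp: space_restrict_space norm_sgn)
  have "(sgn :: 'a \<Rightarrow> 'a) \<in> borel_measurable borel"
    unfolding sgn_div_norm[abs_def] by measurable
  then show "(sgn :: 'a \<Rightarrow> 'a) \<in> restrict_space lborel (cball 0 1 - {0}) \<rightarrow>\<^sub>M borel"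
    by (intro measurable_restrict_space1) simp
qed

text \<open>Expresses the surface measure by the volume of a cone in the ambient space, on which linear
  maps act.\<close>
lemma emeasure_surface_measure:
  fixes A :: "'a::euclidean_space set"
  assumes "A \<in> sets surface_measure"
  shows "emeasure surface_measure A = of_nat DIM('a) * emeasure lborel (sgn -` A \<inter> (cball 0 1 - {0}))"
    and "sgn -` A \<inter> (cball 0 1 - {0}) \<in> sets borel"
proof -
  have A: "A \<in> sets (restrict_space borel (sphere 0 1))"
    using assms by (simp add: sets_surface_measure)
  have *: "sgn -` A \<inter> space (restrict_space lborel (cball 0 1 - {0 :: 'a})) = sgn -` A \<inter> (cball 0 1 - {0})"
    by (simp add: space_restrict_space)
  have "sgn -` A \<inter> (cball 0 1 - {0}) \<in> sets (restrict_space lborel (cball 0 1 - {0 :: 'a}))"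
    using measurable_sets[OF sgn_measurable_punctured_ball A] unfolding * .
  then show "sgn -` A \<inter> (cball 0 1 - {0}) \<in> sets borel"
    by (subst (asm) sets_restrict_space_iff) auto
  show "emeasure surface_measure A = of_nat DIM('a) * emeasure lborel (sgn -` A \<inter> (cball 0 1 - {0}))"
    unfolding surface_measure_def emeasure_scale_measure
    by (subst emeasure_distr[OF sgn_measurable_punctured_ball A], unfold *, subst emeasure_restrict_space) auto
qed

lemma emeasure_surface_sphere:
  "emeasure surface_measure (sphere 0 1 :: 'a::euclidean_space set) = of_nat DIM('a) * emeasure lborel (cball 0 1 :: 'a set)"
proof -
  have *: "sgn -` sphere 0 1 \<inter> (cball 0 1 - {0}) = (cball 0 1 - {0 :: 'a})"
    by (auto simp: norm_sgn)
  have "emeasure lborel (cball 0 1 - {0 :: 'a}) = emeasure lborel (cball 0 1 :: 'a set)"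
    by (subst emeasure_Diff) auto
  moreover have "(sphere 0 1 :: 'a set) \<in> sets surface_measure"
    using sets.top[of "surface_measure :: 'a measure"] by simp
  ultimately show ?thesis
    using emeasure_surface_measure(1)[of "sphere 0 1 :: 'a set"] by (simp only: *)
qed

lemma finite_surface_measure: "finite_measure (surface_measure :: 'a::euclidean_space measure)"
proof
  have "emeasure lborel (cball 0 1 :: 'a set) < \<infinity>" by (rule emeasure_bounded_finite) simp
  then show "emeasure (surface_measure :: 'a measure) (space surface_measure) \<noteq> \<infinity>"
    by (simp add: emeasure_surface_sphere ennreal_mult_eq_top_iff less_top)
qed

interpretation surface: finite_measure "surface_measure :: 'a::euclidean_space measure"
  by (rule finite_surface_measure)

lemma measure_surface_sphere_pos: "measure surface_measure (sphere 0 1 :: 'a::euclidean_space set) > 0"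
proof -
  have "measure lborel (cball 0 1 :: 'a set) > 0"
    by (simp add: content_cball_pos)
  then have "emeasure surface_measure (sphere 0 1 :: 'a set) \<noteq> 0"
    unfolding emeasure_surface_sphere by (auto simp: measure_def)
  then show ?thesis
    by (simp add: surface.emeasure_eq_measure zero_less_measure_iff)
qed

lemma surface_measurable_continuous:
  fixes f :: "'a::euclidean_space \<Rightarrow> 'b::euclidean_space"
  assumes "continuous_on (sphere 0 1) f"
  shows "f \<in> borel_measurable surface_measure"
  using borel_measurable_continuous_on_restrict[OF assms]
  by (simp add: measurable_cong_sets[OF sets_surface_measure refl])

lemma integrable_surface_continuous:
  fixes f :: "'a::euclidean_space \<Rightarrow> 'b::euclidean_space"
  assumes "continuous_on (sphere 0 1) f"
  shows "integrable surface_measure f"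
proof -
  have "compact (f ` sphere 0 1)"
    by (intro compact_continuous_image assms compact_sphere)
  then obtain B where "\<forall>x\<in>sphere 0 1. norm (f x) \<le> B"
    using compact_imp_bounded[of "f ` sphere 0 1"] by (auto simp: bounded_iff)
  then show ?thesis
    by (intro surface.integrable_const_bound[where B = B] AE_I2 surface_measurable_continuous[OF assms]) simp
qed

definition volume_preserving :: "('a::euclidean_space \<Rightarrow> 'a) \<Rightarrow> bool" where
  "volume_preserving f \<longleftrightarrow>
     (\<forall>S\<in>lmeasurable. f ` S \<in> lmeasurable \<and> measure lebesgue (f ` S) = measure lebesgue S)"

lemma volume_preservingD:
  assumes "volume_preserving f" "S \<in> lmeasurable"
  shows "f ` S \<in> lmeasurable" "measure lebesgue (f ` S) = measure lebesgue S"
  using assms by (auto simp: volume_preserving_def)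

lemma volume_preserving_comp:
  assumes "volume_preserving f" "volume_preserving g"
  shows "volume_preserving (f \<circ> g)"
  using assms by (simp add: volume_preserving_def image_comp[symmetric] del: o_apply)

definition shear :: "'d::finite \<Rightarrow> 'd \<Rightarrow> real \<Rightarrow> real ^ 'd \<Rightarrow> real ^ 'd" where
  "shear m n c x = (\<chi> i. if i = m then x $ m + c * x $ n else x $ i)"

text \<open>Linear maps preserve volume as soon as they preserve the volume of boxes.\<close>
lemma volume_preserving_unit_shear:
  fixes m n :: "'d::finite"
  assumes "m \<noteq> n"
  shows "volume_preserving (shear m n 1)"
  unfolding volume_preserving_def
proof (intro ballI)
  fix S :: "(real ^ 'd) set" assume S: "S \<in> lmeasurable"
  have lin: "linear (shear m n 1)"
    by (rule linearI) (auto simp: shear_def vec_eq_iff algebra_simps)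
  have "measure lebesgue (shear m n 1 ` cbox a b) = 1 * measure lebesgue (cbox a b)" for a b :: "real ^ 'd"
  proof (cases "cbox a b = {}")
    case False
    \<comment> \<open>\<open>measure_shear_interval\<close> is about boxes with nonnegative coordinate \<open>n\<close>: translate by \<open>v\<close>, shear, translate back by \<open>w\<close>\<close>
    define v :: "real ^ 'd" where "v = (\<chi> i. if i = n then - a $ n else 0)"
    define w :: "real ^ 'd" where "w = (\<chi> i. if i = m \<or> i = n then a $ n else 0)"
    have ne: "cbox (v + a) (v + b) \<noteq> {}" using False by (metis cbox_translation image_is_empty)
    have "shear m n 1 ` cbox a b = (+) w ` shear m n 1 ` (+) v ` cbox a b"
      using assms unfolding image_comp o_def by (force simp: vec_eq_iff shear_def v_def w_def)
    also have "\<dots> = (+) w ` shear m n 1 ` cbox (v + a) (v + b)"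
      by (simp add: cbox_translation)
    finally have "measure lebesgue (shear m n 1 ` cbox a b) = measure lebesgue (shear m n 1 ` cbox (v + a) (v + b))"
      by (simp only: measure_translation)
    also have "\<dots> = measure lebesgue (cbox (v + a) (v + b))"
      using measure_shear_interval[OF assms ne] unfolding shear_def mult_1 by (simp add: v_def)
    also have "\<dots> = measure lebesgue ((+) v ` cbox a b)" by (simp only: cbox_translation)
    finally show ?thesis by (simp only: measure_translation mult_1)
  qed simp
  from measure_linear_sufficient[OF lin S this]
  show "shear m n 1 ` S \<in> lmeasurable \<and> measure lebesgue (shear m n 1 ` S) = measure lebesgue S" by simp
qed

lemma volume_preserving_shear:
  fixes m n :: "'d::finite"
  assumes "m \<noteq> n"
  shows "volume_preserving (shear m n c)"
proof (cases "c = 0")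
  case True
  then have "shear m n c = id" by (auto simp: shear_def fun_eq_iff vec_eq_iff)
  then show ?thesis by (simp add: volume_preserving_def)
next
  case False
  \<comment> \<open>conjugating the unit shear with the dilation of the coordinate \<open>n\<close> by \<open>c\<close> gives the shear by \<open>c\<close>\<close>
  define d where "d = (\<lambda>s i. if i = n then s else 1 :: real)"
  have pd: "prod (d s) UNIV = s" for s
    unfolding d_def by (simp add: prod.delta)
  have conj: "shear m n c = (\<lambda>x. \<chi> i. d (1 / c) i * x $ i) \<circ> shear m n 1 \<circ> (\<lambda>x. \<chi> i. d c i * x $ i)"
    using assms False by (auto simp: shear_def fun_eq_iff vec_eq_iff d_def)
  show ?thesis unfolding volume_preserving_def
  proof (intro ballI)
    fix S :: "(real ^ 'd) set" assume S: "S \<in> lmeasurable"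
    define S1 where "S1 = (\<lambda>x. \<chi> i. d c i * x $ i) ` S"
    define S2 where "S2 = shear m n 1 ` S1"
    have S1: "S1 \<in> lmeasurable" "measure lebesgue S1 = \<bar>c\<bar> * measure lebesgue S"
      unfolding S1_def using measurable_stretch[OF S] measure_stretch[OF S, of "d c"] by (simp_all add: pd)
    have S2: "S2 \<in> lmeasurable" "measure lebesgue S2 = measure lebesgue S1"
      unfolding S2_def by (intro volume_preservingD[OF volume_preserving_unit_shear[OF assms]] S1)+
    have "shear m n c ` S = (\<lambda>x. \<chi> i. d (1 / c) i * x $ i) ` S2"
      unfolding conj S2_def S1_def by (simp add: image_comp)
    then show "shear m n c ` S \<in> lmeasurable \<and> measure lebesgue (shear m n c ` S) = measure lebesgue S"
      using measurable_stretch[OF S2(1)] measure_stretch[OF S2(1), of "d (1 / c)"] False S1 S2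
      by (simp add: pd)
  qed
qed

text \<open>An orthogonal map commutes with the radial projection, so the cone over the preimage of a set
  is the preimage of the cone; preservation of volume then gives preservation of the surface
  measure.\<close>
lemma surface_integral_orthogonal:
  fixes f :: "real ^ 'd \<Rightarrow> real" and T :: "real ^ 'd \<Rightarrow> real ^ 'd"
  assumes T: "orthogonal_transformation T" and vol: "volume_preserving T" and f: "f \<in> borel_measurable surface_measure"
  shows "(LINT x|surface_measure. f (T x)) = (LINT x|surface_measure. f x)"
proof -
  let ?M = "surface_measure :: (real ^ 'd) measure"
  have norm_T: "norm (T x) = norm x" for x using T by (simp add: orthogonal_transformation)
  have linT: "linear T" using T by (simp add: orthogonal_transformation)
  have "T \<in> borel_measurable ?M"
    by (intro surface_measurable_continuous linear_continuous_on) (simp add: linT linear_conv_bounded_linear[symmetric])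
  then have T_meas: "T \<in> ?M \<rightarrow>\<^sub>M ?M"
    by (subst measurable_cong_sets[OF refl sets_surface_measure])
       (rule measurable_restrict_space2, auto simp: norm_T)
  have "distr ?M ?M T = ?M"
  proof (rule measure_eqI)
    fix A assume "A \<in> sets (distr ?M ?M T)"
    then have A: "A \<in> sets ?M" by simp
    define S where "S = sgn -` A \<inter> (cball 0 1 - {0})"
    define A' where "A' = T -` A \<inter> sphere 0 1"
    have A': "A' \<in> sets ?M" using measurable_sets[OF T_meas A] by (simp add: A'_def)
    have S: "S \<in> sets borel" unfolding S_def by (rule emeasure_surface_measure(2)[OF A])
    have T0: "T x = 0 \<longleftrightarrow> x = 0" for x using norm_T[of x] by (metis norm_eq_zero)
    have Ts: "T (sgn x) = sgn (T x)" for x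
      using linear_cmul[OF linT, of "inverse (norm x)" x] by (simp add: sgn_div_norm norm_T)
    have vim: "sgn -` A' \<inter> (cball 0 1 - {0}) = T -` S"
      by (auto simp: S_def A'_def T0 norm_T Ts norm_sgn)
    have TS: "T -` S \<in> sets borel"
      using emeasure_surface_measure(2)[OF A'] unfolding vim .
    have bdd: "bounded S" "bounded (T -` S)"
      by (rule bounded_subset[OF bounded_cball[of 0 1]]; auto simp: S_def norm_T)+
    have Sl: "S \<in> lmeasurable" and TSl: "T -` S \<in> lmeasurable"
      using bdd S TS by (auto intro!: bounded_set_imp_lmeasurable)
    have "T ` (T -` S) = S"
      using orthogonal_transformation_surj[OF T] by (rule surj_image_vimage_eq)
    then have "measure lebesgue (T -` S) = measure lebesgue S"
      using volume_preservingD(2)[OF vol TSl] by simp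
    then have "emeasure lebesgue (T -` S) = emeasure lebesgue S"
      using Sl TSl by (metis emeasure_eq_measure2)
    then have "emeasure lborel (T -` S) = emeasure lborel S" using S TS by simp
    then have "emeasure ?M A' = emeasure ?M A"
      by (simp only: emeasure_surface_measure(1)[OF A] emeasure_surface_measure(1)[OF A'] vim S_def[symmetric])
    then show "emeasure (distr ?M ?M T) A = emeasure ?M A"
      using A T_meas by (simp add: emeasure_distr A'_def)
  qed simp
  then show ?thesis using integral_distr[OF T_meas f] by simp
qed

definition rotation :: "'d::finite \<Rightarrow> 'd \<Rightarrow> real \<Rightarrow> real ^ 'd \<Rightarrow> real ^ 'd" where
  "rotation k j \<theta> x = (\<chi> i. if i = k then cos \<theta> * x $ k - sin \<theta> * x $ j
     else if i = j then sin \<theta> * x $ k + cos \<theta> * x $ j else x $ i)"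

lemma orthogonal_transformation_rotation:
  assumes "j \<noteq> k"
  shows "orthogonal_transformation (rotation k j \<theta>)"
  unfolding orthogonal_transformation
proof (intro conjI allI)
  show "linear (rotation k j \<theta>)"
    by (rule linearI) (auto simp: rotation_def vec_eq_iff algebra_simps)
  fix x :: "real ^ 'a"
  have split: "(\<Sum>i\<in>UNIV. (y $ i)\<^sup>2) = (y $ k)\<^sup>2 + ((y $ j)\<^sup>2 + (\<Sum>i\<in>UNIV - {k} - {j}. (y $ i)\<^sup>2))" for y :: "real ^ 'a"
    using assms by (simp add: sum.remove[of UNIV k] sum.remove[of "UNIV - {k}" j])
  have "(cos \<theta> * a - sin \<theta> * b)\<^sup>2 + (sin \<theta> * a + cos \<theta> * b)\<^sup>2 = ((sin \<theta>)\<^sup>2 + (cos \<theta>)\<^sup>2) * (a\<^sup>2 + b\<^sup>2)" for a b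
    by algebra
  then have "(cos \<theta> * x $ k - sin \<theta> * x $ j)\<^sup>2 + (sin \<theta> * x $ k + cos \<theta> * x $ j)\<^sup>2
     = ((sin \<theta>)\<^sup>2 + (cos \<theta>)\<^sup>2) * ((x $ k)\<^sup>2 + (x $ j)\<^sup>2)"
    by blast
  then have "(cos \<theta> * x $ k - sin \<theta> * x $ j)\<^sup>2 + (sin \<theta> * x $ k + cos \<theta> * x $ j)\<^sup>2 = (x $ k)\<^sup>2 + (x $ j)\<^sup>2"
    by simp
  moreover have "(\<Sum>i\<in>UNIV - {k} - {j}. (rotation k j \<theta> x $ i)\<^sup>2) = (\<Sum>i\<in>UNIV - {k} - {j}. (x $ i)\<^sup>2)"
    by (intro sum.cong) (auto simp: rotation_def)
  ultimately have "(\<Sum>i\<in>UNIV. (rotation k j \<theta> x $ i)\<^sup>2) = (\<Sum>i\<in>UNIV. (x $ i)\<^sup>2)"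
    using assms unfolding split by (simp add: rotation_def)
  then show "norm (rotation k j \<theta> x) = norm x"
    by (simp add: norm_vec_def L2_set_def)
qed

text \<open>A plane rotation is the product of three shears. The formula degenerates where the sine
  vanishes, but small positive angles suffice for differentiating at angle zero.\<close>
lemma volume_preserving_rotation:
  assumes "j \<noteq> k" and s: "sin \<theta> \<noteq> 0"
  shows "volume_preserving (rotation k j \<theta>)"
proof -
  \<comment> \<open>the tangent of half the angle\<close>
  define t where "t = (1 - cos \<theta>) / sin \<theta>"
  have ts: "t * sin \<theta> = 1 - cos \<theta>" using s by (simp add: t_def)
  have "t * (1 + cos \<theta>) = (1 - (cos \<theta>)\<^sup>2) / sin \<theta>"
    by (simp add: t_def power2_eq_square algebra_simps)
  also have "\<dots> = (sin \<theta>)\<^sup>2 / sin \<theta>" by (simp only: sin_squared_eq)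
  also have "\<dots> = sin \<theta>" using s by (simp only: power2_eq_square) simp
  finally have tc: "t * (1 + cos \<theta>) = sin \<theta>" .
  have eq1: "y + sin \<theta> * (x - t * y) = sin \<theta> * x + cos \<theta> * y" for x y
  proof -
    have "y + sin \<theta> * (x - t * y) = sin \<theta> * x + (1 - t * sin \<theta>) * y" by (simp add: algebra_simps)
    then show ?thesis by (simp add: ts)
  qed
  have eq2: "x - t * y - t * (sin \<theta> * x + cos \<theta> * y) = cos \<theta> * x - sin \<theta> * y" for x y
  proof -
    have "x - t * y - t * (sin \<theta> * x + cos \<theta> * y) = (1 - t * sin \<theta>) * x - t * (1 + cos \<theta>) * y"
      by (simp add: algebra_simps)
    then show ?thesis by (simp only: ts tc) simp
  qed
  have "rotation k j \<theta> = shear k j (- t) \<circ> shear j k (sin \<theta>) \<circ> shear k j (- t)"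
    using assms by (auto simp: fun_eq_iff vec_eq_iff rotation_def shear_def eq1 eq2)
  then show ?thesis using assms(1) by (auto intro!: volume_preserving_comp volume_preserving_shear)
qed

lemma continuous_on_poly_coord [continuous_intros]:
  fixes p :: "real poly"
  shows "continuous_on S (\<lambda>x :: real ^ 'd. poly p (x $ k))"
  by (intro continuous_intros)

lemma abs_coord_le_1: "x \<in> sphere 0 1 \<Longrightarrow> \<bar>x $ k\<bar> \<le> 1" for x :: "real ^ 'd"
  using component_le_norm_cart[of x k] by simp

text \<open>The function \<open>p (x $ k) * x $ j\<close> has the same integral after rotation in the plane of the axes
  \<open>k\<close> and \<open>j\<close> by any small positive angle; the integrand here is the derivative with respect to the
  angle at \<open>0\<close>. The derivatives at all angles are uniformly bounded on the sphere, which justifies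
  differentiation under the integral.\<close>
lemma surface_integral_rotation_field:
  fixes k j :: "'d::finite" and p :: "real poly"
  assumes "j \<noteq> k"
  shows "(LINT x|surface_measure. poly p (x $ k) * x $ k - poly (pderiv p) (x $ k) * (x $ j)\<^sup>2) = 0"
proof -
  define \<Phi> where "\<Phi> = (\<lambda>x :: real ^ 'd. poly p (x $ k) * x $ j)"
  define u v where "u = (\<lambda>(x :: real ^ 'd) \<theta>. cos \<theta> * x $ k - sin \<theta> * x $ j)"
    and "v = (\<lambda>(x :: real ^ 'd) \<theta>. sin \<theta> * x $ k + cos \<theta> * x $ j)"
  define G where "G = (\<lambda>\<theta> x. poly p (u x \<theta>) * v x \<theta>)"
  have G_rot: "G \<theta> x = \<Phi> (rotation k j \<theta> x)" for \<theta> x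
    using assms by (simp add: G_def \<Phi>_def rotation_def u_def v_def)
  have cont: "continuous_on (sphere 0 1) \<Phi>" unfolding \<Phi>_def by (intro continuous_intros)
  have cont_G: "continuous_on (sphere 0 1) (G \<theta>)" for \<theta>
    unfolding G_def u_def v_def by (intro continuous_intros)
  have int_G: "(LINT x|surface_measure. G \<theta> x) = (LINT x|surface_measure. \<Phi> x)"
    if "sin \<theta> \<noteq> 0 \<or> \<theta> = 0" for \<theta>
  proof (cases "\<theta> = 0")
    case True
    then show ?thesis by (simp add: G_def \<Phi>_def u_def v_def)
  next
    case False
    then have s: "sin \<theta> \<noteq> 0" using that by simp
    show ?thesis unfolding G_rot
      by (rule surface_integral_orthogonal[OF orthogonal_transformation_rotation[OF assms]
            volume_preserving_rotation[OF assms s] surface_measurable_continuous[OF cont]])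
  qed
  have dG: "((\<lambda>\<theta>. G \<theta> x) has_real_derivative (poly p (u x \<theta>) * u x \<theta> - poly (pderiv p) (u x \<theta>) * (v x \<theta>)\<^sup>2)) (at \<theta>)" for x \<theta>
  proof -
    have "(u x has_real_derivative - v x \<theta>) (at \<theta>)" "(v x has_real_derivative u x \<theta>) (at \<theta>)"
      unfolding u_def v_def by (auto intro!: derivative_eq_intros)
    then show ?thesis unfolding G_def
      by (auto intro!: derivative_eq_intros DERIV_chain2[of "poly p"] poly_DERIV simp: power2_eq_square)
  qed
  have "bounded ((\<lambda>s. poly p s) ` {-1..1})" "bounded ((\<lambda>s. poly (pderiv p) s) ` {-1..1})"
    by (intro compact_imp_bounded compact_continuous_image continuous_intros; simp)+
  then obtain B B' where B: "\<And>s. \<bar>s\<bar> \<le> 1 \<Longrightarrow> \<bar>poly p s\<bar> \<le> B" and B': "\<And>s. \<bar>s\<bar> \<le> 1 \<Longrightarrow> \<bar>poly (pderiv p) s\<bar> \<le> B'"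
    unfolding bounded_iff by (fastforce simp: abs_le_iff)
  have bound: "\<bar>poly p (u x \<theta>) * u x \<theta> - poly (pderiv p) (u x \<theta>) * (v x \<theta>)\<^sup>2\<bar> \<le> B + B'" if "x \<in> sphere 0 1" for x \<theta>
  proof -
    have "rotation k j \<theta> x \<in> sphere 0 1"
      using that orthogonal_transformation_rotation[OF assms, of \<theta>] by (simp add: orthogonal_transformation)
    from abs_coord_le_1[OF this, of k] abs_coord_le_1[OF this, of j]
    have uv: "\<bar>u x \<theta>\<bar> \<le> 1" "\<bar>v x \<theta>\<bar> \<le> 1" using assms by (auto simp: rotation_def u_def v_def)
    have "\<bar>poly p (u x \<theta>) * u x \<theta>\<bar> \<le> B * 1"
      unfolding abs_mult by (intro mult_mono B uv) (use B[of 0] in auto)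
    moreover have "\<bar>poly (pderiv p) (u x \<theta>) * (v x \<theta>)\<^sup>2\<bar> \<le> B' * 1"
      unfolding abs_mult using uv(2) by (intro mult_mono B' uv) (use B'[of 0] in \<open>auto simp: abs_square_le_1\<close>)
    ultimately show ?thesis by linarith
  qed
  \<comment> \<open>difference quotients along the angles \<open>h i\<close>, all in the range where the rotation is a product of shears\<close>
  define h where "h = (\<lambda>i::nat. inverse (real (Suc i)))"
  define s where "s = (\<lambda>i x. (G (h i) x - G 0 x) / h i)"
  have h: "h i > 0" for i by (simp add: h_def)
  have sin_h: "sin (h i) \<noteq> 0" for i
  proof -
    have "h i \<le> 1" by (simp add: h_def field_simps)
    then have "sin (h i) > 0" using h[of i] pi_gt3 by (intro sin_gt_zero) linarith+
    then show ?thesis by simp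
  qed
  have h0: "filterlim h (at 0) sequentially"
  proof (rule filterlim_atI)
    show "h \<longlonglongrightarrow> 0" unfolding h_def by (rule LIMSEQ_inverse_real_of_nat)
    show "\<forall>\<^sub>F i in sequentially. h i \<noteq> 0" using h by (intro always_eventually allI) (metis less_irrefl)
  qed
  have "(\<lambda>i. LINT x|surface_measure. s i x) \<longlonglongrightarrow>
      (LINT x|surface_measure. poly p (x $ k) * x $ k - poly (pderiv p) (x $ k) * (x $ j)\<^sup>2)"
  proof (rule integral_dominated_convergence[where w = "\<lambda>_. B + B'"])
    show "AE x in surface_measure. (\<lambda>i. s i x) \<longlonglongrightarrow> poly p (x $ k) * x $ k - poly (pderiv p) (x $ k) * (x $ j)\<^sup>2"
    proof (rule AE_I2)
      fix x :: "real ^ 'd"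
      have "((\<lambda>\<epsilon>. (G (0 + \<epsilon>) x - G 0 x) / \<epsilon>) \<longlongrightarrow> poly p (u x 0) * u x 0 - poly (pderiv p) (u x 0) * (v x 0)\<^sup>2) (at 0)"
        using dG[of x 0] by (simp add: DERIV_def)
      from filterlim_compose[OF this h0]
      show "(\<lambda>i. s i x) \<longlonglongrightarrow> poly p (x $ k) * x $ k - poly (pderiv p) (x $ k) * (x $ j)\<^sup>2"
        by (simp add: s_def u_def v_def)
    qed
    show "AE x in surface_measure. norm (s i x) \<le> B + B'" for i
    proof (rule AE_I2)
      fix x :: "real ^ 'd" assume "x \<in> space surface_measure"
      then have x: "x \<in> sphere 0 1" by simp
      have "norm (G (h i) x - G 0 x) \<le> (B + B') * norm (h i - 0)"
        by (rule field_differentiable_bound[of UNIV "\<lambda>\<theta>. G \<theta> x"]) (use dG bound[OF x] in auto)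
      then show "norm (s i x) \<le> B + B'" using h[of i] by (simp add: s_def field_simps)
    qed
    show "(\<lambda>x :: real ^ 'd. poly p (x $ k) * x $ k - poly (pderiv p) (x $ k) * (x $ j)\<^sup>2) \<in> borel_measurable surface_measure"
      by (intro surface_measurable_continuous continuous_intros)
    show "s i \<in> borel_measurable surface_measure" for i
      unfolding s_def using h[of i] by (intro surface_measurable_continuous continuous_intros cont_G) auto
  qed simp
  moreover have "(LINT x|surface_measure. s i x) = 0" for i
    unfolding s_def
    by (subst integral_divide_zero, subst Bochner_Integration.integral_diff)
       (simp_all add: integrable_surface_continuous[OF cont_G] int_G sin_h)
  ultimately show ?thesis by (simp add: LIMSEQ_const_iff)
qed

definition zonal_int :: "'d::finite \<Rightarrow> real poly \<Rightarrow> real" where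
  "zonal_int k p = (LINT x|(surface_measure :: (real ^ 'd) measure). poly p (x $ k))"

lemma integrable_poly_coord [simp]: "integrable surface_measure (\<lambda>x :: real ^ 'd. poly p (x $ k))"
  by (intro integrable_surface_continuous continuous_intros)

lemma zonal_int_0 [simp]: "zonal_int k 0 = 0" by (simp add: zonal_int_def)
lemma zonal_int_add: "zonal_int k (p + q) = zonal_int k p + zonal_int k q" by (simp add: zonal_int_def)
lemma zonal_int_diff: "zonal_int k (p - q) = zonal_int k p - zonal_int k q" by (simp add: zonal_int_def)
lemma zonal_int_smult: "zonal_int k (smult a p) = a * zonal_int k p" by (simp add: zonal_int_def)
lemma zonal_int_sum: "zonal_int k (\<Sum>i\<in>A. f i) = (\<Sum>i\<in>A. zonal_int k (f i))"
  by (induction A rule: infinite_finite_induct) (auto simp: zonal_int_add)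
lemma zonal_int_1_pos: "zonal_int k 1 > 0"
  using measure_surface_sphere_pos by (simp add: zonal_int_def)

text \<open>Summing the identity for the rotations in the planes of \<open>k\<close> and \<open>j\<close> over all \<open>j \<noteq> k\<close>, where
  the squares of the other coordinates add up to \<open>1 - (x $ k)\<^sup>2\<close> on the sphere.\<close>
lemma zonal_int_divergence:
  fixes k :: "'d::finite"
  shows "zonal_int k ([:1, 0, -1:] * pderiv p - smult (real CARD('d) - 1) ([:0, 1:] * p)) = 0"
proof -
  have "(\<Sum>j\<in>UNIV - {k}. LINT x|surface_measure. poly p (x $ k) * x $ k - poly (pderiv p) (x $ k) * (x $ j)\<^sup>2) = 0"
    by (intro sum.neutral ballI surface_integral_rotation_field) auto
  also have "(\<Sum>j\<in>UNIV - {k}. LINT x|surface_measure. poly p (x $ k) * x $ k - poly (pderiv p) (x $ k) * (x $ j)\<^sup>2)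
     = (LINT x|surface_measure. (\<Sum>j\<in>UNIV - {k}. poly p (x $ k) * x $ k - poly (pderiv p) (x $ k) * (x $ j)\<^sup>2))"
    by (rule Bochner_Integration.integral_sum[symmetric]) (intro integrable_surface_continuous continuous_intros)
  also have "\<dots> = (LINT x|surface_measure. - poly ([:1, 0, -1:] * pderiv p - smult (real CARD('d) - 1) ([:0, 1:] * p)) (x $ k))"
  proof (intro Bochner_Integration.integral_cong refl)
    fix x :: "real ^ 'd" assume "x \<in> space surface_measure"
    then have "(\<Sum>j\<in>UNIV. (x $ j)\<^sup>2) = 1"
      by (simp add: norm_vec_def L2_set_def)
    then have S: "(\<Sum>j\<in>UNIV - {k}. (x $ j)\<^sup>2) = 1 - (x $ k)\<^sup>2"
      by (simp add: sum.remove[of UNIV k])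
    have "(\<Sum>j\<in>UNIV - {k}. poly p (x $ k) * x $ k - poly (pderiv p) (x $ k) * (x $ j)\<^sup>2) =
        (real CARD('d) - 1) * (poly p (x $ k) * x $ k) - poly (pderiv p) (x $ k) * (1 - (x $ k)\<^sup>2)"
      unfolding sum_subtractf sum_distrib_left[symmetric] S
      by (simp add: card_Diff_singleton of_nat_diff)
    then show "(\<Sum>j\<in>UNIV - {k}. poly p (x $ k) * x $ k - poly (pderiv p) (x $ k) * (x $ j)\<^sup>2) =
        - poly ([:1, 0, -1:] * pderiv p - smult (real CARD('d) - 1) ([:0, 1:] * p)) (x $ k)"
      by (simp add: power2_eq_square algebra_simps)
  qed
  also have "\<dots> = - zonal_int k ([:1, 0, -1:] * pderiv p - smult (real CARD('d) - 1) ([:0, 1:] * p))"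
    unfolding zonal_int_def by (rule integral_minus)
  finally show ?thesis by simp
qed

section \<open>Integrals of finite zonal sums\<close>

text \<open>The Laplace--Beltrami operator on zonal functions of the sphere of dimension \<open>2 * lam + 1\<close>, as
  an operator on polynomials in \<open>t = x $ k\<close>.\<close>
definition zonal_laplacian :: "real \<Rightarrow> real poly \<Rightarrow> real poly" where
  "zonal_laplacian lam p = [:1, 0, -1:] * pderiv (pderiv p) - smult (2 * lam + 1) ([:0, 1:] * pderiv p)"

lemma zonal_laplacian_gegenbauer_poly:
  "zonal_laplacian lam (gegenbauer_poly lam l) = smult (- (real l * (real l + 2 * lam))) (gegenbauer_poly lam l)"
  by (subst poly_eq_poly_eq_iff[symmetric])
     (use gegenbauer_poly_ode[of _ lam l] in \<open>simp add: fun_eq_iff zonal_laplacian_def power2_eq_square algebra_simps\<close>)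

lemma zonal_laplacian_sum_smult:
  "zonal_laplacian lam (\<Sum>l\<in>A. smult (a l) (p l)) = (\<Sum>l\<in>A. smult (a l) (zonal_laplacian lam (p l)))"
  by (induction A rule: infinite_finite_induct)
     (simp_all add: zonal_laplacian_def pderiv_add pderiv_smult smult_add_right smult_diff_right algebra_simps)

text \<open>Green's formula: the divergence identity for \<open>p' * q\<close>. The right-hand side is symmetric in \<open>p\<close>
  and \<open>q\<close>.\<close>
lemma zonal_int_green:
  fixes k :: "'d::finite"
  assumes dim: "real CARD('d) = 2 * lam + 2"
  shows "zonal_int k (q * zonal_laplacian lam p) = - zonal_int k ([:1, 0, -1:] * pderiv p * pderiv q)"
proof -
  have "q * zonal_laplacian lam p = ([:1, 0, -1:] * pderiv (pderiv p * q) - smult (real CARD('d) - 1) ([:0, 1:] * (pderiv p * q)))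
     - [:1, 0, -1:] * pderiv p * pderiv q"
    unfolding zonal_laplacian_def pderiv_mult dim by (simp add: algebra_simps)
  then have "zonal_int k (q * zonal_laplacian lam p) = zonal_int k (([:1, 0, -1:] * pderiv (pderiv p * q)
      - smult (real CARD('d) - 1) ([:0, 1:] * (pderiv p * q))) - [:1, 0, -1:] * pderiv p * pderiv q)"
    by (rule arg_cong)
  also have "\<dots> = 0 - zonal_int k ([:1, 0, -1:] * pderiv p * pderiv q)"
    by (subst zonal_int_diff) (simp only: zonal_int_divergence)
  finally show ?thesis by simp
qed

text \<open>Eigenfunctions of a symmetric operator for different eigenvalues; \<open>l * (l + 2 * lam)\<close> is
  injective in \<open>l\<close> since \<open>lam > 0\<close>.\<close>
lemma zonal_int_gegenbauer_orthogonal: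
  fixes k :: "'d::finite"
  assumes dim: "real CARD('d) = 2 * lam + 2" and lam: "lam > 0" and "l \<noteq> j"
  shows "zonal_int k (gegenbauer_poly lam l * gegenbauer_poly lam j) = 0"
proof -
  have "zonal_int k (gegenbauer_poly lam l * zonal_laplacian lam (gegenbauer_poly lam j)) = zonal_int k (gegenbauer_poly lam j * zonal_laplacian lam (gegenbauer_poly lam l))"
    unfolding zonal_int_green[OF dim] by (simp only: mult.assoc mult.commute[of "pderiv (gegenbauer_poly lam l)"])
  then have "- (real j * (real j + 2 * lam)) * zonal_int k (gegenbauer_poly lam l * gegenbauer_poly lam j) =
      - (real l * (real l + 2 * lam)) * zonal_int k (gegenbauer_poly lam l * gegenbauer_poly lam j)"
    by (simp only: zonal_laplacian_gegenbauer_poly zonal_int_smult mult_smult_right mult.commute[of "gegenbauer_poly lam j" "gegenbauer_poly lam l"])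
  then have "(real l * (real l + 2 * lam) - real j * (real j + 2 * lam)) * zonal_int k (gegenbauer_poly lam l * gegenbauer_poly lam j) = 0"
    by (simp only: left_diff_distrib) auto
  moreover have "real l * (real l + 2 * lam) - real j * (real j + 2 * lam) = (real l - real j) * (real l + real j + 2 * lam)"
    by (simp add: algebra_simps)
  moreover have "real l + real j + 2 * lam > 0" using lam by linarith
  ultimately show ?thesis using \<open>l \<noteq> j\<close> by simp
qed

lemma X_times_gegenbauer_poly:
  "smult (2 * (real l + 1 + lam)) ([:0, 1:] * gegenbauer_poly lam (Suc l)) =
     smult (real l + 2) (gegenbauer_poly lam (Suc (Suc l))) + smult (real l + 2 * lam) (gegenbauer_poly lam l)"
  by (subst poly_eq_poly_eq_iff[symmetric])
     (use gegenbauer_poly_recurrence[of l lam] in \<open>simp add: fun_eq_iff algebra_simps\<close>)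

lemma zonal_int_X_gegenbauer_gegenbauer:
  fixes k :: "'d::finite"
  assumes dim: "real CARD('d) = 2 * lam + 2" and lam: "lam > 0"
  shows "2 * (real l + lam) * zonal_int k ([:0, 1:] * gegenbauer_poly lam l * gegenbauer_poly lam j) =
     (if j = Suc l then (real l + 1) * zonal_int k (gegenbauer_poly lam j * gegenbauer_poly lam j) else
      if l = Suc j then (real j + 2 * lam) * zonal_int k (gegenbauer_poly lam j * gegenbauer_poly lam j) else 0)"
proof (cases l)
  case 0
  have "smult (2 * lam) ([:0, 1:] * gegenbauer_poly lam l * gegenbauer_poly lam j) = gegenbauer_poly lam (Suc 0) * gegenbauer_poly lam j"
    using 0 by simp
  then have "2 * lam * zonal_int k ([:0, 1:] * gegenbauer_poly lam l * gegenbauer_poly lam j) = zonal_int k (gegenbauer_poly lam (Suc 0) * gegenbauer_poly lam j)"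
    by (metis zonal_int_smult)
  then show ?thesis using 0 zonal_int_gegenbauer_orthogonal[OF dim lam, of "Suc 0" j k] by auto
next
  case (Suc i)
  have "smult (2 * (real i + 1 + lam)) ([:0, 1:] * gegenbauer_poly lam (Suc i) * gegenbauer_poly lam j)
      = smult (2 * (real i + 1 + lam)) ([:0, 1:] * gegenbauer_poly lam (Suc i)) * gegenbauer_poly lam j"
    by (simp only: mult_smult_left mult.assoc)
  also have "\<dots> = smult (real i + 2) (gegenbauer_poly lam (Suc (Suc i)) * gegenbauer_poly lam j) + smult (real i + 2 * lam) (gegenbauer_poly lam i * gegenbauer_poly lam j)"
    unfolding X_times_gegenbauer_poly by (simp only: mult_smult_left distrib_right)
  finally have "2 * (real i + 1 + lam) * zonal_int k ([:0, 1:] * gegenbauer_poly lam (Suc i) * gegenbauer_poly lam j) =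
     (real i + 2) * zonal_int k (gegenbauer_poly lam (Suc (Suc i)) * gegenbauer_poly lam j) + (real i + 2 * lam) * zonal_int k (gegenbauer_poly lam i * gegenbauer_poly lam j)"
    by (metis zonal_int_smult zonal_int_add)
  then show ?thesis unfolding Suc
    using zonal_int_gegenbauer_orthogonal[OF dim lam, of "Suc (Suc i)" j k] zonal_int_gegenbauer_orthogonal[OF dim lam, of i j k]
    by (auto simp: algebra_simps)
qed

text \<open>The integral of \<open>t * C l * C (l + 1)\<close> can be evaluated by applying the recurrence to either
  factor; comparing the results relates the norms of neighbouring polynomials.\<close>
lemma zonal_int_gegenbauer_sq_step:
  fixes k :: "'d::finite"
  assumes dim: "real CARD('d) = 2 * lam + 2" and lam: "lam > 0"
  shows "(real l + 1) * (real l + 1 + lam) * zonal_int k (gegenbauer_poly lam (Suc l) * gegenbauer_poly lam (Suc l)) =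
     (real l + lam) * (real l + 2 * lam) * zonal_int k (gegenbauer_poly lam l * gegenbauer_poly lam l)"
proof -
  define I where "I = zonal_int k ([:0, 1:] * gegenbauer_poly lam l * gegenbauer_poly lam (Suc l))"
  have "2 * (real l + lam) * I = (real l + 1) * zonal_int k (gegenbauer_poly lam (Suc l) * gegenbauer_poly lam (Suc l))"
    using zonal_int_X_gegenbauer_gegenbauer[OF dim lam, where l = l and j = "Suc l" and k = k] by (simp add: I_def)
  moreover have "2 * (real l + 1 + lam) * I = (real l + 2 * lam) * zonal_int k (gegenbauer_poly lam l * gegenbauer_poly lam l)"
    using zonal_int_X_gegenbauer_gegenbauer[OF dim lam, where l = "Suc l" and j = l and k = k]
    by (simp add: I_def mult_ac add_ac)
  moreover have "(real l + 1 + lam) * (2 * (real l + lam) * I) = (real l + lam) * (2 * (real l + 1 + lam) * I)"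
    by (simp only: mult_ac)
  ultimately show ?thesis by (simp only: mult_ac)
qed

lemma zonal_int_gegenbauer_sq:
  fixes k :: "'d::finite"
  assumes dim: "CARD('d) = m + 3" and lam: "lam = (real m + 1) / 2"
  shows "(real l + lam) * zonal_int k (gegenbauer_poly lam l * gegenbauer_poly lam l) = lam * real ((l + m) choose m) * zonal_int k 1"
proof (induction l)
  case (Suc l)
  have dim': "real CARD('d) = 2 * lam + 2" and pos: "lam > 0" unfolding dim lam by simp_all
  have rec: "(real l + 1) * real ((Suc l + m) choose m) = (real l + 2 * lam) * real ((l + m) choose m)"
    using gegenbauer_poly_at_1[of l lam] by (simp add: lam gegenbauer_poly_half_integer_at_1)
  have "(real l + 1) * ((real (Suc l) + lam) * zonal_int k (gegenbauer_poly lam (Suc l) * gegenbauer_poly lam (Suc l)))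
      = (real l + 2 * lam) * ((real l + lam) * zonal_int k (gegenbauer_poly lam l * gegenbauer_poly lam l))"
    using zonal_int_gegenbauer_sq_step[OF dim' pos, of l k] by (simp only: of_nat_Suc mult_ac add_ac)
  also have "\<dots> = ((real l + 2 * lam) * real ((l + m) choose m)) * (lam * zonal_int k 1)"
    unfolding Suc by (simp only: mult_ac)
  also have "\<dots> = (real l + 1) * (lam * real ((Suc l + m) choose m) * zonal_int k 1)"
    unfolding rec[symmetric] by (simp only: mult_ac)
  finally show ?case by (subst (asm) mult_left_cancel) (simp_all add: add_pos_pos)
qed (use lam in simp)

text \<open>The factor \<open>(l + lam) / lam\<close> turns the Gegenbauer polynomial into the reproducing kernel of
  the spherical harmonics of degree \<open>l\<close>, up to a constant independent of \<open>l\<close>; in terms of \<open>g\<close> all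
  weights below become binomial coefficients.\<close>
definition zonal_coeff :: "real \<Rightarrow> (nat \<Rightarrow> real) \<Rightarrow> nat \<Rightarrow> real" where
  "zonal_coeff lam g l = g l * ((real l + lam) / lam)"

definition zonal_sum :: "real \<Rightarrow> (nat \<Rightarrow> real) \<Rightarrow> nat \<Rightarrow> real poly" where
  "zonal_sum lam g N = (\<Sum>l<N. smult (zonal_coeff lam g l) (gegenbauer_poly lam l))"

lemma zonal_int_sum_mult_sum:
  fixes k :: "'d::finite"
  assumes dim: "real CARD('d) = 2 * lam + 2" and lam: "lam > 0"
  shows "zonal_int k ((\<Sum>l<N. smult (a l) (gegenbauer_poly lam l)) * (\<Sum>l<N. smult (b l) (gegenbauer_poly lam l)))
    = (\<Sum>l<N. a l * b l * zonal_int k (gegenbauer_poly lam l * gegenbauer_poly lam l))"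
proof -
  have "zonal_int k ((\<Sum>l<N. smult (a l) (gegenbauer_poly lam l)) * (\<Sum>l<N. smult (b l) (gegenbauer_poly lam l)))
    = (\<Sum>l<N. \<Sum>j<N. a l * b j * zonal_int k (gegenbauer_poly lam l * gegenbauer_poly lam j))"
    unfolding sum_product zonal_int_sum by (simp add: zonal_int_smult mult_ac)
  also have "\<dots> = (\<Sum>l<N. \<Sum>j<N. if j = l then a l * b l * zonal_int k (gegenbauer_poly lam l * gegenbauer_poly lam l) else 0)"
    by (intro sum.cong refl) (use zonal_int_gegenbauer_orthogonal[OF dim lam] in auto)
  also have "\<dots> = (\<Sum>l<N. a l * b l * zonal_int k (gegenbauer_poly lam l * gegenbauer_poly lam l))"
    by (intro sum.cong refl) (simp add: sum.delta)
  finally show ?thesis .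
qed

text \<open>The dimension of the space of spherical harmonics of degree \<open>l\<close> on the sphere of dimension
  \<open>m + 2\<close>.\<close>
definition harmonic_weight :: "nat \<Rightarrow> nat \<Rightarrow> real" where
  "harmonic_weight m l = (2 * real l + real m + 1) / (real m + 1) * real ((l + m) choose m)"

text \<open>The weight of the product \<open>g l * g (l + 1)\<close> in the integral of \<open>t * f\<^sup>2\<close>. Being the number of
  monomials of degree \<open>l\<close> in \<open>m + 2\<close> variables, it adds up to dimensions of spaces of harmonics over
  two consecutive degrees.\<close>
definition coupling_weight :: "nat \<Rightarrow> nat \<Rightarrow> real" where
  "coupling_weight m l = real ((l + Suc m) choose Suc m)"

lemma coupling_weight_eq: "(real m + 1) * coupling_weight m l = (real l + real m + 1) * real ((l + m) choose m)"
  using arg_cong[OF Suc_times_binomial_eq[of "l + m" m], of real]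
  by (simp add: coupling_weight_def algebra_simps del: binomial_Suc_Suc)

lemma coupling_weight_diff:
  "coupling_weight m (Suc l) - coupling_weight m l = real ((Suc l + m) choose m)"
  by (simp add: coupling_weight_def)

lemma harmonic_weight_0: "harmonic_weight m 0 = coupling_weight m 0"
  by (simp add: harmonic_weight_def coupling_weight_def)

lemma harmonic_weight_Suc: "harmonic_weight m (Suc l) = coupling_weight m (Suc l) + coupling_weight m l"
proof -
  have "harmonic_weight m (Suc l) + (coupling_weight m (Suc l) - coupling_weight m l) = 2 * coupling_weight m (Suc l)"
  proof -
    define b where "b = real ((Suc l + m) choose m)"
    have c: "coupling_weight m (Suc l) = (real (Suc l) + real m + 1) * b / (real m + 1)"
      using coupling_weight_eq[of m "Suc l"] unfolding b_def by (subst nonzero_eq_divide_eq) (simp_all add: mult.commute)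
    have "(real m + 1) \<noteq> 0" by linarith
    then show ?thesis
      unfolding coupling_weight_diff unfolding harmonic_weight_def b_def[symmetric] c
      by (simp add: divide_simps) (simp add: algebra_simps)
  qed
  then show ?thesis by simp
qed

lemma zonal_coeff_sq_weight:
  fixes k :: "'d::finite"
  assumes dim: "CARD('d) = m + 3" and lam: "lam = (real m + 1) / 2"
  shows "((real l + lam) / lam)\<^sup>2 * zonal_int k (gegenbauer_poly lam l * gegenbauer_poly lam l) = zonal_int k 1 * harmonic_weight m l"
proof -
  have pos: "lam > 0" by (simp add: lam)
  have "((real l + lam) / lam)\<^sup>2 * zonal_int k (gegenbauer_poly lam l * gegenbauer_poly lam l)
      = (real l + lam) / lam\<^sup>2 * ((real l + lam) * zonal_int k (gegenbauer_poly lam l * gegenbauer_poly lam l))"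
    by (simp add: power2_eq_square)
  also have "\<dots> = (real l + lam) / lam * real ((l + m) choose m) * zonal_int k 1"
    unfolding zonal_int_gegenbauer_sq[OF dim lam] using pos by (simp add: power2_eq_square)
  moreover have "(real l + lam) / lam = (2 * real l + real m + 1) / (real m + 1)"
    by (simp add: lam field_simps)
  then have "(real l + lam) / lam * real ((l + m) choose m) = harmonic_weight m l"
    by (simp only: harmonic_weight_def)
  ultimately show ?thesis by (simp only: mult.commute)
qed

lemma zonal_int_zonal_sum_sq:
  fixes k :: "'d::finite"
  assumes dim: "CARD('d) = m + 3" and lam: "lam = (real m + 1) / 2"
  shows "zonal_int k (zonal_sum lam g N * zonal_sum lam g N) = zonal_int k 1 * (\<Sum>l<N. harmonic_weight m l * (g l)\<^sup>2)"
proof -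
  have dim': "real CARD('d) = 2 * lam + 2" and pos: "lam > 0" unfolding dim lam by simp_all
  have "zonal_int k (zonal_sum lam g N * zonal_sum lam g N)
      = (\<Sum>l<N. (g l)\<^sup>2 * (((real l + lam) / lam)\<^sup>2 * zonal_int k (gegenbauer_poly lam l * gegenbauer_poly lam l)))"
    unfolding zonal_sum_def zonal_int_sum_mult_sum[OF dim' pos]
    by (intro sum.cong) (simp_all add: zonal_coeff_def power2_eq_square mult_ac)
  then show ?thesis unfolding zonal_coeff_sq_weight[OF dim lam] by (simp add: sum_distrib_left mult_ac)
qed

lemma zonal_int_zonal_sum_laplacian:
  fixes k :: "'d::finite"
  assumes dim: "CARD('d) = m + 3" and lam: "lam = (real m + 1) / 2"
  shows "zonal_int k (zonal_laplacian lam (zonal_sum lam g N) * zonal_sum lam g N)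
     = - zonal_int k 1 * (\<Sum>l<N. real l * (real l + 2 * lam) * harmonic_weight m l * (g l)\<^sup>2)"
proof -
  have dim': "real CARD('d) = 2 * lam + 2" and pos: "lam > 0" unfolding dim lam by simp_all
  have "zonal_laplacian lam (zonal_sum lam g N) =
      (\<Sum>l<N. smult (- (real l * (real l + 2 * lam)) * zonal_coeff lam g l) (gegenbauer_poly lam l))"
    unfolding zonal_sum_def zonal_laplacian_sum_smult zonal_laplacian_gegenbauer_poly by (simp add: mult_ac)
  then have "zonal_int k (zonal_laplacian lam (zonal_sum lam g N) * zonal_sum lam g N)
      = (\<Sum>l<N. - (real l * (real l + 2 * lam)) * (g l)\<^sup>2 * (((real l + lam) / lam)\<^sup>2 * zonal_int k (gegenbauer_poly lam l * gegenbauer_poly lam l)))"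
    unfolding zonal_sum_def using zonal_int_sum_mult_sum[OF dim' pos]
    by (simp only:) (intro sum.cong, simp_all add: zonal_coeff_def power2_eq_square mult_ac)
  then show ?thesis unfolding zonal_coeff_sq_weight[OF dim lam] by (simp add: sum_distrib_left sum_negf mult_ac)
qed

text \<open>Multiplication by \<open>t\<close> only couples neighbouring degrees, so adding the term of degree \<open>N + 1\<close>
  to the sum creates a single new product.\<close>
lemma zonal_int_X_zonal_sum_sq:
  fixes k :: "'d::finite"
  assumes dim: "CARD('d) = m + 3" and lam: "lam = (real m + 1) / 2"
  shows "zonal_int k ([:0, 1:] * (zonal_sum lam g (Suc N) * zonal_sum lam g (Suc N)))
     = zonal_int k 1 * (\<Sum>l<N. 2 * coupling_weight m l * g l * g (Suc l))"
proof (induction N)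
  have dim': "real CARD('d) = 2 * lam + 2" and pos: "lam > 0" unfolding dim lam by simp_all
  note XG = zonal_int_X_gegenbauer_gegenbauer[OF dim' pos]
  have XG0: "zonal_int k ([:0, 1:] * gegenbauer_poly lam l * gegenbauer_poly lam j) = 0" if "j \<noteq> Suc l" "l \<noteq> Suc j" for l j
  proof -
    have "real l + lam \<noteq> 0" using pos by linarith
    then show ?thesis using XG[where l = l and j = j and k = k] that by (simp del: mult_pCons_left)
  qed
  have XG1: "zonal_coeff lam g l * zonal_coeff lam g (Suc l) * zonal_int k ([:0, 1:] * gegenbauer_poly lam l * gegenbauer_poly lam (Suc l))
      = zonal_int k 1 * coupling_weight m l * g l * g (Suc l)" for l
  proof -
    define I where "I = zonal_int k ([:0, 1:] * gegenbauer_poly lam l * gegenbauer_poly lam (Suc l))"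
    have nz: "real l + 1 + lam > 0" "lam \<noteq> 0" using pos by auto
    have "2 * (real l + 1 + lam) * I = (real l + 2 * lam) * zonal_int k (gegenbauer_poly lam l * gegenbauer_poly lam l)"
      using XG[where l = "Suc l" and j = l and k = k] by (simp add: I_def mult_ac add_ac)
    then have I: "(real l + lam) * (real l + 1 + lam) * I
        = (real l + 2 * lam) / 2 * ((real l + lam) * zonal_int k (gegenbauer_poly lam l * gegenbauer_poly lam l))"
    proof -
      have "(real l + lam) * (real l + 1 + lam) * I = (real l + lam) / 2 * (2 * (real l + 1 + lam) * I)" by simp
      also note \<open>2 * (real l + 1 + lam) * I = _\<close>
      finally show ?thesis by simp
    qed
    have "zonal_coeff lam g l * zonal_coeff lam g (Suc l) * I
        = g l * g (Suc l) / lam\<^sup>2 * ((real l + lam) * (real l + 1 + lam) * I)"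
      by (simp add: zonal_coeff_def power2_eq_square add_ac)
    also have "\<dots> = g l * g (Suc l) / (2 * lam) * ((real l + 2 * lam) * real ((l + m) choose m)) * zonal_int k 1"
      unfolding I zonal_int_gegenbauer_sq[OF dim lam] using nz by (simp add: field_simps power2_eq_square)
    also have "(real l + 2 * lam) * real ((l + m) choose m) = 2 * lam * coupling_weight m l"
    proof -
      have lam2: "2 * lam = real m + 1" by (simp add: lam)
      show ?thesis unfolding lam2 using coupling_weight_eq[of m l] by (simp only: add_ac)
    qed
    finally show ?thesis using nz by (simp add: I_def mult_ac)
  qed
  { case 0
    have "zonal_int k ([:0, 1:] * gegenbauer_poly lam 0 * gegenbauer_poly lam 0) = 0" by (rule XG0) auto
    then show ?case
      using zonal_int_smult[of k "zonal_coeff lam g 0 * zonal_coeff lam g 0" "[:0, 1:]"]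
      by (simp add: zonal_sum_def) }
  { case (Suc N)
    define F where "F = zonal_sum lam g (Suc N)"
    define G where "G = gegenbauer_poly lam (Suc N)"
    define c where "c = zonal_coeff lam g (Suc N)"
    have F': "zonal_sum lam g (Suc (Suc N)) = F + smult c G"
      by (simp add: F_def zonal_sum_def c_def G_def)
    have "[:0, 1:] * ((F + smult c G) * (F + smult c G)) =
        [:0, 1:] * (F * F) + smult (2 * c) ([:0, 1:] * F * G) + smult (c * c) ([:0, 1:] * G * G)"
      by (subst poly_eq_poly_eq_iff[symmetric]) (simp add: fun_eq_iff algebra_simps)
    moreover have "zonal_int k ([:0, 1:] * G * G) = 0" unfolding G_def by (rule XG0) auto
    moreover have "zonal_int k ([:0, 1:] * F * G) = zonal_coeff lam g N * zonal_int k ([:0, 1:] * gegenbauer_poly lam N * G)"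
    proof -
      have "zonal_int k ([:0, 1:] * F * G) = (\<Sum>l<Suc N. zonal_coeff lam g l * zonal_int k ([:0, 1:] * gegenbauer_poly lam l * G))"
        unfolding F_def zonal_sum_def sum_distrib_left sum_distrib_right zonal_int_sum
        by (simp only: mult_smult_left mult_smult_right zonal_int_smult)
      also have "\<dots> = zonal_coeff lam g N * zonal_int k ([:0, 1:] * gegenbauer_poly lam N * G)"
        unfolding G_def by (simp add: XG0 del: mult_pCons_left)
      finally show ?thesis .
    qed
    ultimately have "zonal_int k ([:0, 1:] * ((F + smult c G) * (F + smult c G))) =
        zonal_int k ([:0, 1:] * (F * F)) + 2 * (zonal_coeff lam g N * c * zonal_int k ([:0, 1:] * gegenbauer_poly lam N * G))"
      by (simp only: zonal_int_add zonal_int_smult) simp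
    also have "\<dots> = zonal_int k 1 * (\<Sum>l<N. 2 * coupling_weight m l * g l * g (Suc l)) + 2 * (zonal_int k 1 * coupling_weight m N * g N * g (Suc N))"
      using Suc.IH XG1[of N] unfolding F_def G_def c_def by (simp only:)
    finally show ?case unfolding F' by (simp add: algebra_simps) }
qed

text \<open>As \<open>harmonic_weight\<close> is the sum of two consecutive \<open>coupling_weight\<close>s, the quadratic form is a
  sum of squares of differences; the last term comes from the jump to zero at the end of the finite
  sum.\<close>
lemma harmonic_minus_coupling:
  "(\<Sum>l<Suc N. harmonic_weight m l * (g l)\<^sup>2) - (\<Sum>l<N. 2 * coupling_weight m l * g l * g (Suc l))
     = (\<Sum>l<N. coupling_weight m l * (g (Suc l) - g l)\<^sup>2) + coupling_weight m N * (g N)\<^sup>2"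
  by (induction N)
     (simp_all add: harmonic_weight_0 harmonic_weight_Suc power2_eq_square algebra_simps)

lemma zonal_int_one_minus_X_zonal_sum_sq:
  fixes k :: "'d::finite"
  assumes dim: "CARD('d) = m + 3" and lam: "lam = (real m + 1) / 2"
  shows "zonal_int k ([:1, -1:] * (zonal_sum lam g (Suc N) * zonal_sum lam g (Suc N)))
     = zonal_int k 1 * ((\<Sum>l<N. coupling_weight m l * (g (Suc l) - g l)\<^sup>2) + coupling_weight m N * (g N)\<^sup>2)"
proof -
  have "[:1, -1:] * p = p - [:0, 1:] * p" for p :: "real poly" by simp
  then show ?thesis
    by (simp only: zonal_int_diff zonal_int_X_zonal_sum_sq[OF dim lam] zonal_int_zonal_sum_sq[OF dim lam]
        right_diff_distrib[symmetric] harmonic_minus_coupling)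
qed

section \<open>Estimates of the weighted sums\<close>

text \<open>Half of the exponential absorbs the power \<open>(l + 1) ^ p\<close> at the cost of \<open>L ^ p\<close>, since \<open>y ^ p\<close>
  is at most \<open>fact p * exp y\<close>; the other half leaves a geometric series whose sum is of order \<open>L\<close>.\<close>
lemma power_exp_sum_le:
  fixes \<beta> :: real
  assumes "\<beta> > 0"
  shows "\<exists>C>0. \<forall>L\<ge>1. \<forall>N. (\<Sum>l<N. (real l + 1) ^ p * exp (- \<beta> * real l / L)) \<le> C * L ^ (p + 1)"
proof -
  define D where "D = fact p * (2 / \<beta>) ^ p * exp (\<beta> / 2)"
  have D: "D > 0" using assms by (simp add: D_def)
  show ?thesis
  proof (intro exI[of _ "D * (1 + 2 / \<beta>)"] conjI allI impI)
    show "D * (1 + 2 / \<beta>) > 0" using D assms by (simp add: add_pos_pos)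
    fix L :: real and N :: nat
    assume L: "1 \<le> L"
    define r where "r = exp (- (\<beta> / (2 * L)))"
    have r: "0 < r" "r < 1" using assms L by (auto simp: r_def)
    have tm: "(real l + 1) ^ p * exp (- \<beta> * real l / L) \<le> D * L ^ p * r ^ l" for l
    proof -
      define y where "y = \<beta> / (2 * L) * (real l + 1)"
      have y: "y \<ge> 0" using assms L by (simp add: y_def)
      have "y ^ p / fact p \<le> exp y"
      proof -
        have sums: "(\<lambda>k. y ^ k /\<^sub>R fact k) sums exp y" by (rule exp_converges)
        have "(\<Sum>k\<in>{p}. y ^ k /\<^sub>R fact k) \<le> (\<Sum>k. y ^ k /\<^sub>R fact k)"
          by (rule sum_le_suminf[OF sums_summable[OF sums]]) (use y in auto)
        then have "y ^ p /\<^sub>R fact p \<le> exp y" using sums_unique[OF sums] by simp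
        then show ?thesis by (simp add: divide_inverse mult.commute)
      qed
      then have yp: "y ^ p \<le> fact p * exp y" by (simp add: field_simps)
      have "real l + 1 = 2 * L / \<beta> * y" using assms L by (simp add: y_def)
      then have "(real l + 1) ^ p = (2 / \<beta>) ^ p * L ^ p * y ^ p"
        by (simp add: power_mult_distrib power_divide)
      also have "\<dots> \<le> (2 / \<beta>) ^ p * L ^ p * (fact p * exp y)"
        using assms L by (intro mult_left_mono yp) auto
      also have "exp y = exp (\<beta> / (2 * L)) * exp (\<beta> / (2 * L) * real l)"
        by (simp only: y_def distrib_left mult_1_right exp_add mult.commute[of "exp (\<beta> / (2 * L))"])
      also have "(2 / \<beta>) ^ p * L ^ p * (fact p * \<dots>) \<le> (2 / \<beta>) ^ p * L ^ p * (fact p * (exp (\<beta> / 2) * exp (\<beta> / (2 * L) * real l)))"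
      proof -
        have "\<beta> / (2 * L) \<le> \<beta> / 2" using assms L by (intro divide_left_mono) auto
        then show ?thesis using assms L by (intro mult_left_mono mult_right_mono) auto
      qed
      also have "\<dots> = D * L ^ p * exp (\<beta> / (2 * L) * real l)" by (simp add: D_def)
      finally have "(real l + 1) ^ p * exp (- \<beta> * real l / L)
          \<le> D * L ^ p * exp (\<beta> / (2 * L) * real l) * exp (- \<beta> * real l / L)"
        by (intro mult_right_mono) auto
      also have "\<dots> = D * L ^ p * r ^ l"
      proof -
        have "r ^ l = exp (real l * (- (\<beta> / (2 * L))))" unfolding r_def by (rule exp_of_nat_mult[symmetric])
        also have "real l * (- (\<beta> / (2 * L))) = \<beta> / (2 * L) * real l + - \<beta> * real l / L"
          using L by (simp add: divide_simps)
        finally show ?thesis by (simp only: exp_add mult.assoc)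
      qed
      finally show ?thesis .
    qed
    have geo: "(\<Sum>l<N. r ^ l) \<le> 1 / (1 - r)"
    proof -
      have "(\<Sum>l<N. r ^ l) = (1 - r ^ N) / (1 - r)" using r by (simp add: sum_gp_strict)
      also have "\<dots> \<le> 1 / (1 - r)" using r by (intro divide_right_mono) auto
      finally show ?thesis .
    qed
    have "1 / (1 - r) \<le> L * (1 + 2 / \<beta>)"
    proof -
      define z where "z = \<beta> / (2 * L)"
      have z: "z > 0" using assms L by (simp add: z_def)
      have "r * (1 + z) \<le> exp (- z) * exp z"
        unfolding r_def z_def by (intro mult_left_mono exp_ge_add_one_self) simp
      then have "z \<le> (1 - r) * (1 + z)" by (simp add: exp_add[symmetric] algebra_simps)
      then have "1 / (1 - r) \<le> (1 + z) / z" using z r by (simp add: field_simps)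
      also have "\<dots> = 1 + 2 * L / \<beta>" using z assms L by (simp add: z_def field_simps)
      also have "\<dots> \<le> L * (1 + 2 / \<beta>)" using L by (simp add: algebra_simps)
      finally show ?thesis .
    qed
    with geo have geo': "(\<Sum>l<N. r ^ l) \<le> L * (1 + 2 / \<beta>)" by linarith
    have "(\<Sum>l<N. (real l + 1) ^ p * exp (- \<beta> * real l / L)) \<le> D * L ^ p * (\<Sum>l<N. r ^ l)"
      unfolding sum_distrib_left by (intro sum_mono tm)
    also have "\<dots> \<le> D * L ^ p * (L * (1 + 2 / \<beta>))"
      using D L by (intro mult_left_mono geo') auto
    finally show "(\<Sum>l<N. (real l + 1) ^ p * exp (- \<beta> * real l / L)) \<le> D * (1 + 2 / \<beta>) * L ^ (p + 1)"
      by (simp add: mult_ac)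
  qed
qed

lemma summable_power_exp:
  fixes \<beta> :: real
  assumes "\<beta> > 0" "L \<ge> 1"
  shows "summable (\<lambda>l. (real l + 1) ^ p * exp (- \<beta> * real l / L))"
proof -
  obtain C where C: "C > 0"
    "\<forall>L\<ge>1. \<forall>N. (\<Sum>l<N. (real l + 1) ^ p * exp (- \<beta> * real l / L)) \<le> C * L ^ (p + 1)"
    using power_exp_sum_le[OF assms(1), of p] by blast
  show ?thesis by (rule bounded_imp_summable[of _ "C * L ^ (p + 1)"]) (use C(2)[rule_format, OF assms(2), of "Suc _"] in \<open>auto simp: lessThan_Suc_atMost\<close>)
qed

lemma Abel_coupling:
  "(\<Sum>l<N. coupling_weight m l * (W l - W (Suc l))) + coupling_weight m N * W N
     = (\<Sum>l<Suc N. real ((l + m) choose m) * W l)"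
proof (induction N)
  case 0
  then show ?case by (simp add: coupling_weight_def)
next
  case (Suc N)
  have "coupling_weight m (Suc N) * W (Suc N) = (coupling_weight m N + real ((Suc N + m) choose m)) * W (Suc N)"
    using coupling_weight_diff[of m N] by simp
  with Suc show ?case by (simp add: algebra_simps del: binomial_Suc_Suc)
qed

text \<open>Here \<open>W\<close> majorises the variation of \<open>g\<close> from \<open>l\<close> on. The square of a jump is at most a
  constant times the jump, and the jumps are dominated by the decrements of \<open>W\<close>. Abel summation
  moves the difference to the weights, which lowers their growth from \<open>l ^ (m + 1)\<close> to \<open>l ^ m\<close>; this
  gains one power of \<open>L\<close> over the mass.\<close>
lemma localisation_defect_le:
  fixes K \<beta> :: real
  assumes "K > 0" "\<beta> > 0"
  shows "\<exists>C>0. \<forall>L\<ge>1. \<forall>g W N. (\<forall>l. \<bar>g l\<bar> \<le> W l) \<and> (\<forall>l. W l \<le> K * exp (- \<beta> * real l / L)) \<and>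
       (\<forall>l. \<bar>g (Suc l) - g l\<bar> \<le> W l - W (Suc l)) \<longrightarrow>
       (\<Sum>l<N. coupling_weight m l * (g (Suc l) - g l)\<^sup>2) + coupling_weight m N * (g N)\<^sup>2 \<le> C * L ^ (m + 1)"
proof -
  obtain C where C: "C > 0"
    "\<forall>L\<ge>1. \<forall>N. (\<Sum>l<N. (real l + 1) ^ m * exp (- \<beta> * real l / L)) \<le> C * L ^ (m + 1)"
    using power_exp_sum_le[OF assms(2), of m] by blast
  show ?thesis
  proof (intro exI[of _ "2 * K * K * C"] conjI allI impI)
    show "2 * K * K * C > 0" using C assms by simp
    fix L :: real and g W :: "nat \<Rightarrow> real" and N :: nat
    assume L: "1 \<le> L" and gW: "(\<forall>l. \<bar>g l\<bar> \<le> W l) \<and> (\<forall>l. W l \<le> K * exp (- \<beta> * real l / L)) \<and>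
       (\<forall>l. \<bar>g (Suc l) - g l\<bar> \<le> W l - W (Suc l))"
    have g: "\<bar>g l\<bar> \<le> W l" and W: "W l \<le> K * exp (- \<beta> * real l / L)"
      and step: "\<bar>g (Suc l) - g l\<bar> \<le> W l - W (Suc l)" for l using gW by auto
    have WK: "W l \<le> K" for l
    proof -
      have "K * exp (- \<beta> * real l / L) \<le> K * 1" using assms L by (intro mult_left_mono) auto
      then show ?thesis using W[of l] by simp
    qed
    have W0: "W l \<ge> 0" for l using g[of l] by linarith
    have gK: "\<bar>g l\<bar> \<le> K" for l using g[of l] WK[of l] by linarith
    have cw: "coupling_weight m l \<ge> 0" for l by (simp add: coupling_weight_def)
    have d: "(g (Suc l) - g l)\<^sup>2 \<le> 2 * K * (W l - W (Suc l))" for l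
    proof -
      have "(g (Suc l) - g l)\<^sup>2 = \<bar>g (Suc l) - g l\<bar> * \<bar>g (Suc l) - g l\<bar>" by (simp add: power2_eq_square)
      also have "\<dots> \<le> (2 * K) * (W l - W (Suc l))"
        using gK[of l] gK[of "Suc l"] step[of l] assms by (intro mult_mono) auto
      finally show ?thesis .
    qed
    have e: "(g N)\<^sup>2 \<le> 2 * K * W N"
    proof -
      have "(g N)\<^sup>2 = \<bar>g N\<bar> * \<bar>g N\<bar>" by (simp add: power2_eq_square)
      also have "\<dots> \<le> (2 * K) * W N" using gK[of N] g[of N] assms by (intro mult_mono) auto
      finally show ?thesis .
    qed
    have "(\<Sum>l<N. coupling_weight m l * (g (Suc l) - g l)\<^sup>2) + coupling_weight m N * (g N)\<^sup>2
       \<le> (\<Sum>l<N. coupling_weight m l * (2 * K * (W l - W (Suc l)))) + coupling_weight m N * (2 * K * W N)"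
      by (intro add_mono sum_mono mult_left_mono d e cw)
    also have "\<dots> = 2 * K * ((\<Sum>l<N. coupling_weight m l * (W l - W (Suc l))) + coupling_weight m N * W N)"
      by (simp add: sum_distrib_left algebra_simps)
    also have "\<dots> = 2 * K * (\<Sum>l<Suc N. real ((l + m) choose m) * W l)"
      by (simp only: Abel_coupling)
    also have "\<dots> \<le> 2 * K * (\<Sum>l<Suc N. (real l + 1) ^ m * (K * exp (- \<beta> * real l / L)))"
      using assms by (intro mult_left_mono sum_mono mult_mono binomial_add_le_power W W0) auto
    also have "\<dots> = 2 * K * K * (\<Sum>l<Suc N. (real l + 1) ^ m * exp (- \<beta> * real l / L))"
      by (simp only: sum_distrib_left mult_ac)
    also have "\<dots> \<le> 2 * K * K * (C * L ^ (m + 1))"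
      using assms by (intro mult_left_mono C(2)[rule_format] L) auto
    finally show "(\<Sum>l<N. coupling_weight m l * (g (Suc l) - g l)\<^sup>2) + coupling_weight m N * (g N)\<^sup>2 \<le> 2 * K * K * C * L ^ (m + 1)"
      by (simp add: mult_ac)
  qed
qed

lemma harmonic_weight_le: "harmonic_weight m l \<le> 2 * (real l + 1) ^ (m + 1)"
proof -
  have "(2 * real l + real m + 1) / (real m + 1) \<le> 2 * (real l + 1)"
    by (simp add: field_simps)
  then have "harmonic_weight m l \<le> (2 * (real l + 1)) * (real l + 1) ^ m"
    unfolding harmonic_weight_def by (intro mult_mono binomial_add_le_power) auto
  also have "\<dots> = 2 * (real l + 1) ^ (m + 1)" by simp
  finally show ?thesis .
qed

lemma harmonic_weight_nonneg: "harmonic_weight m l \<ge> 0"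
  by (simp add: harmonic_weight_def)

lemma harmonic_weight_ge: "(real l / (real m + 1)) ^ (m + 1) \<le> harmonic_weight m l"
proof -
  have "(real l / (real m + 1)) ^ m \<le> (real (l + m) / real m) ^ m"
  proof (cases "m = 0")
    case False
    have "real l * real m \<le> real (l + m) * (real m + 1)" by (simp add: algebra_simps)
    then have "real l / (real m + 1) \<le> real (l + m) / real m" using False by (simp add: field_simps)
    then show ?thesis by (intro power_mono) auto
  qed simp
  also have "\<dots> \<le> real ((l + m) choose m)" by (rule binomial_ge_n_over_k_pow_k) simp
  finally have "(real l / (real m + 1)) ^ m \<le> real ((l + m) choose m)" .
  moreover have "real l / (real m + 1) \<le> (2 * real l + real m + 1) / (real m + 1)"
    by (intro divide_right_mono) auto
  ultimately have "(real l / (real m + 1)) * (real l / (real m + 1)) ^ m \<le> harmonic_weight m l"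
    unfolding harmonic_weight_def by (intro mult_mono) auto
  then show ?thesis by simp
qed

lemma laplacian_energy_le:
  fixes K \<beta> :: real
  assumes "K > 0" "\<beta> > 0" and lam: "lam = (real m + 1) / 2"
  shows "\<exists>C>0. \<forall>L\<ge>1. \<forall>g N. (\<forall>l. \<bar>g l\<bar> \<le> K * exp (- \<beta> * real l / L)) \<longrightarrow>
       (\<Sum>l<N. real l * (real l + 2 * lam) * harmonic_weight m l * (g l)\<^sup>2) \<le> C * L ^ (m + 4)"
proof -
  obtain C where C: "C > 0"
    "\<forall>L\<ge>1. \<forall>N. (\<Sum>l<N. (real l + 1) ^ (m + 3) * exp (- \<beta> * real l / L)) \<le> C * L ^ (m + 3 + 1)"
    using power_exp_sum_le[OF assms(2), of "m + 3"] by blast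
  define B where "B = (real m + 1) * 2 * K\<^sup>2"
  show ?thesis
  proof (intro exI[of _ "B * C"] conjI allI impI)
    show "B * C > 0" using C assms by (simp add: B_def add_pos_pos)
    fix L :: real and g :: "nat \<Rightarrow> real" and N :: nat
    assume L: "1 \<le> L" and "\<forall>l. \<bar>g l\<bar> \<le> K * exp (- \<beta> * real l / L)"
    then have g: "\<bar>g l\<bar> \<le> K * exp (- \<beta> * real l / L)" for l by blast
    have "real l * (real l + 2 * lam) * harmonic_weight m l * (g l)\<^sup>2 \<le> B * ((real l + 1) ^ (m + 3) * exp (- \<beta> * real l / L))" for l
    proof -
      have "(g l)\<^sup>2 = \<bar>g l\<bar> * \<bar>g l\<bar>" by (simp add: power2_eq_square)
      also have "\<dots> \<le> (K * exp (- \<beta> * real l / L)) * (K * 1)"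
      proof (intro mult_mono g)
        have "K * exp (- \<beta> * real l / L) \<le> K * 1" using assms L by (intro mult_left_mono) auto
        then show "\<bar>g l\<bar> \<le> K * 1" using g[of l] by linarith
      qed (use assms in auto)
      finally have g2: "(g l)\<^sup>2 \<le> K\<^sup>2 * exp (- \<beta> * real l / L)" by (simp add: power2_eq_square mult_ac)
      have lam2: "2 * lam = real m + 1" by (simp add: lam)
      have "real l + 2 * lam \<le> (real m + 1) * (real l + 1)" unfolding lam2 by (simp add: algebra_simps)
      moreover have lam0: "lam \<ge> 0" by (simp add: lam)
      ultimately have A: "real l * (real l + 2 * lam) \<le> (real l + 1) * ((real m + 1) * (real l + 1))"
        by (intro mult_mono) auto
      have "real l * (real l + 2 * lam) * harmonic_weight m l * (g l)\<^sup>2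
          \<le> ((real l + 1) * ((real m + 1) * (real l + 1))) * (2 * (real l + 1) ^ (m + 1)) * (K\<^sup>2 * exp (- \<beta> * real l / L))"
        by (rule mult_mono[OF mult_mono[OF A harmonic_weight_le] g2]) (use lam0 harmonic_weight_nonneg[of m l] in auto)
      also have "\<dots> = B * ((real l + 1) ^ (m + 3) * exp (- \<beta> * real l / L))"
        by (simp add: B_def power_add numeral_3_eq_3)
      finally show ?thesis .
    qed
    then have "(\<Sum>l<N. real l * (real l + 2 * lam) * harmonic_weight m l * (g l)\<^sup>2)
        \<le> B * (\<Sum>l<N. (real l + 1) ^ (m + 3) * exp (- \<beta> * real l / L))"
      unfolding sum_distrib_left by (intro sum_mono)
    also have "\<dots> \<le> B * (C * L ^ (m + 3 + 1))"
      by (intro mult_left_mono C(2)[rule_format] L) (simp add: B_def)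
    finally show "(\<Sum>l<N. real l * (real l + 2 * lam) * harmonic_weight m l * (g l)\<^sup>2) \<le> B * C * L ^ (m + 4)"
      by (simp add: mult.assoc add.commute[of m])
  qed
qed

text \<open>There are at least \<open>L / 2\<close> integers between \<open>L\<close> and \<open>2 * L\<close>, each contributing at least a
  fixed positive multiple of \<open>L ^ (m + 1)\<close>.\<close>
lemma harmonic_mass_ge:
  fixes L h0 :: real
  assumes L: "L \<ge> 2" and h0: "h0 > 0" and g: "\<And>l. L \<le> real l \<Longrightarrow> real l \<le> 2 * L \<Longrightarrow> h0 \<le> g l"
    and N: "real N > 2 * L"
  shows "h0\<^sup>2 / (2 * (real m + 1) ^ (m + 1)) * L ^ (m + 2) \<le> (\<Sum>l<N. harmonic_weight m l * (g l)\<^sup>2)"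
proof -
  define a j where "a = nat \<lceil>L\<rceil>" and "j = nat \<lfloor>L\<rfloor>"
  have a: "L \<le> real a" "real a < L + 1" using L unfolding a_def by linarith+
  have j: "real j \<le> L" "L - 1 < real j" using L unfolding j_def by linarith+
  have range: "L \<le> real l" "real l \<le> 2 * L" if "l \<in> {a..<a + j}" for l
  proof -
    have "real l + 1 \<le> real a + real j" using that by (metis Suc_leI atLeastLessThan_iff of_nat_Suc of_nat_add of_nat_le_iff add.commute)
    then show "real l \<le> 2 * L" using a j by linarith
    show "L \<le> real l" using that a by (meson atLeastLessThan_iff of_nat_le_iff order_trans)
  qed
  have "L ^ (m + 1) * (L / 2) \<le> L ^ (m + 1) * real j"
    using L j by (intro mult_left_mono) auto
  then have "h0\<^sup>2 / (2 * (real m + 1) ^ (m + 1)) * L ^ (m + 2) \<le> real j * ((L / (real m + 1)) ^ (m + 1) * h0\<^sup>2)"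
  proof -
    assume le: "L ^ (m + 1) * (L / 2) \<le> L ^ (m + 1) * real j"
    have "h0\<^sup>2 / (2 * (real m + 1) ^ (m + 1)) * L ^ (m + 2) = h0\<^sup>2 / (real m + 1) ^ (m + 1) * (L ^ (m + 1) * (L / 2))"
      by (simp add: mult_ac)
    also have "\<dots> \<le> h0\<^sup>2 / (real m + 1) ^ (m + 1) * (L ^ (m + 1) * real j)"
      by (rule mult_left_mono[OF le]) simp
    finally show ?thesis by (simp only: power_divide times_divide_eq_left times_divide_eq_right mult_ac)
  qed
  also have "\<dots> = (\<Sum>l\<in>{a..<a + j}. (L / (real m + 1)) ^ (m + 1) * h0\<^sup>2)" by simp
  also have "\<dots> \<le> (\<Sum>l\<in>{a..<a + j}. harmonic_weight m l * (g l)\<^sup>2)"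
  proof (intro sum_mono mult_mono)
    fix l assume l: "l \<in> {a..<a + j}"
    have "(L / (real m + 1)) ^ (m + 1) \<le> (real l / (real m + 1)) ^ (m + 1)"
      using L range(1)[OF l] by (intro power_mono divide_right_mono) auto
    also have "\<dots> \<le> harmonic_weight m l" by (rule harmonic_weight_ge)
    finally show "(L / (real m + 1)) ^ (m + 1) \<le> harmonic_weight m l" .
    show "h0\<^sup>2 \<le> (g l)\<^sup>2" using g[OF range[OF l]] h0 by (intro power_mono) auto
  qed (use harmonic_weight_nonneg in auto)
  also have "\<dots> \<le> (\<Sum>l<N. harmonic_weight m l * (g l)\<^sup>2)"
  proof (rule sum_mono2)
    show "{a..<a + j} \<subseteq> {..<N}"
    proof
      fix l assume "l \<in> {a..<a + j}"
      from range(2)[OF this] N have "real l < real N" by linarith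
      then show "l \<in> {..<N}" by simp
    qed
  qed (auto simp: harmonic_weight_nonneg)
  finally show ?thesis .
qed

section \<open>The coefficient profile\<close>

definition bump :: "real \<Rightarrow> real \<Rightarrow> real" where
  "bump c u = u powr c * exp (- u)"

lemma bump_pos: "u > 0 \<Longrightarrow> bump c u > 0"
  by (simp add: bump_def)

lemma bump_eq_exp: "u > 0 \<Longrightarrow> bump c u = exp (c * ln u - u)"
  by (simp add: bump_def powr_def exp_diff exp_minus field_simps)

text \<open>Here and in \<open>bump_antimono\<close> one compares \<open>c * ln u - u\<close> at two points by means of
  \<open>ln s \<le> s - 1\<close>.\<close>
lemma bump_mono:
  assumes "0 < u" "u \<le> v" "v \<le> c"
  shows "bump c u \<le> bump c v"
proof -
  have "ln (u / v) \<le> u / v - 1" using assms by (intro ln_le_minus_one) auto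
  then have "c * (1 - u / v) \<le> c * (ln v - ln u)" using assms by (intro mult_left_mono) (auto simp: ln_div)
  moreover have "v - u \<le> c * (1 - u / v)"
  proof -
    have "v - u = v * (1 - u / v)" using assms by (simp add: field_simps)
    also have "\<dots> \<le> c * (1 - u / v)" using assms by (intro mult_right_mono) (auto simp: field_simps)
    finally show ?thesis .
  qed
  ultimately have "c * ln u - u \<le> c * ln v - v" by (simp add: algebra_simps)
  then show ?thesis using assms by (simp add: bump_eq_exp)
qed

lemma bump_antimono:
  assumes "0 < c" "c \<le> u" "u \<le> v"
  shows "bump c v \<le> bump c u"
proof -
  have "ln (v / u) \<le> v / u - 1" using assms by (intro ln_le_minus_one) auto
  then have "c * (ln v - ln u) \<le> c * (v / u - 1)" using assms by (intro mult_left_mono) (auto simp: ln_div)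
  moreover have "c * (v / u - 1) \<le> v - u"
  proof -
    have "c * (v / u - 1) \<le> u * (v / u - 1)" using assms by (intro mult_right_mono) (auto simp: field_simps)
    also have "\<dots> = v - u" using assms by (simp add: field_simps)
    finally show ?thesis .
  qed
  ultimately have "c * ln v - v \<le> c * ln u - u" by (simp add: algebra_simps)
  then show ?thesis using assms by (simp add: bump_eq_exp)
qed

lemma bump_le_max: "c > 0 \<Longrightarrow> u > 0 \<Longrightarrow> bump c u \<le> bump c c"
  using bump_mono[of u c c] bump_antimono[of c c u] by (cases "u \<le> c") auto

lemma bump_ge_min:
  assumes "c > 0" "0 < a" "a \<le> u" "u \<le> b"
  shows "min (bump c a) (bump c b) \<le> bump c u"
  using bump_mono[of a u c] bump_antimono[of c u b] assms by (cases "u \<le> c") auto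

text \<open>Half of the exponential is split off, and \<open>u powr c * exp (- u / 2)\<close> is again a rescaled bump,
  hence bounded.\<close>
lemma bump_le_exp:
  assumes "c > 0" "u > 0"
  shows "bump c u \<le> 2 powr c * bump c c * exp (- u / 2)"
proof -
  have "bump c u = 2 powr c * bump c (u / 2) * exp (- u / 2)"
    using assms by (simp add: bump_def powr_divide exp_add[symmetric])
  also have "\<dots> \<le> 2 powr c * bump c c * exp (- u / 2)"
    using assms by (intro mult_right_mono mult_left_mono bump_le_max) auto
  finally show ?thesis .
qed

text \<open>The total variation of \<open>bump c\<close> on the half-line from \<open>u\<close> to infinity: \<open>bump c\<close> increases up
  to \<open>c\<close> and decreases to \<open>0\<close> afterwards.\<close>
definition bump_variation :: "real \<Rightarrow> real \<Rightarrow> real" where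
  "bump_variation c u = (if u \<le> c then 2 * bump c c - bump c u else bump c u)"

lemma bump_le_variation: "c > 0 \<Longrightarrow> u > 0 \<Longrightarrow> bump c u \<le> bump_variation c u"
  using bump_le_max[of c u] by (auto simp: bump_variation_def)

lemma bump_variation_step:
  assumes "c > 0" "0 < u" "u \<le> v"
  shows "\<bar>bump c v - bump c u\<bar> \<le> bump_variation c u - bump_variation c v"
  using bump_mono[of u v c] bump_antimono[of c u v] bump_le_max[of c u] bump_le_max[of c v] assms
  by (auto simp: bump_variation_def)

lemma bump_variation_le_exp:
  assumes "c > 0" "u > 0"
  shows "bump_variation c u \<le> (2 powr c + 2 * exp (c / 2)) * bump c c * exp (- u / 2)"
proof (cases "u \<le> c")
  case True
  have "bump_variation c u \<le> 2 * bump c c" using True bump_pos[of u c] assms by (simp add: bump_variation_def)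
  also have "\<dots> \<le> 2 * bump c c * (exp (c / 2) * exp (- u / 2))"
  proof -
    have "1 \<le> exp (c / 2) * exp (- u / 2)" using True by (simp add: exp_add[symmetric])
    then have "2 * bump c c * 1 \<le> 2 * bump c c * (exp (c / 2) * exp (- u / 2))"
      using bump_pos[of c c] assms by (intro mult_left_mono) auto
    then show ?thesis by simp
  qed
  also have "\<dots> \<le> (2 powr c + 2 * exp (c / 2)) * bump c c * exp (- u / 2)"
    using bump_pos[of c c] assms by (simp add: algebra_simps)
  finally show ?thesis .
next
  case False
  then have "bump_variation c u \<le> 2 powr c * bump c c * exp (- u / 2)"
    using bump_le_exp[OF assms] by (simp add: bump_variation_def)
  also have "\<dots> \<le> (2 powr c + 2 * exp (c / 2)) * bump c c * exp (- u / 2)"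
    using bump_pos[of c c] assms by (simp add: algebra_simps)
  finally show ?thesis .
qed

text \<open>The sequence \<open>q(l) / l ^ degree q\<close> is positive for \<open>l \<ge> 1\<close> and tends to the leading
  coefficient, which is not zero; so the sequence and that of its reciprocals are bounded.\<close>
lemma poly_power_bounds:
  fixes q :: "real poly"
  assumes deg: "degree q \<ge> 1" and pos: "\<forall>l::nat. l \<ge> 1 \<longrightarrow> poly q (real l) > 0"
  shows "\<exists>A B. 0 < A \<and> 0 < B \<and> (\<forall>l::nat. l \<ge> 1 \<longrightarrow> A * real l ^ degree q \<le> poly q (real l) \<and> poly q (real l) \<le> B * real l ^ degree q)"
proof -
  define s where "s = (\<lambda>l::nat. poly q (real l) / real l ^ degree q)"
  have "((\<lambda>x. poly q x / x ^ degree q) \<longlongrightarrow> lead_coeff q) at_infinity"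
    by (rule poly_divide_tendsto_aux)
  then have lim: "s \<longlonglongrightarrow> lead_coeff q" unfolding s_def
    by (rule filterlim_compose) (rule filterlim_at_top_imp_at_infinity[OF filterlim_real_sequentially])
  have lc: "lead_coeff q \<noteq> 0" using deg by auto
  obtain B where B: "B > 0" "\<And>l. \<bar>s l\<bar> \<le> B"
    using convergent_imp_Bseq[OF convergentI[OF lim]] unfolding Bseq_def by auto
  obtain D where D: "D > 0" "\<And>l. \<bar>inverse (s l)\<bar> \<le> D"
    using convergent_imp_Bseq[OF convergentI[OF tendsto_inverse[OF lim lc]]] unfolding Bseq_def by auto
  show ?thesis
  proof (intro exI conjI allI impI)
    show "1 / D > 0" "B > 0" using D B by auto
    fix l :: nat assume l: "l \<ge> 1"
    then have s: "s l > 0" "poly q (real l) = s l * real l ^ degree q" using pos by (auto simp: s_def)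
    show "poly q (real l) \<le> B * real l ^ degree q"
      unfolding s(2) using B(2)[of l] by (intro mult_right_mono) auto
    have "1 / D \<le> s l" using D(1) D(2)[of l] s(1) by (simp add: field_simps)
    then show "1 / D * real l ^ degree q \<le> poly q (real l)"
      unfolding s(2) by (intro mult_right_mono) auto
  qed
qed

definition profile :: "real \<Rightarrow> real poly \<Rightarrow> real \<Rightarrow> nat \<Rightarrow> real" where
  "profile c q \<epsilon> l = rpow (\<epsilon> * poly q (real l)) c * exp (- (\<epsilon> * poly q (real l)))"

lemma abs_rpow:
  assumes "c > 0" "rpow_defined x c"
  shows "\<bar>rpow x c\<bar> = \<bar>x\<bar> powr c"
proof (cases "c \<in> \<int>")
  case True
  then obtain i :: int where i: "c = of_int i" by (elim Ints_cases)
  with assms have i0: "i > 0" by simp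
  then have "\<bar>rpow x c\<bar> = \<bar>x\<bar> ^ nat i" using i by (simp add: rpow_def power_int_def power_abs)
  also have "\<dots> = \<bar>x\<bar> powr c"
  proof (cases "x = 0")
    case False
    have "c = real (nat i)" using i i0 by simp
    then show ?thesis using powr_realpow[of "\<bar>x\<bar>" "nat i"] False by simp
  qed (use i0 assms in auto)
  finally show ?thesis .
next
  case False
  then show ?thesis using assms by (auto simp: rpow_def rpow_defined_def)
qed

lemma rpow_pos: 
  assumes "c > 0" "x > 0"
  shows "rpow x c = x powr c"
proof -
  have "rpow x c \<ge> 0" using assms by (auto simp: rpow_def)
  then show ?thesis using abs_rpow[of c x] assms by (simp add: rpow_defined_def)
qed

lemma profile_eq_bump:
  assumes "c > 0" "\<epsilon> > 0" "poly q (real l) > 0"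
  shows "profile c q \<epsilon> l = bump c (\<epsilon> * poly q (real l))"
  using assms by (simp add: profile_def bump_def rpow_pos)

text \<open>Here \<open>\<epsilon> = \<rho> powr a\<close> and \<open>L = \<rho> powr (- a / \<nu>)\<close>. The argument of the bump at \<open>l\<close> is comparable
  to \<open>(l / L) ^ \<nu>\<close>, which is at least \<open>l / L - 1\<close>; this gives the exponential decay on the scale
  \<open>L\<close>. For \<open>l\<close> between \<open>L\<close> and \<open>2 * L\<close> the argument stays in a fixed compact interval. The
  monotonicity of \<open>q\<close> lets the variation of the bump bound the variation of the profile, of which
  \<open>W\<close> is a majorant.\<close>
lemma profile_bounds:
  fixes q :: "real poly"
  assumes c: "c > 0" and deg: "degree q \<ge> 1" and pos: "\<forall>l::nat. l \<ge> 1 \<longrightarrow> poly q (real l) > 0"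
    and mono: "mono_on {1::nat..} (\<lambda>l. poly q (real l))"
  shows "\<exists>K \<beta> h0. 0 < K \<and> 0 < \<beta> \<and> 0 < h0 \<and>
    (\<forall>\<epsilon> L. 0 < \<epsilon> \<and> \<epsilon> \<le> 1 \<and> 1 \<le> L \<and> \<epsilon> * L ^ degree q = 1 \<and> rpow_defined (\<epsilon> * poly q 0) c \<longrightarrow>
      (\<exists>W. (\<forall>l. \<bar>profile c q \<epsilon> l\<bar> \<le> W l) \<and> (\<forall>l. W l \<le> K * exp (- \<beta> * real l / L)) \<and>
           (\<forall>l. \<bar>profile c q \<epsilon> (Suc l) - profile c q \<epsilon> l\<bar> \<le> W l - W (Suc l))) \<and>
      (\<forall>l. L \<le> real l \<and> real l \<le> 2 * L \<longrightarrow> h0 \<le> profile c q \<epsilon> l))"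
proof -
  obtain A B where AB: "A > 0" "B > 0"
    "\<And>l::nat. l \<ge> 1 \<Longrightarrow> A * real l ^ degree q \<le> poly q (real l)"
    "\<And>l::nat. l \<ge> 1 \<Longrightarrow> poly q (real l) \<le> B * real l ^ degree q"
    using poly_power_bounds[OF deg pos] by blast
  define K1 where "K1 = (2 powr c + 2 * exp (c / 2)) * bump c c * exp (A / 2)"
  define Q where "Q = \<bar>poly q 0\<bar> powr c * exp \<bar>poly q 0\<bar>"
  define h0 where "h0 = min (bump c A) (bump c (B * 2 ^ degree q))"
  have K1: "K1 > 0" using bump_pos[OF c, of c] c by (simp add: K1_def add_pos_pos)
  have Q: "Q \<ge> 0" by (simp add: Q_def)
  have main: "(\<exists>W. (\<forall>l. \<bar>profile c q \<epsilon> l\<bar> \<le> W l) \<and> (\<forall>l. W l \<le> (2 * K1 + Q) * exp (- (A / 2) * real l / L)) \<and>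
           (\<forall>l. \<bar>profile c q \<epsilon> (Suc l) - profile c q \<epsilon> l\<bar> \<le> W l - W (Suc l))) \<and>
      (\<forall>l. L \<le> real l \<and> real l \<le> 2 * L \<longrightarrow> h0 \<le> profile c q \<epsilon> l)"
    if \<epsilon>: "0 < \<epsilon>" "\<epsilon> \<le> 1" and L: "1 \<le> L" and \<epsilon>L: "\<epsilon> * L ^ degree q = 1" and def0: "rpow_defined (\<epsilon> * poly q 0) c" for \<epsilon> L
  proof -
    define u where "u = (\<lambda>l::nat. \<epsilon> * poly q (real l))"
    have u_pos: "u l > 0" if "l \<ge> 1" for l using pos \<epsilon> that by (simp add: u_def)
    have prof: "profile c q \<epsilon> l = bump c (u l)" if "l \<ge> 1" for l
      using profile_eq_bump[OF c \<epsilon>(1)] pos that by (simp add: u_def)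
    have Lpow: "\<epsilon> * x ^ degree q = (x / L) ^ degree q" for x
      using \<epsilon>L L by (simp add: power_divide field_simps)
    have u_ge: "A * (real l / L) ^ degree q \<le> u l" and u_le: "u l \<le> B * (real l / L) ^ degree q" if "l \<ge> 1" for l
      using mult_left_mono[OF AB(3)[OF that], of \<epsilon>] mult_left_mono[OF AB(4)[OF that], of \<epsilon>] \<epsilon>
      unfolding Lpow[symmetric] u_def by (simp_all add: mult_ac)
    have u_lin: "A * (real l / L - 1) \<le> u l" if "l \<ge> 1" for l
    proof -
      have "real l / L - 1 \<le> (real l / L) ^ degree q"
      proof (cases "real l / L \<ge> 1")
        case True
        then have "(real l / L) ^ 1 \<le> (real l / L) ^ degree q" using deg by (intro power_increasing) auto
        then show ?thesis by simp
      next
        case False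
        then show ?thesis using L by (smt (verit) divide_nonneg_nonneg of_nat_0_le_iff zero_le_power)
      qed
      then have "A * (real l / L - 1) \<le> A * (real l / L) ^ degree q" using AB by (intro mult_left_mono) auto
      with u_ge[OF that] show ?thesis by linarith
    qed
    have u_exp: "exp (- u l / 2) \<le> exp (A / 2) * exp (- (A / 2) * real l / L)" if "l \<ge> 1" for l
    proof -
      have "- u l / 2 \<le> A / 2 + - (A / 2) * real l / L" using u_lin[OF that] by (simp add: algebra_simps)
      then show ?thesis by (simp only: exp_add[symmetric] exp_le_cancel_iff)
    qed
    define W1 where "W1 = (\<lambda>l. bump_variation c (u l))"
    have W1_le: "W1 l \<le> K1 * exp (- (A / 2) * real l / L)" if "l \<ge> 1" for l
    proof -
      have "W1 l \<le> (2 powr c + 2 * exp (c / 2)) * bump c c * exp (- u l / 2)"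
        unfolding W1_def by (rule bump_variation_le_exp[OF c u_pos[OF that]])
      also have "\<dots> \<le> (2 powr c + 2 * exp (c / 2)) * bump c c * (exp (A / 2) * exp (- (A / 2) * real l / L))"
        using bump_pos[OF c, of c] by (intro mult_left_mono u_exp[OF that]) (auto intro: add_nonneg_nonneg)
      finally show ?thesis by (simp add: K1_def mult_ac)
    qed
    \<comment> \<open>at \<open>l = 0\<close> the argument of the bump may be nonpositive, so the first jump is accounted for separately\<close>
    define W where "W = (\<lambda>l. if l = 0 then W1 1 + \<bar>profile c q \<epsilon> 1\<bar> + \<bar>profile c q \<epsilon> 0\<bar> else W1 l)"
    have g1: "\<bar>profile c q \<epsilon> l\<bar> \<le> W1 l" if "l \<ge> 1" for l
      using bump_le_variation[OF c u_pos[OF that]] bump_pos[OF u_pos[OF that], of c] by (simp add: W1_def prof[OF that])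
    have g0: "\<bar>profile c q \<epsilon> 0\<bar> \<le> Q"
    proof -
      have le: "\<bar>\<epsilon> * poly q 0\<bar> \<le> \<bar>poly q 0\<bar>" using \<epsilon> by (simp add: abs_mult mult_left_le_one_le)
      have "\<bar>profile c q \<epsilon> 0\<bar> = \<bar>\<epsilon> * poly q 0\<bar> powr c * exp (- (\<epsilon> * poly q 0))"
        unfolding profile_def abs_mult[of "rpow _ _"] of_nat_0 abs_rpow[OF c def0] by simp
      also have "\<dots> \<le> \<bar>poly q 0\<bar> powr c * exp \<bar>poly q 0\<bar>"
        using le c by (intro mult_mono powr_mono2) auto
      finally show ?thesis by (simp add: Q_def)
    qed
    have W1_1: "W1 1 \<le> K1"
    proof -
      have "exp (- (A / 2) * real 1 / L) \<le> 1" using AB L by simp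
      then have "K1 * exp (- (A / 2) * real 1 / L) \<le> K1 * 1" using K1 by (intro mult_left_mono) auto
      with W1_le[of 1] show ?thesis by simp
    qed
    have "W l \<le> (2 * K1 + Q) * exp (- (A / 2) * real l / L)" for l
    proof (cases "l = 0")
      case True
      then show ?thesis using g0 g1[of 1] W1_1 by (simp add: W_def)
    next
      case False
      then have "W l \<le> K1 * exp (- (A / 2) * real l / L)" using W1_le[of l] by (simp add: W_def)
      also have "\<dots> \<le> (2 * K1 + Q) * exp (- (A / 2) * real l / L)" using K1 Q by (intro mult_right_mono) auto
      finally show ?thesis .
    qed
    moreover have "\<bar>profile c q \<epsilon> l\<bar> \<le> W l" for l
      using g1[of l] g1[of 1] by (cases "l = 0") (auto simp: W_def)
    moreover have "\<bar>profile c q \<epsilon> (Suc l) - profile c q \<epsilon> l\<bar> \<le> W l - W (Suc l)" for l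
    proof (cases "l = 0")
      case True
      then show ?thesis by (simp add: W_def)
    next
      case False
      then have l: "l \<ge> 1" by simp
      have "poly q (real l) \<le> poly q (real (Suc l))" using mono_onD[OF mono, of l "Suc l"] l by simp
      then have "u l \<le> u (Suc l)" using \<epsilon> by (simp add: u_def)
      from bump_variation_step[OF c u_pos[OF l] this] show ?thesis
        using False by (simp add: W_def W1_def prof l del: of_nat_Suc)
    qed
    moreover have "h0 \<le> profile c q \<epsilon> l" if "L \<le> real l" "real l \<le> 2 * L" for l
    proof -
      have l: "l \<ge> 1" using that L by linarith
      have "1 \<le> (real l / L) ^ degree q" using that L by (intro one_le_power) auto
      then have "A * 1 \<le> A * (real l / L) ^ degree q" using AB by (intro mult_left_mono) auto
      then have lo: "A \<le> u l" using u_ge[OF l] by linarith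
      have "(real l / L) ^ degree q \<le> 2 ^ degree q" using that L by (intro power_mono) (auto simp: field_simps)
      then have "B * (real l / L) ^ degree q \<le> B * 2 ^ degree q" using AB by (intro mult_left_mono) auto
      then have hi: "u l \<le> B * 2 ^ degree q" using u_le[OF l] by linarith
      show ?thesis using bump_ge_min[OF c AB(1) lo hi] by (simp add: h0_def prof[OF l])
    qed
    ultimately show ?thesis by blast
  qed
  have "0 < 2 * K1 + Q" "0 < A / 2" "0 < h0"
    using K1 Q AB by (auto simp: h0_def bump_pos)
  then show ?thesis
    by (intro exI[of _ "2 * K1 + Q"] exI[of _ "A / 2"] exI[of _ h0] conjI[OF _ conjI[OF _ conjI]] allI impI)
       (assumption | elim conjE, rule main, assumption+)+
qed

section \<open>The Laplace--Beltrami operator on zonal functions\<close>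

lemma coord_sgn_bound: "\<bar>sgn y $ k\<bar> \<le> 1" for y :: "real ^ 'd"
proof -
  have "\<bar>sgn y $ k\<bar> \<le> norm (sgn y)" by (rule component_le_norm_cart)
  also have "\<dots> \<le> 1" by (simp add: norm_sgn)
  finally show ?thesis .
qed

lemma coord_sgn_range: "sgn y $ k \<in> {- 1..1}" for y :: "real ^ 'd"
  using coord_sgn_bound[of y k] by auto

lemma has_real_derivative_norm_line:
  fixes y :: "real ^ 'd"
  assumes "y \<noteq> 0"
  shows "((\<lambda>t. norm (y + t *\<^sub>R axis i 1)) has_real_derivative y $ i / norm y) (at 0)"
proof -
  have "(norm has_derivative (\<lambda>h. h \<bullet> sgn y)) (at (y + 0 *\<^sub>R axis i 1))"
    using has_derivative_norm[OF assms] by simp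
  moreover have "((\<lambda>t. y + t *\<^sub>R axis i 1) has_derivative (\<lambda>t. t *\<^sub>R axis i 1)) (at 0)"
    by (auto intro!: derivative_eq_intros)
  ultimately have "((\<lambda>t. norm (y + t *\<^sub>R axis i 1)) has_derivative (\<lambda>t. (t *\<^sub>R axis i 1) \<bullet> sgn y)) (at 0)"
    by (rule has_derivative_compose[rotated])
  moreover have "(\<lambda>t. (t *\<^sub>R axis i 1) \<bullet> sgn y) = (*) (y $ i / norm y)"
    by (auto simp: fun_eq_iff inner_axis' sgn_div_norm divide_inverse mult_ac)
  ultimately show ?thesis by (simp add: has_field_derivative_def)
qed

definition kronecker :: "'d \<Rightarrow> 'd \<Rightarrow> real" where "kronecker i j = (if i = j then 1 else 0)"

text \<open>First and second partial derivatives of \<open>sgn y $ k\<close>, the coordinate \<open>k\<close> of the radial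
  projection of \<open>y\<close>.\<close>
definition dcoord :: "'d::finite \<Rightarrow> 'd \<Rightarrow> real ^ 'd \<Rightarrow> real" where
  "dcoord k i y = kronecker i k / norm y - y $ k * y $ i / norm y ^ 3"

definition ddcoord :: "'d::finite \<Rightarrow> 'd \<Rightarrow> 'd \<Rightarrow> real ^ 'd \<Rightarrow> real" where
  "ddcoord k i j y = 3 * (y $ k * y $ i * y $ j) / norm y ^ 5
     - (kronecker i k * y $ j + kronecker j k * y $ i + kronecker i j * y $ k) / norm y ^ 3"

lemma coord_line: "(y + t *\<^sub>R axis i 1) $ k = y $ k + t * kronecker i k"
  by (simp add: kronecker_def axis_def)

lemma has_real_derivative_sgn_coord_line:
  fixes y :: "real ^ 'd"
  assumes "y \<noteq> 0"
  shows "((\<lambda>t. sgn (y + t *\<^sub>R axis i 1) $ k) has_real_derivative dcoord k i y) (at 0)"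
proof -
  have "((\<lambda>t. (y $ k + t * kronecker i k) / norm (y + t *\<^sub>R axis i 1)) has_real_derivative
      (kronecker i k * norm y - y $ k * (y $ i / norm y)) / (norm y * norm y)) (at 0)"
    using assms by (auto intro!: derivative_eq_intros has_real_derivative_norm_line)
  moreover have "(kronecker i k * norm y - y $ k * (y $ i / norm y)) / (norm y * norm y) = dcoord k i y"
    using assms by (simp add: dcoord_def field_simps power3_eq_cube)
  moreover have "(\<lambda>t. sgn (y + t *\<^sub>R axis i 1) $ k) = (\<lambda>t. (y $ k + t * kronecker i k) / norm (y + t *\<^sub>R axis i 1))"
    by (simp add: fun_eq_iff sgn_div_norm coord_line divide_inverse mult.commute del: vector_add_component)
  ultimately show ?thesis by simp
qed

lemma has_real_derivative_dcoord_line: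
  fixes y :: "real ^ 'd"
  assumes "y \<noteq> 0"
  shows "((\<lambda>t. dcoord k i (y + t *\<^sub>R axis j 1)) has_real_derivative ddcoord k i j y) (at 0)"
proof -
  have n: "norm y > 0" using assms by simp
  have "((\<lambda>t. kronecker i k / norm (y + t *\<^sub>R axis j 1)
       - (y $ k + t * kronecker j k) * (y $ i + t * kronecker j i) / norm (y + t *\<^sub>R axis j 1) ^ 3) has_real_derivative
      - (kronecker i k * (y $ j / norm y)) / (norm y * norm y)
      - ((kronecker j k * y $ i + kronecker j i * y $ k) * norm y ^ 3 - y $ k * y $ i * (3 * (y $ j / norm y) * norm y ^ 2)) / (norm y ^ 3 * norm y ^ 3)) (at 0)"
    using assms by (auto intro!: derivative_eq_intros has_real_derivative_norm_line)
  moreover have "- (kronecker i k * (y $ j / norm y)) / (norm y * norm y)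
      - ((kronecker j k * y $ i + kronecker j i * y $ k) * norm y ^ 3 - y $ k * y $ i * (3 * (y $ j / norm y) * norm y ^ 2)) / (norm y ^ 3 * norm y ^ 3)
      = ddcoord k i j y"
    unfolding ddcoord_def kronecker_def using n
    by (simp add: field_simps power3_eq_cube power2_eq_square numeral_eq_Suc)
  ultimately show ?thesis by (simp add: dcoord_def coord_line del: vector_add_component)
qed

lemma continuous_dcoord: "continuous_on (- {0}) (dcoord k i)"
  unfolding dcoord_def by (intro continuous_intros) auto

lemma continuous_ddcoord: "continuous_on (- {0}) (ddcoord k i j)"
  unfolding ddcoord_def by (intro continuous_intros) auto

lemma continuous_sgn_coord: "continuous_on (- {0 :: real ^ 'd}) (\<lambda>y. sgn y $ k)"
  unfolding sgn_div_norm by (intro continuous_intros) auto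

text \<open>The squared gradient and the Laplacian of the coordinate function on the sphere: they produce
  the coefficients of the second and the first derivative in the Laplace--Beltrami operator of a
  zonal function.\<close>
lemma dcoord_sums:
  fixes x :: "real ^ 'd"
  assumes "norm x = 1"
  shows "(\<Sum>i\<in>UNIV. (dcoord k i x)\<^sup>2) = 1 - (x $ k)\<^sup>2" (is ?A)
    and "(\<Sum>i\<in>UNIV. ddcoord k i i x) = - (real CARD('d) - 1) * x $ k" (is ?B)
proof -
  have sq: "(\<Sum>i\<in>UNIV. (x $ i)\<^sup>2) = 1" using assms by (simp add: norm_vec_def L2_set_def)
  have sum_kronecker: "(\<Sum>i\<in>UNIV. kronecker i k * f i) = f k" for f :: "'d \<Rightarrow> real"
  proof -
    have "(\<Sum>i\<in>UNIV. kronecker i k * f i) = (\<Sum>i\<in>UNIV. if i = k then f i else 0)"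
      by (intro sum.cong) (auto simp: kronecker_def)
    then show ?thesis by simp
  qed
  have "(dcoord k i x)\<^sup>2 = kronecker i k * (1 - 2 * (x $ k) * x $ i) + (x $ k)\<^sup>2 * (x $ i)\<^sup>2" for i
    by (simp add: dcoord_def kronecker_def assms power2_eq_square algebra_simps)
  then have "(\<Sum>i\<in>UNIV. (dcoord k i x)\<^sup>2) = (1 - 2 * (x $ k) * x $ k) + (x $ k)\<^sup>2 * 1"
    by (simp only: sum.distrib sum_kronecker sum_distrib_left[symmetric] sq)
  then show ?A by (simp add: power2_eq_square)
  have "ddcoord k i i x = 3 * x $ k * (x $ i)\<^sup>2 - (kronecker i k * (2 * x $ i) + x $ k)" for i
    by (simp add: ddcoord_def kronecker_def assms power2_eq_square algebra_simps)
  then have "(\<Sum>i\<in>UNIV. ddcoord k i i x) = 3 * x $ k * 1 - (2 * x $ k + real CARD('d) * x $ k)"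
    by (simp only: sum.distrib sum_subtractf sum_kronecker sum_distrib_left[symmetric] sq sum_constant)
  then show ?B by (simp add: algebra_simps)
qed

text \<open>At the poles \<open>sgn y $ k\<close> is an endpoint of \<open>[-1, 1]\<close>; the chain rule with one-sided
  derivatives of \<open>F\<close> applies because the inner function never leaves the interval.\<close>
lemma has_real_derivative_zonal_line:
  fixes y :: "real ^ 'd"
  assumes F: "\<And>t. t \<in> {-1..1} \<Longrightarrow> (F has_real_derivative F' t) (at t within {-1..1})" and y: "y \<noteq> 0"
  shows "((\<lambda>t. F (sgn (y + t *\<^sub>R axis i 1) $ k)) has_real_derivative F' (sgn y $ k) * dcoord k i y) (at 0)"
proof -
  have range: "sgn y $ k \<in> {-1..1}" for y :: "real ^ 'd" by (rule coord_sgn_range)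
  have "(F has_real_derivative F' (sgn y $ k)) (at (sgn (y + 0 *\<^sub>R axis i 1) $ k) within range (\<lambda>t. sgn (y + t *\<^sub>R axis i 1) $ k))"
    by simp (rule has_field_derivative_subset[OF F[OF range]], use range in auto)
  from DERIV_image_chain[OF this has_real_derivative_sgn_coord_line[OF y]] show ?thesis
    by (simp add: o_def)
qed

lemma dir_deriv_eqI:
  assumes "((\<lambda>t. f (y + t *\<^sub>R v)) has_vector_derivative D) (at 0)"
  shows "dir_deriv v f y = D" "(\<lambda>t. f (y + t *\<^sub>R v)) differentiable (at 0)"
  using assms by (auto simp: dir_deriv_def vector_derivative_at differentiableI_vector)

text \<open>The derivatives of \<open>F\<close> at the endpoints are one-sided: a series of Gegenbauer polynomials is
  controlled on \<open>[-1, 1]\<close> only.\<close>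
locale zonal_C2 =
  fixes F F1 F2 :: "real \<Rightarrow> real" and k :: "'d::finite"
  assumes F1: "\<And>t. t \<in> {-1..1} \<Longrightarrow> (F has_real_derivative F1 t) (at t within {-1..1})"
    and F2: "\<And>t. t \<in> {-1..1} \<Longrightarrow> (F1 has_real_derivative F2 t) (at t within {-1..1})"
    and contF2: "continuous_on {-1..1} F2"
begin

definition f :: "real ^ 'd \<Rightarrow> complex" where "f x = complex_of_real (F (x $ k))"

definition D1 :: "'d \<Rightarrow> real ^ 'd \<Rightarrow> complex" where
  "D1 i y = complex_of_real (F1 (sgn y $ k) * dcoord k i y)"

definition D2 :: "'d \<Rightarrow> 'd \<Rightarrow> real ^ 'd \<Rightarrow> complex" where
  "D2 i j y = complex_of_real (F2 (sgn y $ k) * dcoord k j y * dcoord k i y + F1 (sgn y $ k) * ddcoord k i j y)"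

lemma radial_ext_f: "radial_ext f y = complex_of_real (F (sgn y $ k))"
  by (simp add: radial_ext_def f_def)

lemma deriv_radial:
  assumes "y \<noteq> 0"
  shows "((\<lambda>t. radial_ext f (y + t *\<^sub>R axis i 1)) has_vector_derivative D1 i y) (at 0)"
  unfolding radial_ext_f D1_def
  by (rule has_vector_derivative_of_real) (rule has_real_derivative_zonal_line[OF F1 assms])

lemma deriv_D1:
  assumes "y \<noteq> 0"
  shows "((\<lambda>t. D1 i (y + t *\<^sub>R axis j 1)) has_vector_derivative D2 i j y) (at 0)"
proof -
  have "((\<lambda>t. F1 (sgn (y + t *\<^sub>R axis j 1) $ k) * dcoord k i (y + t *\<^sub>R axis j 1)) has_real_derivative
     (F2 (sgn y $ k) * dcoord k j y * dcoord k i y + F1 (sgn y $ k) * ddcoord k i j y)) (at 0)"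
    using DERIV_mult[OF has_real_derivative_zonal_line[OF F2 assms, of j k] has_real_derivative_dcoord_line[OF assms, of k i j]]
    by (simp add: mult_ac)
  then show ?thesis unfolding D1_def D2_def
    by (intro has_vector_derivative_of_real) (simp add: has_real_derivative_iff_has_vector_derivative)
qed

lemma dir_deriv_radial: "y \<noteq> 0 \<Longrightarrow> dir_deriv (axis i 1) (radial_ext f) y = D1 i y"
  by (rule dir_deriv_eqI(1)[OF deriv_radial])

lemma deriv_dir_deriv:
  assumes "y \<noteq> 0"
  shows "((\<lambda>t. dir_deriv (axis i 1) (radial_ext f) (y + t *\<^sub>R axis j 1)) has_vector_derivative D2 i j y) (at 0)"
proof (rule has_vector_derivative_transform_within_open[OF deriv_D1[OF assms]])
  have "continuous_on UNIV (\<lambda>t. y + t *\<^sub>R axis j (1::real))" by (intro continuous_intros)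
  then show "open ((\<lambda>t. y + t *\<^sub>R axis j (1::real)) -` (- {0}))"
    by (rule open_vimage[rotated]) auto
  show "0 \<in> (\<lambda>t. y + t *\<^sub>R axis j (1::real)) -` (- {0})" using assms by simp
qed (simp add: dir_deriv_radial)

lemma cont_F: "continuous_on {-1..1} F1"
  using F2 by (metis DERIV_continuous continuous_on_eq_continuous_within)

lemma cont_comp: "continuous_on {-1..1} G \<Longrightarrow> continuous_on (- {0}) (\<lambda>y :: real ^ 'd. G (sgn y $ k))" for G :: "real \<Rightarrow> real"
  by (rule continuous_on_compose2[OF _ continuous_sgn_coord]) (use coord_sgn_range in blast)+

lemma C2_on_sphere_f: "C2_on_sphere f"
proof -
  have c1: "continuous_on (- {0}) (dir_deriv (axis i 1) (radial_ext f))" for i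
  proof -
    have "continuous_on (- {0}) (D1 i)" unfolding D1_def
      by (intro continuous_intros cont_comp cont_F continuous_dcoord)
    then show ?thesis by (rule continuous_on_eq) (simp add: dir_deriv_radial)
  qed
  have c2: "continuous_on (- {0}) (dir_deriv (axis j 1) (dir_deriv (axis i 1) (radial_ext f)))" for i j
  proof -
    have "continuous_on (- {0}) (D2 i j)" unfolding D2_def
      by (intro continuous_intros cont_comp cont_F contF2 continuous_dcoord continuous_ddcoord)
    then show ?thesis by (rule continuous_on_eq) (simp add: dir_deriv_eqI(1)[OF deriv_dir_deriv])
  qed
  have B: "(Basis :: (real ^ 'd) set) = range (\<lambda>i. axis i 1)" by (auto simp: Basis_vec_def)
  show ?thesis
    unfolding C2_on_sphere_def C2_on_def C1_on_def B
    by (auto simp: c1 c2 intro!: dir_deriv_eqI(2)[OF deriv_radial] dir_deriv_eqI(2)[OF deriv_dir_deriv])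
qed

lemma laplace_beltrami_f:
  assumes "x \<in> sphere 0 1"
  shows "laplace_beltrami f x =
    complex_of_real ((1 - (x $ k)\<^sup>2) * F2 (x $ k) - (real CARD('d) - 1) * x $ k * F1 (x $ k))"
proof -
  have x: "norm x = 1" "x \<noteq> 0" using assms by auto
  then have sx: "sgn x = x" by (simp add: sgn_div_norm)
  have "laplace_beltrami f x = (\<Sum>i\<in>UNIV. dir_deriv (axis i 1) (dir_deriv (axis i 1) (radial_ext f)) x)"
    unfolding laplace_beltrami_def
    by (rule sum.reindex_bij_betw[symmetric]) (auto simp: bij_betw_def inj_on_def axis_eq_axis Basis_vec_def)
  also have "\<dots> = (\<Sum>i\<in>UNIV. D2 i i x)"
    using x by (intro sum.cong refl dir_deriv_eqI(1)[OF deriv_dir_deriv])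
  also have "\<dots> = complex_of_real (F2 (x $ k) * (\<Sum>i\<in>UNIV. (dcoord k i x)\<^sup>2) + F1 (x $ k) * (\<Sum>i\<in>UNIV. ddcoord k i i x))"
    by (simp add: D2_def sx power2_eq_square sum.distrib sum_distrib_left mult_ac)
  finally show ?thesis unfolding dcoord_sums[OF x(1)] by (simp add: algebra_simps)
qed

end

section \<open>Zonal series\<close>

text \<open>Pointwise bounded convergence of the profiles suffices, as the surface measure is finite.\<close>
lemma zonal_int_tendsto:
  fixes k :: "'d::finite" and P :: "nat \<Rightarrow> real poly" and \<phi> :: "real \<Rightarrow> real"
  assumes lim: "\<And>t. t \<in> {-1..1} \<Longrightarrow> (\<lambda>N. poly (P N) t) \<longlonglongrightarrow> \<phi> t"
    and bound: "\<And>N t. t \<in> {-1..1} \<Longrightarrow> \<bar>poly (P N) t\<bar> \<le> M"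
  shows "(\<lambda>N. zonal_int k (P N)) \<longlonglongrightarrow> (LINT x|(surface_measure :: (real ^ 'd) measure). \<phi> (x $ k))"
  unfolding zonal_int_def
proof (rule integral_dominated_convergence[where w = "\<lambda>_. M"])
  have range: "x $ k \<in> {-1..1}" if "x \<in> space surface_measure" for x :: "real ^ 'd"
    using abs_coord_le_1[of x k] that by auto
  have meas: "(\<lambda>x :: real ^ 'd. poly (P N) (x $ k)) \<in> borel_measurable surface_measure" for N
    by (intro surface_measurable_continuous continuous_intros)
  show "(\<lambda>x :: real ^ 'd. poly (P N) (x $ k)) \<in> borel_measurable surface_measure" for N by (rule meas)
  show "(\<lambda>x :: real ^ 'd. \<phi> (x $ k)) \<in> borel_measurable surface_measure"
    by (rule borel_measurable_LIMSEQ_real[OF _ meas]) (rule lim[OF range])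
  show "AE x :: real ^ 'd in surface_measure. (\<lambda>N. poly (P N) (x $ k)) \<longlonglongrightarrow> \<phi> (x $ k)"
    by (rule AE_I2) (rule lim[OF range])
  show "AE x :: real ^ 'd in surface_measure. norm (poly (P N) (x $ k)) \<le> M" for N
    by (rule AE_I2) (use bound[OF range] in simp)
qed simp

text \<open>The coefficients decay exponentially on the scale \<open>L\<close>, which dominates the polynomial growth
  of the Gegenbauer polynomials and their derivatives.\<close>
locale zonal_series =
  fixes m :: nat and lam K \<beta> L :: real and g :: "nat \<Rightarrow> real" and k :: "'d::finite"
  assumes dim: "CARD('d) = m + 3" and lam: "lam = (real m + 1) / 2"
    and K: "K > 0" and \<beta>: "\<beta> > 0" and L: "L \<ge> 1"
    and decay: "\<And>l. \<bar>g l\<bar> \<le> K * exp (- \<beta> * real l / L)"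
begin

abbreviation "a \<equiv> zonal_coeff lam g"

definition "F t = (\<Sum>l. a l * poly (gegenbauer_poly lam l) t)"
definition "F1 t = (\<Sum>l. a l * poly (pderiv (gegenbauer_poly lam l)) t)"
definition "F2 t = (\<Sum>l. a l * poly (pderiv (pderiv (gegenbauer_poly lam l))) t)"

text \<open>Absolute convergence, even against polynomial weights: the majorant for the series of the
  function and of its derivatives.\<close>
lemma summable_coeff: "summable (\<lambda>l. \<bar>a l\<bar> * (c * (real l + 1) ^ p))"
proof -
  have le: "\<bar>\<bar>a l\<bar> * (real l + 1) ^ p\<bar> \<le> 2 * K * ((real l + 1) ^ (p + 1) * exp (- \<beta> * real l / L))" for l
  proof -
    have "(real l + lam) / lam \<le> 2 * (real l + 1)" unfolding lam by (simp add: field_simps)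
    moreover have "(real l + lam) / lam \<ge> 0" unfolding lam by (simp add: field_simps)
    ultimately have "\<bar>a l\<bar> \<le> (K * exp (- \<beta> * real l / L)) * (2 * (real l + 1))"
      unfolding zonal_coeff_def abs_mult using decay[of l] by (intro mult_mono) auto
    then have "\<bar>a l\<bar> * (real l + 1) ^ p \<le> (K * exp (- \<beta> * real l / L)) * (2 * (real l + 1)) * (real l + 1) ^ p"
      by (intro mult_right_mono) auto
    also have "\<dots> = 2 * K * ((real l + 1) ^ (p + 1) * exp (- \<beta> * real l / L))"
      by (simp only: power_add power_one_right mult_ac)
    finally show ?thesis by (simp add: abs_of_nonneg)
  qed
  have "summable (\<lambda>l. 2 * K * ((real l + 1) ^ (p + 1) * exp (- \<beta> * real l / L)))"
    by (intro summable_mult summable_power_exp \<beta> L)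
  then have "summable (\<lambda>l. \<bar>a l\<bar> * (real l + 1) ^ p)"
    by (rule summable_comparison_test') (use le in simp)
  from summable_mult[OF this, of c] show ?thesis by (simp add: mult_ac)
qed

lemma uniform_limit_series:
  fixes P :: "nat \<Rightarrow> real \<Rightarrow> real"
  assumes P: "\<forall>l t. \<bar>t\<bar> \<le> 1 \<longrightarrow> \<bar>P l t\<bar> \<le> c * (real l + 1) ^ p"
  shows "uniform_limit {-1..1} (\<lambda>N t. \<Sum>l<N. a l * P l t) (\<lambda>t. \<Sum>l. a l * P l t) sequentially"
    and "t \<in> {-1..1} \<Longrightarrow> summable (\<lambda>l. a l * P l t)"
    and "\<exists>M. \<forall>N. \<forall>t\<in>{-1..1}. \<bar>\<Sum>l<N. a l * P l t\<bar> \<le> M"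
proof -
  have b: "\<bar>a l * P l t\<bar> \<le> \<bar>a l\<bar> * (c * (real l + 1) ^ p)" if "t \<in> {-1..1}" for l t
    unfolding abs_mult by (intro mult_left_mono P[rule_format]) (use that in \<open>auto simp: abs_le_iff\<close>)
  show "uniform_limit {-1..1} (\<lambda>N t. \<Sum>l<N. a l * P l t) (\<lambda>t. \<Sum>l. a l * P l t) sequentially"
    by (rule Weierstrass_m_test[OF _ summable_coeff[of c p]]) (use b in auto)
  show "summable (\<lambda>l. a l * P l t)" if "t \<in> {-1..1}"
    by (rule summable_comparison_test'[OF summable_coeff[of c p]]) (use b[OF that] in auto)
  have "\<bar>\<Sum>l<N. a l * P l t\<bar> \<le> (\<Sum>l. \<bar>a l\<bar> * (c * (real l + 1) ^ p))" if t: "t \<in> {-1..1}" for N t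
  proof -
    have "\<bar>\<Sum>l<N. a l * P l t\<bar> \<le> (\<Sum>l<N. \<bar>a l * P l t\<bar>)" by (rule sum_abs)
    also have "\<dots> \<le> (\<Sum>l<N. \<bar>a l\<bar> * (c * (real l + 1) ^ p))" by (intro sum_mono b t)
    also have "\<dots> \<le> (\<Sum>l. \<bar>a l\<bar> * (c * (real l + 1) ^ p))"
    proof (rule sum_le_suminf[OF summable_coeff])
      show "0 \<le> \<bar>a l\<bar> * (c * (real l + 1) ^ p)" for l
        using order_trans[OF abs_ge_zero b[OF t, of l]] .
    qed auto
    finally show ?thesis .
  qed
  then show "\<exists>M. \<forall>N. \<forall>t\<in>{-1..1}. \<bar>\<Sum>l<N. a l * P l t\<bar> \<le> M" by blast
qed

lemma gegenbauer_poly_bounds: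
  shows "\<forall>l t. \<bar>t\<bar> \<le> 1 \<longrightarrow> \<bar>poly (gegenbauer_poly lam l) t\<bar> \<le> 1 * (real l + 1) ^ m"
    and "\<forall>l t. \<bar>t\<bar> \<le> 1 \<longrightarrow> \<bar>poly (pderiv (gegenbauer_poly lam l)) t\<bar> \<le> (real m + 3) * (real l + 1) ^ (m + 2)"
    and "\<forall>l t. \<bar>t\<bar> \<le> 1 \<longrightarrow>
      \<bar>poly (pderiv (pderiv (gegenbauer_poly lam l))) t\<bar> \<le> (real m + 3)\<^sup>2 * (real l + 1) ^ (m + 4)"
  unfolding lam mult_1
  by (intro allI impI abs_gegenbauer_poly_half_integer_le abs_gegenbauer_poly_deriv_le abs_gegenbauer_poly_deriv2_le; assumption)+

lemmas series0 = uniform_limit_series[where P = "\<lambda>l t. poly (gegenbauer_poly lam l) t", OF gegenbauer_poly_bounds(1), folded F_def]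
lemmas series1 = uniform_limit_series[where P = "\<lambda>l t. poly (pderiv (gegenbauer_poly lam l)) t", OF gegenbauer_poly_bounds(2), folded F1_def]
lemmas series2 = uniform_limit_series[where P = "\<lambda>l t. poly (pderiv (pderiv (gegenbauer_poly lam l))) t", OF gegenbauer_poly_bounds(3), folded F2_def]

lemma series_deriv:
  fixes P P' :: "nat \<Rightarrow> real \<Rightarrow> real"
  assumes P: "\<forall>l t. \<bar>t\<bar> \<le> 1 \<longrightarrow> \<bar>P l t\<bar> \<le> c * (real l + 1) ^ p"
    and P': "\<forall>l t. \<bar>t\<bar> \<le> 1 \<longrightarrow> \<bar>P' l t\<bar> \<le> c' * (real l + 1) ^ p'"
    and deriv: "\<And>l t. (P l has_real_derivative P' l t) (at t)" and t: "t \<in> {-1..1}"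
  shows "((\<lambda>t. \<Sum>l. a l * P l t) has_real_derivative (\<Sum>l. a l * P' l t)) (at t within {-1..1})"
proof -
  have "\<exists>G. \<forall>t\<in>{-1..1}. (\<lambda>l. a l * P l t) sums G t \<and> (G has_real_derivative (\<Sum>l. a l * P' l t)) (at t within {-1..1})"
  proof (rule has_field_derivative_series)
    show "((\<lambda>t. a l * P l t) has_real_derivative a l * P' l t) (at t within {-1..1})" for l t
      by (rule DERIV_cmult[OF has_field_derivative_at_within[OF deriv]])
    show "uniform_limit {-1..1} (\<lambda>n t. \<Sum>i<n. a i * P' i t) (\<lambda>t. \<Sum>l. a l * P' l t) sequentially"
      by (rule uniform_limit_series(1)[OF P'])
    show "summable (\<lambda>n. a n * P n 0)" by (rule uniform_limit_series(2)[OF P]) auto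
  qed auto
  then obtain G where G: "\<And>t. t \<in> {-1..1} \<Longrightarrow> (\<lambda>l. a l * P l t) sums G t"
      "\<And>t. t \<in> {-1..1} \<Longrightarrow> (G has_real_derivative (\<Sum>l. a l * P' l t)) (at t within {-1..1})" by blast
  show ?thesis
    using has_derivative_transform[OF t _ G(2)[OF t, unfolded has_field_derivative_def], of "\<lambda>t. \<Sum>l. a l * P l t"]
      sums_unique[OF G(1)] by (simp add: has_field_derivative_def)
qed

sublocale zonal_C2 F F1 F2 k
proof
  fix t :: real assume t: "t \<in> {-1..1}"
  show "(F has_real_derivative F1 t) (at t within {-1..1})"
    unfolding F_def F1_def 
    by (rule series_deriv[where P = "\<lambda>l t. poly (gegenbauer_poly lam l) t" and P' = "\<lambda>l t. poly (pderiv (gegenbauer_poly lam l)) t",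
          OF gegenbauer_poly_bounds(1,2) poly_DERIV t])
  show "(F1 has_real_derivative F2 t) (at t within {-1..1})"
    unfolding F1_def F2_def 
    by (rule series_deriv[where P = "\<lambda>l t. poly (pderiv (gegenbauer_poly lam l)) t"
          and P' = "\<lambda>l t. poly (pderiv (pderiv (gegenbauer_poly lam l))) t", OF gegenbauer_poly_bounds(2,3) poly_DERIV t])
next
  have "continuous_on {-1..1} (\<lambda>t. F2 t)"
    by (rule uniform_limit_theorem[OF _ series2(1)]) (auto intro!: always_eventually continuous_intros)
  then show "continuous_on {-1..1} F2" by simp
qed

abbreviation "S N \<equiv> zonal_sum lam g N"

lemma pderiv_sum: "pderiv (\<Sum>i\<in>A. p i) = (\<Sum>i\<in>A. pderiv (p i))" for p :: "nat \<Rightarrow> real poly"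
  by (induction A rule: infinite_finite_induct) (simp_all add: pderiv_add)

lemma poly_S: "poly (S N) t = (\<Sum>l<N. a l * poly (gegenbauer_poly lam l) t)"
  "poly (pderiv (S N)) t = (\<Sum>l<N. a l * poly (pderiv (gegenbauer_poly lam l)) t)"
  "poly (pderiv (pderiv (S N))) t = (\<Sum>l<N. a l * poly (pderiv (pderiv (gegenbauer_poly lam l))) t)"
  by (simp_all add: zonal_sum_def poly_sum pderiv_sum pderiv_smult)

lemma S_lim:
  assumes "t \<in> {-1..1}"
  shows "(\<lambda>N. poly (S N) t) \<longlonglongrightarrow> F t" "(\<lambda>N. poly (pderiv (S N)) t) \<longlonglongrightarrow> F1 t"
    "(\<lambda>N. poly (pderiv (pderiv (S N))) t) \<longlonglongrightarrow> F2 t"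
  unfolding poly_S F_def F1_def F2_def
  using series0(2)[OF assms] series1(2)[OF assms] series2(2)[OF assms] by (simp_all add: summable_LIMSEQ)

lemma S_bound:
  "\<exists>M\<ge>0. \<forall>N. \<forall>t\<in>{-1..1}. \<bar>poly (S N) t\<bar> \<le> M \<and> \<bar>poly (pderiv (S N)) t\<bar> \<le> M \<and> \<bar>poly (pderiv (pderiv (S N))) t\<bar> \<le> M"
proof -
  obtain M0 where M0: "\<forall>N. \<forall>t\<in>{-1..1}. \<bar>poly (S N) t\<bar> \<le> M0"
    using series0(3) unfolding poly_S by blast
  obtain M1 where M1: "\<forall>N. \<forall>t\<in>{-1..1}. \<bar>poly (pderiv (S N)) t\<bar> \<le> M1"
    using series1(3) unfolding poly_S by blast
  obtain M2 where M2: "\<forall>N. \<forall>t\<in>{-1..1}. \<bar>poly (pderiv (pderiv (S N))) t\<bar> \<le> M2"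
    using series2(3) unfolding poly_S by blast
  show ?thesis by (rule exI[of _ "max 0 (max M0 (max M1 M2))"]) (use M0 M1 M2 in \<open>simp add: le_max_iff_disj\<close>)
qed

definition "moment_k = (LINT x|(surface_measure :: (real ^ 'd) measure). (F (x $ k))\<^sup>2 * x $ k)"

definition "energy = - (LINT x|(surface_measure :: (real ^ 'd) measure).
   ((1 - (x $ k)\<^sup>2) * F2 (x $ k) - (2 * lam + 1) * x $ k * F1 (x $ k)) * F (x $ k))"

lemma cont_F0: "continuous_on {-1..1} F"
  using F1 by (metis DERIV_continuous continuous_on_eq_continuous_within)

lemma cont_coord: "continuous_on {-1..1} G \<Longrightarrow> continuous_on (sphere 0 1) (\<lambda>x :: real ^ 'd. G (x $ k))" for G :: "real \<Rightarrow> real"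
  by (rule continuous_on_compose2[of "{-1..1}" G])
     (use abs_coord_le_1 in \<open>fastforce intro!: continuous_intros simp: abs_le_iff\<close>)+

lemma mass_eq: "mass f = (LINT x|(surface_measure :: (real ^ 'd) measure). (F (x $ k))\<^sup>2)"
  by (simp add: mass_def f_def)

lemma moment_component: "moment f $ k = moment_k"
proof -
  have "integrable surface_measure (\<lambda>x. (cmod (f x))\<^sup>2 *\<^sub>R x)"
    unfolding f_def norm_of_real power2_abs
    by (intro integrable_surface_continuous continuous_intros cont_coord cont_F0)
  then have "moment f \<bullet> axis k 1 = (LINT x|surface_measure. ((cmod (f x))\<^sup>2 *\<^sub>R x) \<bullet> axis k 1)"
    unfolding moment_def by (intro integral_inner_left[symmetric])
  then show ?thesis by (simp add: moment_k_def f_def inner_axis)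
qed

lemma var_M_eq: "var_M f = energy / mass f"
proof -
  have "(LINT x|surface_measure. laplace_beltrami f x * cnj (f x)) =
     (LINT x|(surface_measure :: (real ^ 'd) measure). complex_of_real (((1 - (x $ k)\<^sup>2) * F2 (x $ k) - (2 * lam + 1) * x $ k * F1 (x $ k)) * F (x $ k)))"
  proof (intro Bochner_Integration.integral_cong refl)
    have n: "real CARD('d) - 1 = 2 * lam + 1" by (simp add: dim lam)
    fix x :: "real ^ 'd" assume "x \<in> space surface_measure"
    then show "laplace_beltrami f x * cnj (f x) = complex_of_real (((1 - (x $ k)\<^sup>2) * F2 (x $ k)
        - (2 * lam + 1) * x $ k * F1 (x $ k)) * F (x $ k))"
      using laplace_beltrami_f[of x] unfolding n by (simp add: f_def)
  qed
  then show ?thesis by (simp only: var_M_def energy_def integral_complex_of_real Re_complex_of_real)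
qed

lemma mass_lim: "(\<lambda>N. zonal_int k (S N * S N)) \<longlonglongrightarrow> mass f"
proof -
  obtain M where M: "M \<ge> 0" "\<And>N t. t \<in> {-1..1} \<Longrightarrow> \<bar>poly (S N) t\<bar> \<le> M" using S_bound by blast
  show ?thesis unfolding mass_eq
  proof (rule zonal_int_tendsto)
    fix t :: real assume t: "t \<in> {-1..1}"
    show "(\<lambda>N. poly (S N * S N) t) \<longlonglongrightarrow> (F t)\<^sup>2"
      unfolding poly_mult power2_eq_square by (intro tendsto_intros S_lim t)
    show "\<bar>poly (S N * S N) t\<bar> \<le> M * M" for N
      unfolding poly_mult abs_mult using M by (intro mult_mono M(2) t) auto
  qed
qed

lemma defect_lim: "(\<lambda>N. zonal_int k ([:1, -1:] * (S N * S N))) \<longlonglongrightarrow> mass f - moment_k"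
proof -
  obtain M where M: "M \<ge> 0" "\<And>N t. t \<in> {-1..1} \<Longrightarrow> \<bar>poly (S N) t\<bar> \<le> M" using S_bound by blast
  have "(\<lambda>N. zonal_int k ([:1, -1:] * (S N * S N))) \<longlonglongrightarrow>
     (LINT x|(surface_measure :: (real ^ 'd) measure). (1 - x $ k) * (F (x $ k))\<^sup>2)"
  proof (rule zonal_int_tendsto)
    fix t :: real assume t: "t \<in> {-1..1}"
    have "poly [:1, -1:] t = 1 - t" by simp
    then show "(\<lambda>N. poly ([:1, -1:] * (S N * S N)) t) \<longlonglongrightarrow> (1 - t) * (F t)\<^sup>2"
      unfolding poly_mult power2_eq_square by (simp only:) (intro tendsto_intros S_lim t)
    show "\<bar>poly ([:1, -1:] * (S N * S N)) t\<bar> \<le> 2 * (M * M)" for N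
      unfolding poly_mult abs_mult using M t by (intro mult_mono M(2) t) auto
  qed
  also have "(LINT x|(surface_measure :: (real ^ 'd) measure). (1 - x $ k) * (F (x $ k))\<^sup>2) = mass f - moment_k"
    unfolding mass_eq moment_k_def left_diff_distrib mult_1 mult.commute[of "_ $ k"]
    by (rule Bochner_Integration.integral_diff)
       (intro integrable_surface_continuous continuous_intros cont_coord cont_F0)+
  finally show ?thesis .
qed

lemma energy_lim: "(\<lambda>N. zonal_int k (zonal_laplacian lam (S N) * S N)) \<longlonglongrightarrow> - energy"
proof -
  obtain M where M: "M \<ge> 0" "\<And>N t. t \<in> {-1..1} \<Longrightarrow> \<bar>poly (S N) t\<bar> \<le> M"
    "\<And>N t. t \<in> {-1..1} \<Longrightarrow> \<bar>poly (pderiv (S N)) t\<bar> \<le> M"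
    "\<And>N t. t \<in> {-1..1} \<Longrightarrow> \<bar>poly (pderiv (pderiv (S N))) t\<bar> \<le> M" using S_bound by blast
  have lam0: "2 * lam + 1 \<ge> 0" by (simp add: lam)
  have eq: "poly (zonal_laplacian lam (S N) * S N) t =
     ((1 - t\<^sup>2) * poly (pderiv (pderiv (S N))) t - (2 * lam + 1) * t * poly (pderiv (S N)) t) * poly (S N) t" for N t
    by (simp add: zonal_laplacian_def power2_eq_square algebra_simps)
  show ?thesis unfolding energy_def minus_minus
  proof (rule zonal_int_tendsto)
    fix t :: real assume t: "t \<in> {-1..1}"
    then have t': "\<bar>t\<bar> \<le> 1" by auto
    then have t2: "\<bar>1 - t\<^sup>2\<bar> \<le> 1" using abs_square_le_1[of t] by simp
    show "(\<lambda>N. poly (zonal_laplacian lam (S N) * S N) t) \<longlonglongrightarrow>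
       ((1 - t\<^sup>2) * F2 t - (2 * lam + 1) * t * F1 t) * F t"
      unfolding eq by (intro tendsto_intros S_lim t)
    show "\<bar>poly (zonal_laplacian lam (S N) * S N) t\<bar> \<le> (1 * M + (2 * lam + 1) * 1 * M) * M" for N
    proof -
      have "\<bar>(1 - t\<^sup>2) * poly (pderiv (pderiv (S N))) t\<bar> \<le> 1 * M"
        unfolding abs_mult by (intro mult_mono t2 M(4)[OF t]) auto
      moreover have "\<bar>(2 * lam + 1) * t * poly (pderiv (S N)) t\<bar> \<le> (2 * lam + 1) * 1 * M"
        unfolding abs_mult using lam0 t' by (intro mult_mono M(3)[OF t]) auto
      ultimately have "\<bar>(1 - t\<^sup>2) * poly (pderiv (pderiv (S N))) t - (2 * lam + 1) * t * poly (pderiv (S N)) t\<bar>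
          \<le> 1 * M + (2 * lam + 1) * 1 * M" by linarith
      then show ?thesis unfolding eq abs_mult[of _ "poly (S N) t"]
        using M(1) lam0 by (intro mult_mono M(2)[OF t]) auto
    qed
  qed
qed

text \<open>The three finite-sum estimates pass to the limit, up to the common factor \<open>\<sigma>\<close>, the measure of
  the sphere. Writing \<open>M\<close> for the mass and \<open>\<mu>\<close> for the coordinate \<open>k\<close> of the moment, \<open>2 * A \<le> Q\<close>
  forces \<open>\<mu> \<ge> M / 2\<close>, and \<open>(M / \<mu>)\<^sup>2 - 1 = (M - \<mu>) * (M + \<mu>) / \<mu>\<^sup>2 \<le> 8 * (M - \<mu>) / M\<close>. Bounding the
  moment below by its coordinate \<open>k\<close> is enough for an upper bound of the variance in space.\<close>
lemma uncertainty_bound: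
  assumes defect: "\<And>N. (\<Sum>l<N. coupling_weight m l * (g (Suc l) - g l)\<^sup>2) + coupling_weight m N * (g N)\<^sup>2 \<le> A"
    and energy: "\<And>N. (\<Sum>l<N. real l * (real l + 2 * lam) * harmonic_weight m l * (g l)\<^sup>2) \<le> B"
    and mass: "\<And>N. N \<ge> N0 \<Longrightarrow> Q \<le> (\<Sum>l<N. harmonic_weight m l * (g l)\<^sup>2)"
    and Q: "Q > 0" and AQ: "2 * A \<le> Q"
  shows "moment f \<noteq> 0" "uncertainty_product f \<le> sqrt (8 * A / Q) * sqrt (B / Q)"
proof -
  define \<sigma> where "\<sigma> = zonal_int k 1"
  have \<sigma>: "\<sigma> > 0" unfolding \<sigma>_def by (rule zonal_int_1_pos)
  have mass_ge: "\<sigma> * Q \<le> mass f"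
  proof (rule LIMSEQ_le_const[OF mass_lim], intro exI[of _ N0] allI impI)
    fix N assume "N0 \<le> N"
    then show "\<sigma> * Q \<le> zonal_int k (S N * S N)"
      unfolding zonal_int_zonal_sum_sq[OF dim lam] \<sigma>_def[symmetric] using \<sigma> mass by (intro mult_left_mono) auto
  qed
  have sQ: "\<sigma> * Q > 0" using \<sigma> Q by simp
  then have mass0: "mass f > 0" using mass_ge by linarith
  have defect_le: "mass f - moment_k \<le> \<sigma> * A"
  proof (rule LIMSEQ_le_const2[OF LIMSEQ_Suc[OF defect_lim]], intro exI[of _ 0] allI impI)
    fix N
    show "zonal_int k ([:1, -1:] * (S (Suc N) * S (Suc N))) \<le> \<sigma> * A"
      unfolding zonal_int_one_minus_X_zonal_sum_sq[OF dim lam] \<sigma>_def[symmetric] using \<sigma> defect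
      by (intro mult_left_mono) auto
  qed
  have defect_ge: "0 \<le> mass f - moment_k"
  proof (rule LIMSEQ_le_const[OF LIMSEQ_Suc[OF defect_lim]], intro exI[of _ 0] allI impI)
    fix N
    show "0 \<le> zonal_int k ([:1, -1:] * (S (Suc N) * S (Suc N)))"
      unfolding zonal_int_one_minus_X_zonal_sum_sq[OF dim lam] \<sigma>_def[symmetric] using \<sigma>
      by (intro mult_nonneg_nonneg add_nonneg_nonneg sum_nonneg) (auto simp: coupling_weight_def)
  qed
  have energy_neg: "zonal_int k (zonal_laplacian lam (S N) * S N) =
      - (\<sigma> * (\<Sum>l<N. real l * (real l + 2 * lam) * harmonic_weight m l * (g l)\<^sup>2))" for N
    unfolding zonal_int_zonal_sum_laplacian[OF dim lam] \<sigma>_def by simp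
  have energy_le: "- (\<sigma> * B) \<le> - energy"
  proof (rule LIMSEQ_le_const[OF energy_lim], intro exI[of _ 0] allI impI)
    fix N
    show "- (\<sigma> * B) \<le> zonal_int k (zonal_laplacian lam (S N) * S N)"
      unfolding energy_neg using \<sigma> energy[of N] by simp
  qed
  have energy_ge: "- energy \<le> 0"
  proof (rule LIMSEQ_le_const2[OF energy_lim], intro exI[of _ 0] allI impI)
    fix N
    have "(\<Sum>l<N. real l * (real l + 2 * lam) * harmonic_weight m l * (g l)\<^sup>2) \<ge> 0"
      by (intro sum_nonneg mult_nonneg_nonneg harmonic_weight_nonneg) (auto simp: lam)
    then show "zonal_int k (zonal_laplacian lam (S N) * S N) \<le> 0"
      unfolding energy_neg using \<sigma> by simp
  qed
  define M where "M = mass f"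
  have "2 * (\<sigma> * A) \<le> \<sigma> * Q" using AQ \<sigma> by simp
  then have half: "M / 2 \<le> moment_k" using defect_le mass_ge by (simp add: M_def)
  have M0: "M > 0" using mass0 by (simp add: M_def)
  have mk0: "moment_k > 0" using half M0 by linarith
  have norm_ge: "moment_k \<le> norm (moment f)"
    using component_le_norm_cart[of "moment f" k] mk0 by (simp add: moment_component)
  then show "moment f \<noteq> 0" using mk0 by auto
  have "0 \<le> \<sigma> * A" using defect_le defect_ge by linarith
  then have A0: "A \<ge> 0" using \<sigma> by (simp add: zero_le_mult_iff)
  have frac: "(M - moment_k) / M \<le> A / Q"
  proof -
    have "(M - moment_k) / M \<le> (\<sigma> * A) / M" using defect_le M0 by (intro divide_right_mono) (auto simp: M_def)
    also have "\<dots> \<le> (\<sigma> * A) / (\<sigma> * Q)" using mass_ge sQ A0 \<sigma> by (intro divide_left_mono) (auto simp: M_def)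
    finally show ?thesis using \<sigma> by simp
  qed
  have "M / norm (moment f) \<le> M / moment_k"
    by (rule divide_left_mono[OF norm_ge]) (use norm_ge mk0 M0 in \<open>auto intro!: mult_pos_pos\<close>)
  then have "(M / norm (moment f))\<^sup>2 \<le> (M / moment_k)\<^sup>2"
    by (rule power_mono) (use M0 in simp)
  then have "var_S f \<le> (M / moment_k)\<^sup>2 - 1"
    unfolding var_S_def M_def[symmetric] by simp
  also have "\<dots> = (M - moment_k) * (M + moment_k) / moment_k\<^sup>2"
    using mk0 by (simp add: power2_eq_square field_simps)
  also have "\<dots> \<le> (M - moment_k) * (2 * M) / (M / 2)\<^sup>2"
    using half M0 mk0 defect_ge by (intro frac_le mult_left_mono power_mono mult_nonneg_nonneg) (auto simp: M_def)
  also have "\<dots> = 8 * ((M - moment_k) / M)" using M0 by (simp add: power2_eq_square field_simps)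
  also have "\<dots> \<le> 8 * (A / Q)" by (rule mult_left_mono[OF frac]) simp
  finally have varS: "var_S f \<le> 8 * A / Q" by simp
  have "0 \<le> \<sigma> * B" using energy_le energy_ge by linarith
  then have B0: "B \<ge> 0" using \<sigma> by (simp add: zero_le_mult_iff)
  have "var_M f \<le> (\<sigma> * B) / mass f"
    unfolding var_M_eq using energy_le mass0 by (intro divide_right_mono) auto
  also have "\<dots> \<le> (\<sigma> * B) / (\<sigma> * Q)" using mass_ge sQ mass0 B0 \<sigma> by (intro divide_left_mono) auto
  finally have varM: "var_M f \<le> B / Q" using \<sigma> by simp
  have "var_M f \<ge> 0" unfolding var_M_eq using energy_ge mass0 by simp
  then show "uncertainty_product f \<le> sqrt (8 * A / Q) * sqrt (B / Q)"
    unfolding uncertainty_product_def using varS varM A0 Q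
    by (intro mult_mono real_sqrt_le_mono) auto
qed

end

section \<open>The uncertainty product\<close>

lemma Psi_coeff_eq: "Psi_coeff lam a c q \<rho> = zonal_coeff lam (profile c q (\<rho> powr a))"
  by (rule ext) (simp add: Psi_coeff_def zonal_coeff_def profile_def)

theorem theorem3p4:
  fixes n \<nu> :: nat and lam a c :: real and q :: "real poly" and k :: "'d::finite"
  assumes "n \<ge> 2" and "CARD('d) = n + 1" and "lam = (real n - 1) / 2"
    and "a > 0" and "c > 0"
    and "degree q = \<nu>" and "\<nu> \<ge> 1"
    and "\<forall>l::nat. l \<ge> 1 \<longrightarrow> poly q (real l) > 0"
    and "mono_on {1::nat..} (\<lambda>l. poly q (real l))"
    and "\<forall>\<rho>>0. rpow_defined (\<rho> powr a * poly q 0) c"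
  shows "\<exists>C>0. \<exists>\<rho>0>0. \<forall>\<rho>. 0 < \<rho> \<and> \<rho> < \<rho>0 \<longrightarrow>
           (\<forall>x\<in>sphere 0 1. summable (Psi_term lam a c q k \<rho> x)) \<and>
           uncertainty_defined (Psi lam a c q k \<rho>) \<and>
           uncertainty_product (Psi lam a c q k \<rho>) \<le> C * \<rho> powr (- (a / (2 * real \<nu>)))"
proof -
  define m where "m = n - 2"
  have dim: "CARD('d) = m + 3" and lam: "lam = (real m + 1) / 2"
    using assms(1-3) by (auto simp: m_def of_nat_diff)
  have lam_pos: "lam > 0" by (simp add: lam)
  have deg: "degree q \<ge> 1" using assms(6,7) by simp
  obtain K \<beta> h0 where pos: "0 < K" "0 < \<beta>" "0 < h0" and prof:
    "\<forall>\<epsilon> L. 0 < \<epsilon> \<and> \<epsilon> \<le> 1 \<and> 1 \<le> L \<and> \<epsilon> * L ^ degree q = 1 \<and> rpow_defined (\<epsilon> * poly q 0) c \<longrightarrow>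
      (\<exists>W. (\<forall>l. \<bar>profile c q \<epsilon> l\<bar> \<le> W l) \<and> (\<forall>l. W l \<le> K * exp (- \<beta> * real l / L)) \<and>
           (\<forall>l. \<bar>profile c q \<epsilon> (Suc l) - profile c q \<epsilon> l\<bar> \<le> W l - W (Suc l))) \<and>
      (\<forall>l. L \<le> real l \<and> real l \<le> 2 * L \<longrightarrow> h0 \<le> profile c q \<epsilon> l)"
    using profile_bounds[OF assms(5) deg assms(8,9)] by (elim exE conjE) (rule that)
  obtain C1 where C1: "C1 > 0" and defect:
    "\<forall>L\<ge>1. \<forall>g W N. (\<forall>l. \<bar>g l\<bar> \<le> W l) \<and> (\<forall>l. W l \<le> K * exp (- \<beta> * real l / L)) \<and>
       (\<forall>l. \<bar>g (Suc l) - g l\<bar> \<le> W l - W (Suc l)) \<longrightarrow>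
       (\<Sum>l<N. coupling_weight m l * (g (Suc l) - g l)\<^sup>2) + coupling_weight m N * (g N)\<^sup>2 \<le> C1 * L ^ (m + 1)"
    using localisation_defect_le[OF pos(1,2), of m] by (elim exE conjE) (rule that)
  obtain C2 where C2: "C2 > 0" and energy:
    "\<forall>L\<ge>1. \<forall>g N. (\<forall>l. \<bar>g l\<bar> \<le> K * exp (- \<beta> * real l / L)) \<longrightarrow>
       (\<Sum>l<N. real l * (real l + 2 * lam) * harmonic_weight m l * (g l)\<^sup>2) \<le> C2 * L ^ (m + 4)"
    using laplacian_energy_le[OF pos(1,2) lam] by (elim exE conjE) (rule that)
  define C3 where "C3 = h0\<^sup>2 / (2 * (real m + 1) ^ (m + 1))"
  have C3: "C3 > 0" using pos by (simp add: C3_def add_pos_pos)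
  \<comment> \<open>from this \<open>L\<close> on the defect is at most half of the mass\<close>
  define L0 where "L0 = max 2 (2 * C1 / C3)"
  define C where "C = sqrt (8 * C1 / C3) * sqrt (C2 / C3)"
  have C: "C > 0" using C1 C2 C3 by (simp add: C_def)
  define \<rho>0 where "\<rho>0 = L0 powr (- (real \<nu> / a))"
  have \<rho>0: "\<rho>0 > 0" by (simp add: \<rho>0_def L0_def)
  have main: "(\<forall>x\<in>sphere 0 1. summable (Psi_term lam a c q k \<rho> x)) \<and>
           uncertainty_defined (Psi lam a c q k \<rho>) \<and>
           uncertainty_product (Psi lam a c q k \<rho>) \<le> C * \<rho> powr (- (a / (2 * real \<nu>)))"
    if \<rho>: "0 < \<rho>" "\<rho> < \<rho>0" for \<rho>
  proof -
    define L where "L = \<rho> powr (- (a / real \<nu>))"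
    have \<nu>: "real \<nu> > 0" using assms(7) by simp
    have "L0 = \<rho>0 powr (- (a / real \<nu>))"
      using \<nu> assms(4) by (simp add: \<rho>0_def powr_powr L0_def)
    also have "\<dots> \<le> L" unfolding L_def using \<rho> \<nu> assms(4) by (intro powr_mono2') auto
    finally have L0: "L0 \<le> L" .
    then have L2: "L \<ge> 2" and LC: "2 * C1 / C3 \<le> L" by (auto simp: L0_def)
    then have L1: "L \<ge> 1" by simp
    define \<epsilon> where "\<epsilon> = \<rho> powr a"
    have \<epsilon>0: "\<epsilon> > 0" using \<rho> by (simp add: \<epsilon>_def)
    have "L ^ degree q = L powr real \<nu>" using L1 assms(6) by (simp add: powr_realpow)
    also have "\<dots> = \<rho> powr (- a)" using \<nu> by (simp add: L_def powr_powr)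
    finally have \<epsilon>L: "\<epsilon> * L ^ degree q = 1" using \<rho> by (simp add: \<epsilon>_def powr_minus)
    have "1 \<le> L ^ degree q" using L1 by (rule one_le_power)
    then have \<epsilon>1: "\<epsilon> \<le> 1" using \<epsilon>L \<epsilon>0 mult_left_mono[of 1 "L ^ degree q" \<epsilon>] by simp
    define g where "g = profile c q \<epsilon>"
    have def0: "rpow_defined (\<epsilon> * poly q 0) c" using assms(10) \<rho> by (simp add: \<epsilon>_def)
    from prof[rule_format, of \<epsilon> L] \<epsilon>0 \<epsilon>1 L1 \<epsilon>L def0 obtain W
      where W: "(\<forall>l. \<bar>g l\<bar> \<le> W l) \<and> (\<forall>l. W l \<le> K * exp (- \<beta> * real l / L)) \<and>
           (\<forall>l. \<bar>g (Suc l) - g l\<bar> \<le> W l - W (Suc l))"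
        and g_ge: "\<And>l. L \<le> real l \<Longrightarrow> real l \<le> 2 * L \<Longrightarrow> h0 \<le> g l"
      unfolding g_def by blast
    have decay: "\<bar>g l\<bar> \<le> K * exp (- \<beta> * real l / L)" for l using W order_trans by blast
    interpret zonal_series m lam K \<beta> L g k
      by unfold_locales (use dim lam pos L1 decay in auto)
    have Psi_eq: "Psi lam a c q k \<rho> = f"
    proof (rule ext)
      fix x
      have "Psi lam a c q k \<rho> x = complex_of_real (F (x $ k))"
        unfolding Psi_def F_def Psi_term_def Psi_coeff_eq gegenbauer_eq_poly[OF lam_pos]
        unfolding g_def \<epsilon>_def ..
      then show "Psi lam a c q k \<rho> x = f x" by (simp only: f_def)
    qed
    have summable: "summable (Psi_term lam a c q k \<rho> x)" if x: "x \<in> sphere 0 1" for x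
    proof -
      have "x $ k \<in> {-1..1}" using abs_coord_le_1[OF x, of k] by auto
      from series0(2)[OF this] show ?thesis
        unfolding Psi_term_def[abs_def] Psi_coeff_eq gegenbauer_eq_poly[OF lam_pos] by (simp add: g_def \<epsilon>_def)
    qed
    have b1: "(\<Sum>l<N. coupling_weight m l * (g (Suc l) - g l)\<^sup>2) + coupling_weight m N * (g N)\<^sup>2 \<le> C1 * L ^ (m + 1)" for N
      using defect[rule_format, OF L1 W] .
    have b2: "(\<Sum>l<N. real l * (real l + 2 * lam) * harmonic_weight m l * (g l)\<^sup>2) \<le> C2 * L ^ (m + 4)" for N
      by (rule energy[rule_format, OF L1 decay])
    have b3: "C3 * L ^ (m + 2) \<le> (\<Sum>l<N. harmonic_weight m l * (g l)\<^sup>2)" if "N \<ge> nat \<lceil>2 * L\<rceil> + 1" for N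
      unfolding C3_def by (rule harmonic_mass_ge[OF L2 pos(3) g_ge]) (use that in linarith)+
    have Q: "C3 * L ^ (m + 2) > 0" using C3 L1 by simp
    have "2 * C1 \<le> C3 * L" using LC C3 by (simp add: field_simps)
    then have "2 * C1 * L ^ (m + 1) \<le> C3 * L * L ^ (m + 1)" using L1 by (intro mult_right_mono) auto
    then have AQ: "2 * (C1 * L ^ (m + 1)) \<le> C3 * L ^ (m + 2)" by (simp add: mult_ac)
    note bound = uncertainty_bound[OF b1 b2 b3 Q AQ]
    have "sqrt (8 * (C1 * L ^ (m + 1)) / (C3 * L ^ (m + 2))) * sqrt (C2 * L ^ (m + 4) / (C3 * L ^ (m + 2)))
        = C * sqrt L"
    proof -
      have e1: "8 * (C1 * L ^ (m + 1)) / (C3 * L ^ (m + 2)) = (8 * C1 / C3) * (1 / L)"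
        using L1 C3 by (simp add: field_simps)
      have e2: "C2 * L ^ (m + 4) / (C3 * L ^ (m + 2)) = (C2 / C3) * (L * L)"
        using L1 C3 by (simp add: field_simps power_add power2_eq_square numeral_eq_Suc)
      have "sqrt (1 / L) * sqrt (L * L) = sqrt L"
      proof -
        have "sqrt (1 / L) * sqrt (L * L) = sqrt (1 / L * (L * L))" by (simp only: real_sqrt_mult)
        also have "1 / L * (L * L) = L" using L1 by simp
        finally show ?thesis .
      qed
      then show ?thesis unfolding e1 e2 C_def real_sqrt_mult[of "8 * C1 / C3"] real_sqrt_mult[of "C2 / C3"]
        by (metis (no_types, opaque_lifting) mult.assoc mult.left_commute)
    qed
    moreover have "sqrt L = \<rho> powr (- (a / (2 * real \<nu>)))"
      using \<rho> by (simp add: L_def powr_half_sqrt[symmetric] powr_powr mult.commute)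
    ultimately show ?thesis
      using summable bound C2_on_sphere_f by (simp add: uncertainty_defined_def Psi_eq)
  qed
  show ?thesis using C \<rho>0 main by blast
qed

end
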